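(* Let $x$ be an indeterminate, $\mathbb K=\mathbb Q(x)$, $k\ge2$ and $0\le r\le k$. For $p\in\mathcal P_k$ let $p'$ denote $p$ with its last entry deleted. Then $\tilde{\mathcal P}_k^r=\mathcal P_k^{r,1}\sqcup\mathcal P_k^{r,0}\sqcup\{[p]:p\in\mathcal P_k^{r,-1}\}$ is a basis of $\mathsf C_k^{(r)}$, and with respect to it the Gram matrix of $\langle\cdot,\cdot\rangle$ is block diagonal: $$\begin{pmatrix}\mathsf G_{k-1}^{(r-1)}&0&0\\0&\mathsf G_{k-1}^{(r)}&0\\0&0&\frac{u_{r+1}(x-1)}{u_r(x-1)}\mathsf G_{k-1}^{(r+1)}\end{pmatrix},$$ where the three blocks are indexed via the bijections $\mathcal P_k^{r,1}\to\mathcal P_{k-1}^{r-1}$, $p\mapsto p'$; $\mathcal P_k^{r,0}\to\mathcal P_{k-1}^{r}$, $p\mapsto p'$; and $\mathcal P_k^{r,-1}\to\mathcal P_{k-1}^{r+1}$, $p\mapsto(p_+)'$; i.e. $\langle p,q\rangle=\langle p',q'\rangle$ for $p,q$ both in $\mathcal P_k^{r,1}$ or both in $\mathcal P_k^{r,0}$, $\langle[p],[q]\rangle=\frac{u_{r+1}(x-1)}{u_r(x-1)}\langle(p_+)',(q_+)'\rangle$ for $p,q\in\mathcal P_k^{r,-1}$, and all pairings between different blocks vanish. Blocks $\mathsf G_j^{(i)}$ with $i<0$ or $i>j$ are empty.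
   Context: Motzkin algebra: a Motzkin $k$-diagram has top vertices $1..k$, bottom vertices $1'..k'$, edges each joining two distinct vertices, each vertex on at most one edge, edges planar. $\mathsf M_k(x)$: free $\mathbb K$-module on such diagrams with product: stack $d_1$ above $d_2$, let $d_3$ join outer vertices connected by a path, $d_1d_2=x^\kappa d_3$, $\kappa$ the number of closed middle loops. Rank = number of vertical edges; $\mathsf J_{r-1}$ = span of diagrams of rank $\le r-1$. Motzkin paths: $p=(a_1,\dots,a_k)$, $a_i\in\{-1,0,1\}$, partial sums $\ge0$, rank $\sum a_i$; $\mathcal P_k^r$ those of rank $r$; $\mathcal P_k^{r,\ell}$ those with $a_k=\ell$. Index $i$ with $a_i=1$ is paired with the smallest $j>i$ with $a_i+\dots+a_j=0$ if it exists. The 1-factor of $p$: row of vertices $1..k$, paired indices joined by an edge, unpaired $a_i=1$ white, others black; paths and 1-factors are identified. For $p,q\in\mathcal P_k^r$, $d_p^q$ has bottom-row edges $i'$—$j'$ for edges $\{i,j\}$ of $p$, top-row edges $i$—$j$ for edges of $q$, and vertical edges joining the $s$-th white vertex of $q$ (top) to the $s$-th white vertex of $p$ (bottom); other vertices isolated. $\mathsf C_k^{(r)}$ is the free $\mathbb K$-module on $\mathcal P_k^r$, with bilinear form $d_p^pd_q^q\equiv\langle p,q\rangle d_q^p\pmod{\mathsf J_{r-1}}$; $\mathsf G_k^{(r)}=(\langle p,q\rangle)_{p,q\in\mathcal P_k^r}$ is its Gram matrix. Chebyshev: $u_0(y)=1$, $u_1(y)=y$, $u_m(y)=y\,u_{m-1}(y)-u_{m-2}(y)$.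 For $p\in\mathcal P_k^{r,-1}$ the pivot edge is the edge $\{i,k\}$ of $p$. In general a pivot edge is a designated edge $\{i,j\}$ not nested in any other edge; $s$ = number of white vertices left of $i$; $p_\bullet$ is $p$ with the pivot edge deleted; $p^{(1)}=0$ if $s=0$, otherwise, with $m<i$ the rightmost white vertex, $p^{(1)}$ is obtained by deleting the pivot edge, adding the edge $\{m,i\}$ (the pivot of $p^{(1)}$) and coloring $j$ white; recursively $[0]=0$, $[p]=p-p_\bullet-\frac{u_{s-1}(x-1)}{u_s(x-1)}[p^{(1)}]$. $p_+$ is $p$ with the pivot edge removed and both endpoints colored white. *)

theory Defs
  imports "HOL-Computational_Algebra.Polynomial" "HOL-Computational_Algebra.Fraction_Field"
begin

type_synonym K = "rat poly fract"

definition X :: K where "X = Fract [:0, 1:] 1"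

fun cheb_u :: "nat \<Rightarrow> 'a::comm_ring_1 \<Rightarrow> 'a" where
  "cheb_u 0 y = 1"
| "cheb_u (Suc 0) y = y"
| "cheb_u (Suc (Suc m)) y = y * cheb_u (Suc m) y - cheb_u m y"

datatype vtx = Top nat | Bot nat

text \<open>A diagram is a set of edges; each edge is a two-element set of vertices.\<close>
type_synonym diagram = "vtx set set"

text \<open>Stacking d1 above d2: levels 0 (top of d1), 1 (middle), 2 (bottom of d2).\<close>
definition up1 :: "vtx \<Rightarrow> nat \<times> nat" where
  "up1 v = (case v of Top i \<Rightarrow> (0, i) | Bot i \<Rightarrow> (1, i))"

definition dn2 :: "vtx \<Rightarrow> nat \<times> nat" where
  "dn2 v = (case v of Top i \<Rightarrow> (1, i) | Bot i \<Rightarrow> (2, i))"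

definition cadj :: "diagram \<Rightarrow> diagram \<Rightarrow> nat \<times> nat \<Rightarrow> nat \<times> nat \<Rightarrow> bool" where
  "cadj d1 d2 u v \<longleftrightarrow> u \<noteq> v \<and> ({u, v} \<in> (\<lambda>e. up1 ` e) ` d1 \<or> {u, v} \<in> (\<lambda>e. dn2 ` e) ` d2)"

definition cconn :: "diagram \<Rightarrow> diagram \<Rightarrow> nat \<times> nat \<Rightarrow> nat \<times> nat \<Rightarrow> bool" where
  "cconn d1 d2 = (cadj d1 d2)\<^sup>*\<^sup>*"

definition outv :: "nat \<times> nat \<Rightarrow> vtx" where
  "outv w = (if fst w = 0 then Top (snd w) else Bot (snd w))"

definition compose :: "diagram \<Rightarrow> diagram \<Rightarrow> diagram" where
  "compose d1 d2 = {{outv u, outv v} | u v. fst u \<noteq> 1 \<and> fst v \<noteq> 1 \<and> u \<noteq> v \<and> cconn d1 d2 u v}"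

definition loops :: "diagram \<Rightarrow> diagram \<Rightarrow> nat" where
  "loops d1 d2 = card {{w. cconn d1 d2 v w} | v. fst v = 1 \<and>
     (\<forall>w. cconn d1 d2 v w \<longrightarrow> fst w = 1 \<and> (\<exists>e\<in>d1. Bot (snd w) \<in> e) \<and> (\<exists>e\<in>d2. Top (snd w) \<in> e))}"

definition drank :: "diagram \<Rightarrow> nat" where
  "drank d = card {e \<in> d. \<exists>i j. e = {Top i, Bot j}}"

section \<open>Motzkin paths (positions are 1-based: a_i = p ! (i - 1))\<close>

definition motzkin :: "int list \<Rightarrow> bool" where
  "motzkin p \<longleftrightarrow> set p \<subseteq> {-1, 0, 1} \<and> (\<forall>n \<le> length p. sum_list (take n p) \<ge> 0)"

definition paths :: "nat \<Rightarrow> int \<Rightarrow> int list set" where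
  "paths k r = {p. length p = k \<and> motzkin p \<and> sum_list p = r}"

definition paths_end :: "nat \<Rightarrow> int \<Rightarrow> int \<Rightarrow> int list set" where
  "paths_end k r l = {p \<in> paths k r. last p = l}"

definition seg_sum :: "int list \<Rightarrow> nat \<Rightarrow> nat \<Rightarrow> int" where
  "seg_sum p i j = (\<Sum>l = i..j. p ! (l - 1))"

definition paired :: "int list \<Rightarrow> nat \<Rightarrow> nat \<Rightarrow> bool" where
  "paired p i j \<longleftrightarrow> 1 \<le> i \<and> i < j \<and> j \<le> length p \<and> p ! (i - 1) = 1 \<and>
     seg_sum p i j = 0 \<and> (\<forall>l. i < l \<and> l < j \<longrightarrow> seg_sum p i l \<noteq> 0)"

definition white :: "int list \<Rightarrow> nat \<Rightarrow> bool" where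
  "white p i \<longleftrightarrow> 1 \<le> i \<and> i \<le> length p \<and> p ! (i - 1) = 1 \<and> \<not> (\<exists>j. paired p i j)"

definition whites :: "int list \<Rightarrow> nat list" where
  "whites p = sorted_list_of_set {i. white p i}"

definition diag :: "int list \<Rightarrow> int list \<Rightarrow> diagram" where
  "diag p q = {{Bot i, Bot j} | i j. paired p i j} \<union> {{Top i, Top j} | i j. paired q i j}
     \<union> {{Top (whites q ! s), Bot (whites p ! s)} | s. s < length (whites q)}"

text \<open>The form: d_p^p d_q^q = x^kappa d3 is congruent to form r p q * d_q^p modulo J_(r-1).\<close>
definition form :: "int \<Rightarrow> int list \<Rightarrow> int list \<Rightarrow> K" where
  "form r p q = (let d3 = compose (diag p p) (diag q q) in
     if int (drank d3) < r then 0
     else if d3 = diag q p then X ^ loops (diag p p) (diag q q) else 0)"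

section \<open>The module C_k^(r): vectors are coefficient functions supported on paths k r\<close>

type_synonym vec = "int list \<Rightarrow> K"

definition delta :: "int list \<Rightarrow> vec" where
  "delta p = (\<lambda>q. if q = p then 1 else 0)"

definition formv :: "nat \<Rightarrow> int \<Rightarrow> vec \<Rightarrow> vec \<Rightarrow> K" where
  "formv k r v w = (\<Sum>p\<in>paths k r. \<Sum>q\<in>paths k r. v p * w q * form r p q)"

text \<open>p with pivot edge {i,j} deleted (both endpoints black).\<close>
definition pbullet :: "int list \<Rightarrow> nat \<Rightarrow> nat \<Rightarrow> int list" where
  "pbullet p i j = p[i - 1 := 0, j - 1 := 0]"

text \<open>p with pivot edge {i,j} removed and both endpoints white.\<close>
definition pplus :: "int list \<Rightarrow> nat \<Rightarrow> nat \<Rightarrow> int list" where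
  "pplus p i j = p[i - 1 := 1, j - 1 := 1]"

definition whites_left :: "int list \<Rightarrow> nat \<Rightarrow> nat list" where
  "whites_left p i = filter (\<lambda>w. w < i) (whites p)"

text \<open>p^(1) (for s > 0): delete pivot {i,j}, add edge {m,i} (m rightmost white left of i),
  color j white.\<close>
definition pone :: "int list \<Rightarrow> nat \<Rightarrow> nat \<Rightarrow> int list" where
  "pone p i j = p[i - 1 := -1, j - 1 := 1]"

text \<open>brk s p i j = [p] for p with pivot edge {i,j} and s white vertices left of i.\<close>
fun brk :: "nat \<Rightarrow> int list \<Rightarrow> nat \<Rightarrow> nat \<Rightarrow> vec" where
  "brk 0 p i j = (\<lambda>q. delta p q - delta (pbullet p i j) q)"
| "brk (Suc n) p i j = (\<lambda>q. delta p q - delta (pbullet p i j) q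
     - (cheb_u n (X - 1) / cheb_u (Suc n) (X - 1)) * brk n (pone p i j) (last (whites_left p i)) i q)"

text \<open>For p in P_k^(r,-1) the pivot edge is {i,k}.\<close>
definition pivot_left :: "int list \<Rightarrow> nat" where
  "pivot_left p = (THE i. paired p i (length p))"

definition bracket :: "int list \<Rightarrow> vec" where
  "bracket p = brk (length (whites_left p (pivot_left p))) p (pivot_left p) (length p)"

definition plus_end :: "int list \<Rightarrow> int list" where
  "plus_end p = pplus p (pivot_left p) (length p)"

definition tbasis :: "int list \<Rightarrow> vec" where
  "tbasis p = (if last p = -1 then bracket p else delta p)"

end

theory Submission
  imports Defs "HOL-Library.FuncSet"
begin

text \<open>
  Specialise \<open>x\<close> to a large natural number \<open>n\<close>. Then \<open>\<langle>p,q\<rangle>\<close> counts the colourings of the vertices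
  by \<open>0, \<dots>, n - 1\<close> that are constant on the edges of \<open>p\<close> and of \<open>q\<close>, are \<open>0\<close> on black isolated
  vertices, and are \<open>s\<close> on the \<open>s\<close>-th white vertex of \<open>p\<close> and of \<open>q\<close>: the components of the union of
  the two 1-factors are paths and cycles, and only the cycles are free.

  The colours of the white vertices of a pair of prefixes \<open>(t, q)\<close> define a functional on tensors
  that is planar, i.e. composed of adjacent contractions and evaluations at colour \<open>0\<close>. A tensor
  that is killed by all contractions and evaluations of its first \<open>i\<close> slots (a harmonic tensor) pairs
  to \<open>0\<close> with fewer than \<open>i\<close> further slots, and via a scalar with exactly \<open>i\<close> of them. After clearing
  the denominator \<open>u\<^sub>r(x - 1)\<close>, the bracket \<open>[p]\<close> with \<open>p = t @ [-1]\<close> becomes such a harmonic tensor in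
  the \<open>r + 1\<close> white slots of \<open>t\<close>; harmonicity is the Chebyshev recursion. Hence \<open>\<langle>[p],q\<rangle> = 0\<close> unless
  \<open>q\<close> ends in \<open>-1\<close>. Identities for all large \<open>n\<close> are identities of polynomials in \<open>x\<close>.
\<close>

section \<open>Planar functionals\<close>

text \<open>Why \<open>x - 1\<close>: in the difference of a path and its copy with the pivot edge
  deleted, that edge carries only nonzero colours, so closing it counts \<open>n - 1\<close>.
  Contracting neighbouring slots of the unrolled bracket therefore obeys Temperley-Lieb relations
  with loop value \<open>n - 1\<close>, and the coefficients \<open>(-1)^(r-1-j) u_j / u_r\<close>
  produced by the recursion are those for which \<open>(n - 1) u_j - u_(j+1) - u_(j-1) = 0\<close>
  cancels everything. The obstacle is that the scalar attached to a planar functional is never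
  computed. It depends only on the pair of prefixes and on \<open>n\<close>, so it is found by
  evaluating the same functional on a second harmonic tensor, the one that defines the pairing of
  \<open>t\<close> and \<open>q\<close> at rank \<open>r + 1\<close>. This produces the Gram matrix
  of the third block. What remains is a ratio of two diagonal sums, \<open>1\<close> for that second
  tensor and \<open>(n - 1) u_r - u_(r-1) = u_(r+1)\<close> for the bracket; dividing by the cleared
  denominator \<open>u_r\<close> gives the constant of the block.\<close>

definition ins :: "nat \<Rightarrow> 'a \<Rightarrow> 'a list \<Rightarrow> 'a list" where
  "ins j v l = take j l @ v # drop j l"

definition rem :: "nat \<Rightarrow> 'a list \<Rightarrow> 'a list" where
  "rem j l = take j l @ drop (Suc j) l"

lemma length_ins [simp]: "length (ins j v l) = Suc (length l)"
  by (simp add: ins_def)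

lemma length_rem: "j < length l \<Longrightarrow> length (rem j l) = length l - 1"
  by (simp add: rem_def)

lemma nth_ins: "j \<le> length l \<Longrightarrow> m \<le> length l \<Longrightarrow>
    ins j v l ! m = (if m < j then l ! m else if m = j then v else l ! (m - 1))"
  by (auto simp: ins_def nth_append nth_Cons min_def split: nat.split intro!: arg_cong[where f = "nth l"])

lemma nth_rem: "j < length l \<Longrightarrow> m < length l - 1 \<Longrightarrow>
    rem j l ! m = (if m < j then l ! m else l ! Suc m)"
  by (auto simp: rem_def nth_append min_def)

lemma set_ins: "set (ins j v l) = insert v (set l)"
  by (metis ins_def Un_insert_right append_take_drop_id list.simps(15) set_append)

lemma set_rem: "set (rem j l) \<subseteq> set l"
  by (auto simp: rem_def dest: in_set_takeD in_set_dropD)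

lemma ins_ins: "i \<le> j \<Longrightarrow> j \<le> length l \<Longrightarrow> ins i u (ins j v l) = ins (Suc j) v (ins i u l)"
  by (rule nth_equalityI) (auto simp: nth_ins)

lemma rem_ins_same: "i \<le> length l \<Longrightarrow> rem i (ins i v l) = l"
  by (rule nth_equalityI) (auto simp: nth_ins nth_rem length_rem)

lemma rem_ins_less: "i < j \<Longrightarrow> j \<le> length l \<Longrightarrow> rem j (ins i v l) = ins i v (rem (j - 1) l)"
  by (rule nth_equalityI) (auto simp: nth_ins nth_rem length_rem)

lemma rem_ins_greater: "j < i \<Longrightarrow> i \<le> length l \<Longrightarrow> rem j (ins i v l) = ins (i - 1) v (rem j l)"
  by (rule nth_equalityI) (auto simp: nth_ins nth_rem length_rem)

lemma ins_rem: "i < length l \<Longrightarrow> ins i (l ! i) (rem i l) = l"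
  by (rule nth_equalityI) (auto simp: nth_ins nth_rem length_rem)

section \<open>Words of colours\<close>

definition words :: "nat \<Rightarrow> nat \<Rightarrow> nat list set" where
  "words n k = {c. length c = k \<and> set c \<subseteq> {..<n}}"

lemma finite_words [simp]: "finite (words n k)"
  using finite_lists_length_eq[of "{..<n}" k] by (simp add: words_def conj_commute)

lemma words_0 [simp]: "words n 0 = {[]}"
  by (auto simp: words_def)

lemma sum_words_Suc: "(\<Sum>c\<in>words n (Suc k). g c) = (\<Sum>x<n. \<Sum>c\<in>words n k. g (c @ [x]))"
proof -
  have "bij_betw (\<lambda>(x,c). c @ [x]) ({..<n} \<times> words n k) (words n (Suc k))"
    by (rule bij_betw_byWitness[where f' = "\<lambda>l. (last l, butlast l)"])
      (auto simp: words_def dest: in_set_butlastD, (metis append_butlast_last_id last_in_set length_greater_0_conv lessThan_iff subsetD zero_less_Suc)+)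
  then have "(\<Sum>c\<in>words n (Suc k). g c) = (\<Sum>y\<in>{..<n} \<times> words n k. g ((\<lambda>(x,c). c @ [x]) y))"
    by (rule sum.reindex_bij_betw[symmetric])
  also have "\<dots> = (\<Sum>x<n. \<Sum>c\<in>words n k. g (c @ [x]))"
    by (simp add: sum.cartesian_product split_def)
  finally show ?thesis .
qed

lemma ins_words: "c \<in> words n k \<Longrightarrow> v < n \<Longrightarrow> ins j v c \<in> words n (Suc k)"
  by (auto simp: words_def set_ins)

text \<open>\<open>N\<close> is the number of slots of the tensors to which the functional applies.\<close>
inductive planar :: "nat \<Rightarrow> nat \<Rightarrow> ((nat list \<Rightarrow> rat) \<Rightarrow> rat) \<Rightarrow> bool" for n where
  base: "planar n 0 (\<lambda>W. f * W [])"
| dead: "planar n N L \<Longrightarrow> j \<le> N \<Longrightarrow> planar n (Suc N) (\<lambda>W. L (\<lambda>l. W (ins j 0 l)))"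
| cap: "planar n N L \<Longrightarrow> j \<le> N \<Longrightarrow>
    planar n (Suc (Suc N)) (\<lambda>W. L (\<lambda>l. \<Sum>v<n. W (ins j v (ins j v l))))"

text \<open>Functionals read a tensor only at words over the \<open>n\<close> colours. The
  assumption \<open>n > 0\<close> makes the colour 0, which \<open>dead\<close> inserts, one of
  them.\<close>

lemma planar_cong:
  assumes "planar n N L" "n > 0" "\<And>l. l \<in> words n N \<Longrightarrow> W l = W' l"
  shows "L W = L W'"
  using assms
proof (induction arbitrary: W W')
  case (dead N L j)
  show ?case by (rule dead.IH) (use dead.prems in \<open>auto intro: ins_words\<close>)
next
  case (cap N L j)
  show ?case by (rule cap.IH) (use cap.prems in \<open>auto intro!: ins_words sum.cong\<close>)
qed (auto simp: words_def)

lemma planar_ext: "planar n N L \<Longrightarrow> (\<And>W. L' W = L W) \<Longrightarrow> planar n N L'"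
  by (metis ext)

lemma planar_scale: "planar n N L \<Longrightarrow> planar n N (\<lambda>W. a * L W)"
proof (induction rule: planar.induct)
  case (base f)
  show ?case using planar.base[of n "a * f"] by (simp add: mult.assoc)
qed (auto intro: planar.intros)

lemma planar_scale': "planar n N L \<Longrightarrow> L (\<lambda>l. a * W l) = a * L W"
proof (induction arbitrary: W rule: planar.induct)
  case (dead N L j)
  then show ?case by simp
next
  case (cap N L j)
  then show ?case by (simp add: sum_distrib_left[symmetric])
qed simp

lemma planar_zero: "planar n N L \<Longrightarrow> L (\<lambda>l. 0) = 0"
  using planar_scale'[of n N L 0 "\<lambda>l. 0"] by simp

lemma wordsD: "l \<in> words n N \<Longrightarrow> length l = N" "l \<in> words n N \<Longrightarrow> j < N \<Longrightarrow> l ! j < n"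
  by (auto simp: words_def subset_iff)

text \<open>Slot \<open>j\<close> is fed with the indicator of colour 0. A \<open>dead\<close> at
  this slot cancels against it, a \<open>cap\<close> with one leg there becomes a
  \<open>dead\<close> at its other leg, and every other operation commutes with it after a shift of
  positions.\<close>

lemma planar_dead_adjoint:
  assumes "planar n M L" "M = Suc N" "n > 0" "j \<le> N"
  shows "planar n N (\<lambda>W. L (\<lambda>l. if l ! j = 0 then W (rem j l) else 0))"
  using assms
proof (induction arbitrary: N j)
  case (dead N' L i)
  then have [simp]: "N' = N" by simp
  consider "i = j" | "i < j" | "j < i" by linarith
  then show ?case
  proof cases
    case 1
    show ?thesis
      by (rule planar_ext[OF dead.hyps(1)[simplified]], rule planar_cong[OF dead.hyps(1) \<open>n > 0\<close>])
        (use 1 dead in \<open>auto simp: nth_ins rem_ins_same dest!: wordsD(1)\<close>)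
  next
    case 2
    then obtain N'' where N'': "N = Suc N''" using dead by (cases N) auto
    have *: "planar n N'' (\<lambda>W. L (\<lambda>l. if l ! (j - 1) = 0 then W (rem (j-1) l) else 0))"
      by (rule dead.IH) (use dead 2 N'' in auto)
    have "planar n (Suc N'') (\<lambda>W. L (\<lambda>l. if l ! (j - 1) = 0 then W (ins i 0 (rem (j-1) l)) else 0))"
      by (rule planar.dead[OF *]) (use dead 2 N'' in auto)
    then show ?thesis unfolding N''[symmetric]
      by (rule planar_ext, intro planar_cong[OF dead.hyps(1) \<open>n > 0\<close>])
        (use 2 dead in \<open>auto simp: nth_ins rem_ins_less dest!: wordsD(1)\<close>)
  next
    case 3
    then obtain N'' where N'': "N = Suc N''" using dead by (cases N) auto
    have *: "planar n N'' (\<lambda>W. L (\<lambda>l. if l ! j = 0 then W (rem j l) else 0))"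
      by (rule dead.IH) (use dead 3 N'' in auto)
    have "planar n (Suc N'') (\<lambda>W. L (\<lambda>l. if l ! j = 0 then W (ins (i-1) 0 (rem j l)) else 0))"
      by (rule planar.dead[OF *]) (use dead 3 N'' in auto)
    then show ?thesis unfolding N''[symmetric]
      by (rule planar_ext, intro planar_cong[OF dead.hyps(1) \<open>n > 0\<close>])
        (use 3 dead in \<open>auto simp: nth_ins rem_ins_greater dest!: wordsD(1)\<close>)
  qed
next
  case (cap N' L i)
  then have [simp]: "N = Suc N'" by simp
  consider "i = j" | "Suc i = j" | "Suc i < j" | "j < i" by linarith
  then show ?case
  proof cases
    case 1
    show ?thesis unfolding \<open>N = Suc N'\<close>
      by (rule planar_ext[OF planar.dead[OF cap.hyps]], rule planar_cong[OF cap.hyps(1) \<open>n > 0\<close>])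
        (use 1 cap in \<open>auto simp: nth_ins rem_ins_same dest!: wordsD(1)\<close>)
  next
    case 2
    show ?thesis unfolding \<open>N = Suc N'\<close>
      by (rule planar_ext[OF planar.dead[OF cap.hyps]], rule planar_cong[OF cap.hyps(1) \<open>n > 0\<close>])
        (use 2 cap in \<open>auto simp: nth_ins rem_ins_same rem_ins_less dest!: wordsD(1)\<close>)
  next
    case 3
    then obtain N'' where N'': "N' = Suc N''" using cap by (cases N') auto
    obtain j' where j': "j = Suc (Suc j')" using 3 that[of "j - 2"] by simp
    have *: "planar n N'' (\<lambda>W. L (\<lambda>l. if l ! (j - 2) = 0 then W (rem (j-2) l) else 0))"
      by (rule cap.IH) (use cap 3 N'' in auto)
    have "planar n (Suc (Suc N'')) (\<lambda>W. L (\<lambda>l. if l ! (j - 2) = 0 then \<Sum>v<n. W (ins i v (ins i v (rem (j-2) l))) else 0))"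
      by (rule planar.cap[OF *]) (use cap 3 N'' in auto)
    then show ?thesis unfolding N''[symmetric] \<open>N = Suc N'\<close>
      by (rule planar_ext, intro planar_cong[OF cap.hyps(1) \<open>n > 0\<close>])
        (use 3 cap j' in \<open>auto simp: nth_ins rem_ins_less numeral_2_eq_2 dest!: wordsD(1)\<close>)
  next
    case 4
    then obtain N'' where N'': "N' = Suc N''" using cap by (cases N') auto
    have *: "planar n N'' (\<lambda>W. L (\<lambda>l. if l ! j = 0 then W (rem j l) else 0))"
      by (rule cap.IH) (use cap 4 N'' in auto)
    have "planar n (Suc (Suc N'')) (\<lambda>W. L (\<lambda>l. if l ! j = 0 then \<Sum>v<n. W (ins (i-1) v (ins (i-1) v (rem j l))) else 0))"
      by (rule planar.cap[OF *]) (use cap 4 N'' in auto)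
    then show ?thesis unfolding N''[symmetric] \<open>N = Suc N'\<close>
      by (rule planar_ext, intro planar_cong[OF cap.hyps(1) \<open>n > 0\<close>])
        (use 4 cap in \<open>auto simp: nth_ins rem_ins_greater dest!: wordsD(1)\<close>)
  qed
qed auto

text \<open>Slots \<open>j\<close> and \<open>Suc j\<close> are fed with equal colours. A
  \<open>cap\<close> on both closes a loop of value \<open>n\<close>, a \<open>cap\<close> on one of
  them straightens to the identity, a \<open>dead\<close> on one of them passes colour 0 to the
  other, and everything else commutes.\<close>

lemma planar_cap_adjoint:
  assumes "planar n M L" "M = Suc (Suc N)" "n > 0" "j \<le> N"
  shows "planar n N (\<lambda>W. L (\<lambda>l. if l ! j = l ! Suc j then W (rem j (rem j l)) else 0))"
  using assms
proof (induction arbitrary: N j)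
  case (dead N' L i)
  then have [simp]: "N' = Suc N" by simp
  consider "i = j \<or> i = Suc j" | "i < j" | "Suc j < i" by linarith
  then show ?case
  proof cases
    case 1
    have "planar n N (\<lambda>W. L (\<lambda>l. if l ! j = 0 then W (rem j l) else 0))"
      by (rule planar_dead_adjoint[OF dead.hyps(1)]) (use dead in auto)
    then show ?thesis
      by (rule planar_ext, intro planar_cong[OF dead.hyps(1) \<open>n > 0\<close>])
        (use 1 dead in \<open>auto simp: nth_ins rem_ins_same rem_ins_greater length_rem dest!: wordsD(1)\<close>)
  next
    case 2
    then obtain N'' where N'': "N = Suc N''" using dead by (cases N) auto
    have *: "planar n N'' (\<lambda>W. L (\<lambda>l. if l ! (j - 1) = l ! Suc (j-1) then W (rem (j-1) (rem (j-1) l)) else 0))"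
      by (rule dead.IH) (use dead 2 N'' in auto)
    have "planar n (Suc N'') (\<lambda>W. L (\<lambda>l. if l ! (j - 1) = l ! Suc (j-1) then W (ins i 0 (rem (j-1) (rem (j-1) l))) else 0))"
      by (rule planar.dead[OF *]) (use dead 2 N'' in auto)
    then show ?thesis unfolding N''[symmetric]
      by (rule planar_ext, intro planar_cong[OF dead.hyps(1) \<open>n > 0\<close>])
        (use 2 dead in \<open>auto simp: nth_ins rem_ins_less length_rem dest!: wordsD(1)\<close>)
  next
    case 3
    then obtain N'' where N'': "N = Suc N''" using dead by (cases N) auto
    have *: "planar n N'' (\<lambda>W. L (\<lambda>l. if l ! j = l ! Suc j then W (rem j (rem j l)) else 0))"
      by (rule dead.IH) (use dead 3 N'' in auto)
    have "planar n (Suc N'') (\<lambda>W. L (\<lambda>l. if l ! j = l ! Suc j then W (ins (i-2) 0 (rem j (rem j l))) else 0))"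
      by (rule planar.dead[OF *]) (use dead 3 N'' in auto)
    then show ?thesis unfolding N''[symmetric]
      by (rule planar_ext, intro planar_cong[OF dead.hyps(1) \<open>n > 0\<close>])
        (use 3 dead in \<open>auto simp: nth_ins rem_ins_greater length_rem numeral_2_eq_2 dest!: wordsD(1)\<close>)
  qed
next
  case (cap N' L i)
  then have [simp]: "N' = N" by simp
  consider "i = j" | "i = Suc j" | "Suc i = j" | "Suc i < j" | "Suc j < i" by linarith
  then show ?case
  proof cases
    case 1
    have L: "L (\<lambda>l. of_nat n * W l) = of_nat n * L W" for W
      by (rule planar_scale'[OF cap.hyps(1)])
    have "planar n N (\<lambda>W. of_nat n * L W)"
      using planar_scale[OF cap.hyps(1)] by simp
    then show ?thesis unfolding L[symmetric]
      by (rule planar_ext, intro planar_cong[OF cap.hyps(1) \<open>n > 0\<close>])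
        (use 1 cap in \<open>auto simp: nth_ins rem_ins_same dest!: wordsD(1)\<close>)
  next
    case 2
    show ?thesis
    proof (rule planar_ext[OF cap.hyps(1)[simplified]], rule planar_cong[OF cap.hyps(1) \<open>n > 0\<close>])
      fix W l assume l: "l \<in> words n N'"
      then have l': "length l = N" "l ! j < n" "j < N" using 2 cap wordsD[OF l] by auto
      have "rem j (rem j (ins i v (ins i v l))) = ins j v (rem j l)" for v
        using 2 cap l' by (simp add: rem_ins_greater rem_ins_same rem_ins_less length_rem)
      then have "(\<Sum>v<n. if ins i v (ins i v l) ! j = ins i v (ins i v l) ! Suc j
           then W (rem j (rem j (ins i v (ins i v l)))) else 0)
          = (\<Sum>v<n. if v = l ! j then W (ins j v (rem j l)) else 0)"
        using 2 cap l' by (intro sum.cong) (auto simp: nth_ins)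
      also have "\<dots> = W l" using l' by (simp add: ins_rem)
      finally show "(\<Sum>v<n. if ins i v (ins i v l) ! j = ins i v (ins i v l) ! Suc j
           then W (rem j (rem j (ins i v (ins i v l)))) else 0) = W l" .
    qed
  next
    case 3
    show ?thesis
    proof (rule planar_ext[OF cap.hyps(1)[simplified]], rule planar_cong[OF cap.hyps(1) \<open>n > 0\<close>])
      fix W l assume l: "l \<in> words n N'"
      then have l': "length l = N" "l ! i < n" "i < N" using 3 cap wordsD[OF l] by auto
      have "rem j (rem j (ins i v (ins i v l))) = ins i v (rem i l)" for v
        using 3 cap l' by (auto simp add: rem_ins_greater rem_ins_same rem_ins_less length_rem)
      then have "(\<Sum>v<n. if ins i v (ins i v l) ! j = ins i v (ins i v l) ! Suc j
           then W (rem j (rem j (ins i v (ins i v l)))) else 0)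
          = (\<Sum>v<n. if v = l ! i then W (ins i v (rem i l)) else 0)"
        using 3 cap l' by (intro sum.cong) (auto simp: nth_ins)
      also have "\<dots> = W l" using l' by (simp add: ins_rem)
      finally show "(\<Sum>v<n. if ins i v (ins i v l) ! j = ins i v (ins i v l) ! Suc j
           then W (rem j (rem j (ins i v (ins i v l)))) else 0) = W l" .
    qed
  next
    case 4
    then obtain N'' where N'': "N = Suc (Suc N'')" using cap by (cases N; cases "N-1") auto
    obtain j' where j': "j = Suc (Suc j')" using 4 that[of "j - 2"] by simp
    have *: "planar n N'' (\<lambda>W. L (\<lambda>l. if l ! (j - 2) = l ! Suc (j-2) then W (rem (j-2) (rem (j-2) l)) else 0))"
      by (rule cap.IH) (use cap 4 N'' in auto)
    have "planar n (Suc (Suc N'')) (\<lambda>W. L (\<lambda>l. if l ! (j - 2) = l ! Suc (j-2)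
         then \<Sum>v<n. W (ins i v (ins i v (rem (j-2) (rem (j-2) l)))) else 0))"
      by (rule planar.cap[OF *]) (use cap 4 N'' in auto)
    then show ?thesis unfolding N''[symmetric]
      by (rule planar_ext, intro planar_cong[OF cap.hyps(1) \<open>n > 0\<close>])
        (use 4 cap j' in \<open>auto simp: nth_ins rem_ins_less length_rem numeral_2_eq_2 Suc_diff_Suc dest!: wordsD(1)\<close>)
  next
    case 5
    then obtain N'' where N'': "N = Suc (Suc N'')" using cap by (cases N; cases "N-1") auto
    have *: "planar n N'' (\<lambda>W. L (\<lambda>l. if l ! j = l ! Suc j then W (rem j (rem j l)) else 0))"
      by (rule cap.IH) (use cap 5 N'' in auto)
    have "planar n (Suc (Suc N'')) (\<lambda>W. L (\<lambda>l. if l ! j = l ! Suc j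
         then \<Sum>v<n. W (ins (i-2) v (ins (i-2) v (rem j (rem j l)))) else 0))"
      by (rule planar.cap[OF *]) (use cap 5 N'' in auto)
    then show ?thesis unfolding N''[symmetric]
      by (rule planar_ext, intro planar_cong[OF cap.hyps(1) \<open>n > 0\<close>])
        (use 5 cap in \<open>auto simp: nth_ins rem_ins_greater length_rem numeral_2_eq_2 dest!: wordsD(1)\<close>)
  qed
qed auto

section \<open>Harmonic tensors\<close>

definition harmonic :: "nat \<Rightarrow> nat \<Rightarrow> nat \<Rightarrow> (nat list \<Rightarrow> rat) \<Rightarrow> bool" where
  "harmonic n N i W \<longleftrightarrow>
     (\<forall>j l. j < i \<longrightarrow> Suc (length l) = N \<longrightarrow> W (ins j 0 l) = 0) \<and>
     (\<forall>j l. Suc j < i \<longrightarrow> Suc (Suc (length l)) = N \<longrightarrow> (\<Sum>v<n. W (ins j v (ins j v l))) = 0)"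

lemma harmonic_dead:
  assumes "harmonic n (Suc N) i W" "i \<le> j" "j \<le> N"
  shows "harmonic n N i (\<lambda>l. W (ins j 0 l))"
  unfolding harmonic_def
proof (intro conjI allI impI)
  fix m and l :: "nat list" assume "m < i" "Suc (length l) = N"
  then have "ins j 0 (ins m 0 l) = ins m 0 (ins (j - 1) (0::nat) l)"
    using assms by (subst ins_ins) auto
  then show "W (ins j 0 (ins m 0 l)) = 0"
    using assms \<open>m < i\<close> \<open>Suc (length l) = N\<close> by (simp add: harmonic_def)
next
  fix m and l :: "nat list" assume *: "Suc m < i" "Suc (Suc (length l)) = N"
  then have "ins j 0 (ins m v (ins m v l)) = ins m v (ins m v (ins (j - 2) (0::nat) l))" for v
    using assms by (simp add: ins_ins numeral_2_eq_2 Suc_diff_Suc)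
  then show "(\<Sum>v<n. W (ins j 0 (ins m v (ins m v l)))) = 0"
    using assms * by (simp add: harmonic_def)
qed

text \<open>The second bound \<open>i'\<close> allows for a cap that straddles the boundary of the
  harmonic slots: it uses up the last one and leaves \<open>i - 1\<close>.\<close>

lemma harmonic_cap:
  assumes "harmonic n (Suc (Suc N)) i W" "i' \<le> j" "i' \<le> i" "j \<le> N"
  shows "harmonic n N i' (\<lambda>l. \<Sum>v<n. W (ins j v (ins j v l)))"
  unfolding harmonic_def
proof (intro conjI allI impI)
  fix m and l :: "nat list" assume *: "m < i'" "Suc (length l) = N"
  have "ins j v (ins j v (ins m 0 l)) = ins m 0 (ins (j - 1) v (ins (j - 1) v l))" for v
    using assms * by (subst (1 2) ins_ins) auto
  then show "(\<Sum>v<n. W (ins j v (ins j v (ins m 0 l)))) = 0"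
    using assms * by (simp add: harmonic_def)
next
  fix m and l :: "nat list" assume *: "Suc m < i'" "Suc (Suc (length l)) = N"
  have "ins j v (ins j v (ins m u (ins m u l))) = ins m u (ins m u (ins (j - 2) v (ins (j-2) v l)))" for u v
    using assms * by (simp add: ins_ins numeral_2_eq_2 Suc_diff_Suc)
  then have "(\<Sum>u<n. \<Sum>v<n. W (ins j v (ins j v (ins m u (ins m u l)))))
      = (\<Sum>v<n. \<Sum>u<n. W (ins m u (ins m u (ins (j - 2) v (ins (j-2) v l)))))"
    by (subst sum.swap) simp
  also have "\<dots> = 0" using assms * by (simp add: harmonic_def)
  finally show "(\<Sum>u<n. \<Sum>v<n. W (ins j v (ins j v (ins m u (ins m u l))))) = 0" .
qed

lemma ins_append: "length a = j \<Longrightarrow> ins j v (a @ b) = a @ v # b"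
  by (simp add: ins_def)

text \<open>A planar functional pairs \<open>i\<close> harmonic slots with \<open>d \<le> i\<close> free ones: no harmonic slot
  may be closed off or capped to another one, so all of them must be capped across the middle.\<close>
lemma planar_harmonic:
  assumes "planar n M L" "n > 0" 
  shows "\<exists>f. \<forall>i d W. M = i + d \<longrightarrow> d \<le> i \<longrightarrow> harmonic n M i W \<longrightarrow>
     L W = (if d = i then f * (\<Sum>e\<in>words n i. W (e @ rev e)) else 0)"
  using assms
proof (induction)
  case (base f)
  show ?case by (rule exI[of _ f]) auto
next
  case (dead N L j)
  then obtain f where f: "\<And>i d W. N = i + d \<Longrightarrow> d \<le> i \<Longrightarrow> harmonic n N i W \<Longrightarrow>
     L W = (if d = i then f * (\<Sum>e\<in>words n i. W (e @ rev e)) else 0)" by blast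
  show ?case
  \<comment> \<open>The scalar is 0: an evaluation outside the harmonic slots leaves only
    \<open>d - 1 < i\<close> free slots, where the induction hypothesis gives 0.\<close>
  proof (intro exI[of _ 0] allI impI)
    fix i d W assume *: "Suc N = i + d" "d \<le> i" "harmonic n (Suc N) i W"
    have "L (\<lambda>l. W (ins j 0 l)) = 0"
    proof (cases "j < i")
      case True
      have "L (\<lambda>l. W (ins j 0 l)) = L (\<lambda>l. 0)"
        by (rule planar_cong[OF dead.hyps(1) \<open>n > 0\<close>])
          (use * True in \<open>auto simp: harmonic_def dest!: wordsD(1)\<close>)
      then show ?thesis using planar_zero[OF dead.hyps(1)] by simp
    next
      case False
      have h: "harmonic n N i (\<lambda>l. W (ins j 0 l))"
        by (rule harmonic_dead) (use * False dead.hyps in auto)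
      obtain d' where "d = Suc d'" using * False dead.hyps by (cases d) auto
      then show ?thesis using f[OF _ _ h, of d'] * by simp
    qed
    then show "L (\<lambda>l. W (ins j 0 l)) = (if d = i then 0 * (\<Sum>e\<in>words n i. W (e @ rev e)) else 0)"
      by simp
  qed
next
  case (cap N L j)
  then obtain f where f: "\<And>i d W. N = i + d \<Longrightarrow> d \<le> i \<Longrightarrow> harmonic n N i W \<Longrightarrow>
     L W = (if d = i then f * (\<Sum>e\<in>words n i. W (e @ rev e)) else 0)" by blast
  \<comment> \<open>With \<open>d = i\<close> only a cap in the exact middle survives, i.e.
    \<open>i = Suc j\<close>, which forces \<open>N = j + j\<close>. The scalar must not depend on
    \<open>i\<close>, so the condition is expressed through \<open>N\<close>.\<close>
  let ?f = "if N = j + j then f else 0"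
  show ?case
  proof (intro exI[of _ ?f] allI impI)
    fix i d W assume *: "Suc (Suc N) = i + d" "d \<le> i" "harmonic n (Suc (Suc N)) i W"
    let ?W = "\<lambda>l. \<Sum>v<n. W (ins j v (ins j v l))"
    consider "Suc j < i" | "Suc j = i" | "i \<le> j" by linarith
    then show "L ?W = (if d = i then ?f * (\<Sum>e\<in>words n i. W (e @ rev e)) else 0)"
    proof cases
      case 1
      have "L ?W = L (\<lambda>l. 0)"
        by (rule planar_cong[OF cap.hyps(1) \<open>n > 0\<close>])
          (use * 1 in \<open>auto simp: harmonic_def dest!: wordsD(1)\<close>)
      then show ?thesis using planar_zero[OF cap.hyps(1)] 1 * by auto
    next
      case 2
      have h: "harmonic n N j ?W"
        by (rule harmonic_cap[where i = i]) (use * 2 cap.hyps in auto)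
      have "(\<Sum>e\<in>words n j. ?W (e @ rev e)) = (\<Sum>e\<in>words n i. W (e @ rev e))"
        by (subst 2[symmetric], subst sum_words_Suc, subst sum.swap)
          (auto intro!: sum.cong simp: ins_append dest!: wordsD(1))
      then show ?thesis using f[OF _ _ h, of "d - 1"] * 2 cap.hyps by auto
    next
      case 3
      have h: "harmonic n N i ?W"
        by (rule harmonic_cap[where i = i]) (use * 3 cap.hyps in auto)
      obtain d' where "d = Suc (Suc d')" using * 3 cap.hyps by (cases d; cases "d - 1") auto
      then show ?thesis using f[OF _ _ h, of d'] * 3 by simp
    qed
  qed
qed

section \<open>White vertices and edges of a path\<close>

lemma seg_sum_eq:
  assumes "1 \<le> i" "i \<le> j" "j \<le> length p"
  shows "seg_sum p i j = sum_list (take j p) - sum_list (take (i - 1) p)"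
  using assms(2,3)
proof (induction j rule: dec_induct)
  case base
  then show ?case using assms(1) by (cases i) (auto simp: seg_sum_def take_Suc_conv_app_nth)
next
  case (step m)
  have "seg_sum p i (Suc m) = seg_sum p i m + p ! m"
    using step assms(1) by (simp add: seg_sum_def sum.nat_ivl_Suc')
  then show ?case using step by (simp add: take_Suc_conv_app_nth)
qed

lemma paired_iff: "paired p i j \<longleftrightarrow> 1 \<le> i \<and> i < j \<and> j \<le> length p \<and> p ! (i - 1) = 1 \<and>
    sum_list (take j p) = sum_list (take (i - 1) p) \<and>
    (\<forall>l. i < l \<and> l < j \<longrightarrow> sum_list (take l p) \<noteq> sum_list (take (i - 1) p))"
  by (auto simp: paired_def seg_sum_eq)

text \<open>The first later return to the height before \<open>i\<close>, obtained as a least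
  element, is the mate of \<open>i\<close>; an up step without a return has no mate.\<close>

lemma white_iff: "white p i \<longleftrightarrow> 1 \<le> i \<and> i \<le> length p \<and> p ! (i - 1) = 1 \<and>
    (\<forall>l. i < l \<and> l \<le> length p \<longrightarrow> sum_list (take l p) \<noteq> sum_list (take (i - 1) p))"
proof -
  have ex: "\<exists>j. paired p i j" if *: "1 \<le> i" "p ! (i - 1) = 1" "i < l" "l \<le> length p"
     "sum_list (take l p) = sum_list (take (i - 1) p)" for l
  proof -
    let ?P = "\<lambda>l. i < l \<and> l \<le> length p \<and> sum_list (take l p) = sum_list (take (i - 1) p)"
    have "?P (LEAST l. ?P l)" using * by (intro LeastI[of ?P l]) auto
    moreover have "\<not> ?P m" if "m < (LEAST l. ?P l)" for m using that by (rule not_less_Least)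
    ultimately have "paired p i (LEAST l. ?P l)" using * unfolding paired_iff
      by (metis (no_types, lifting) dual_order.strict_trans order.strict_implies_order order_trans)
    then show ?thesis by blast
  qed
  have "(\<exists>j. paired p i j) \<longleftrightarrow>
      (\<exists>l. i < l \<and> l \<le> length p \<and> sum_list (take l p) = sum_list (take (i - 1) p))"
    if "1 \<le> i" "p ! (i - 1) = 1"
  proof
    assume "\<exists>j. paired p i j"
    then show "\<exists>l. i < l \<and> l \<le> length p \<and> sum_list (take l p) = sum_list (take (i - 1) p)"
      unfolding paired_iff by blast
  qed (use ex[OF that] in blast)
  then show ?thesis unfolding white_def by blast
qed

lemma finite_white [simp]: "finite {i. white p i}"
  by (rule finite_subset[of _ "{..length p}"]) (auto simp: white_def)

lemma set_whites [simp]: "set (whites p) = {i. white p i}"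
  by (simp add: whites_def)

lemma sorted_whites [simp]: "sorted (whites p)" "distinct (whites p)"
  by (simp_all add: whites_def)

lemma white_le: "white t i \<Longrightarrow> i \<le> length t"
  by (simp add: white_def)

lemma whites_nth_le: "j < length (whites t) \<Longrightarrow> 1 \<le> whites t ! j \<and> whites t ! j \<le> length t"
  using nth_mem[of j "whites t"] by (auto simp: white_def)

lemma whitesI: "sorted xs \<Longrightarrow> distinct xs \<Longrightarrow> (\<And>i. white t i \<longleftrightarrow> i \<in> set xs) \<Longrightarrow> whites t = xs"
  by (rule sorted_distinct_set_unique) auto

lemma motzkin_snoc: "motzkin (t @ [a]) \<longleftrightarrow> motzkin t \<and> a \<in> {-1,0,1} \<and> sum_list t + a \<ge> 0"
proof -
  have "(\<forall>n\<le>Suc (length t). sum_list (take n (t @ [a])) \<ge> 0) \<longleftrightarrow>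
     (\<forall>n\<le>length t. sum_list (take n t) \<ge> 0) \<and> sum_list t + a \<ge> 0"
    by (auto simp: le_Suc_eq)
  then show ?thesis unfolding motzkin_def by auto
qed

lemma motzkin_Nil [simp]: "motzkin []" by (simp add: motzkin_def)

text \<open>The invariant for appending letters: since the \<open>s\<close>-th white step (from 0)
  starts at height \<open>s\<close>, a final down step, which ends one below the current height, can
  only be paired with the last white vertex.\<close>

definition heights_ok :: "int list \<Rightarrow> bool" where
  "heights_ok t \<longleftrightarrow> int (length (whites t)) = sum_list t \<and>
     (\<forall>s<length (whites t). sum_list (take (whites t ! s - 1) t) = int s)"

lemma paired_snoc_aux:
  assumes "heights_ok t" "a \<ge> -1"
  shows "paired (t @ [a]) i j \<longleftrightarrow> paired t i j \<or>
     (a = -1 \<and> j = Suc (length t) \<and> whites t \<noteq> [] \<and> i = last (whites t))"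
proof (cases "j \<le> length t")
  case True
  then show ?thesis by (auto simp: paired_iff nth_append)
next
  case False
  have "paired (t @ [a]) i (Suc (length t)) \<longleftrightarrow> white t i \<and> sum_list t + a = sum_list (take (i - 1) t)"
    unfolding paired_iff white_iff by (auto simp: nth_append less_Suc_eq_le)
  also have "\<dots> \<longleftrightarrow> a = -1 \<and> whites t \<noteq> [] \<and> i = last (whites t)"
  proof
    assume *: "white t i \<and> sum_list t + a = sum_list (take (i - 1) t)"
    then have "i \<in> set (whites t)" by simp
    then obtain s where s: "s < length (whites t)" "i = whites t ! s" by (metis in_set_conv_nth)
    with assms * have "int (length (whites t)) + a = int s" by (auto simp: heights_ok_def)
    then have "a = -1" "s = length (whites t) - 1" using s assms by linarith+
    then show "a = -1 \<and> whites t \<noteq> [] \<and> i = last (whites t)" using s last_conv_nth[of "whites t"] by force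
  next
    assume *: "a = -1 \<and> whites t \<noteq> [] \<and> i = last (whites t)"
    then have "white t i" using last_in_set[of "whites t"] by simp
    then show "white t i \<and> sum_list t + a = sum_list (take (i - 1) t)"
      using * assms unfolding heights_ok_def
      by (cases "length (whites t)") (auto simp: last_conv_nth)
  qed
  finally show ?thesis using False by (auto simp: paired_iff)
qed

text \<open>The white vertices behave as a stack: an up step pushes, a flat step does nothing, a
  down step pops its mate.\<close>

lemma whites_snoc_aux:
  assumes "heights_ok t"
  shows "whites (t @ [1]) = whites t @ [Suc (length t)]" "whites (t @ [0]) = whites t"
    "whites (t @ [-1]) = butlast (whites t)"
proof -
  have w: "white (t @ [a]) i \<longleftrightarrow> (i = Suc (length t) \<and> a = 1) \<or> (white t i \<and> \<not> (a = -1 \<and> i = last (whites t)))"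
    if "a \<ge> -1" for a i
  proof (cases "i \<le> length t")
    case True
    have "white t i \<Longrightarrow> whites t \<noteq> []" using set_whites[of t] by force
    with True show ?thesis unfolding white_def using paired_snoc_aux[OF assms that]
      by (auto simp: nth_append)
  next
    case False
    have "\<not> paired (t @ [a]) i j" for j using False by (auto simp: paired_def)
    then show ?thesis using False by (auto simp: white_def nth_append)
  qed
  show "whites (t @ [1]) = whites t @ [Suc (length t)]"
    by (rule whitesI) (auto simp: w sorted_append dest: white_le)
  show "whites (t @ [0]) = whites t"
    by (rule whitesI) (auto simp: w)
  show "whites (t @ [-1]) = butlast (whites t)"
  proof (cases "whites t = []")
    case True
    then have "\<not> white t i" for i using set_whites[of t] by auto
    then show ?thesis using True by (intro whitesI) (auto simp: w)
  next
    case False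
    then have e: "whites t = butlast (whites t) @ [last (whites t)]" by simp
    have "sorted (butlast (whites t))" "distinct (whites t)"
      by (auto simp: butlast_conv_take sorted_wrt_take)
    moreover have "white t i \<longleftrightarrow> i \<in> set (butlast (whites t)) \<or> i = last (whites t)" for i
      using set_whites[of t] by (subst (asm) e) (auto simp del: set_whites)
    moreover have "last (whites t) \<notin> set (butlast (whites t))"
      using sorted_whites(2)[of t] by (subst (asm) e) (simp del: append_butlast_last_id)
    ultimately show ?thesis by (intro whitesI) (auto simp: w distinct_butlast)
  qed
qed

lemma heights_ok: "motzkin t \<Longrightarrow> heights_ok t"
proof (induction t rule: rev_induct)
  case Nil
  have "whites [] = []" by (rule whitesI) (auto simp: white_def)
  then show ?case by (simp add: heights_ok_def)
next
  case (snoc a t)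
  then have h: "heights_ok t" and a: "a \<in> {-1,0,1}" "sum_list t + a \<ge> 0" by (auto simp: motzkin_snoc)
  then have "int (length (whites t)) = sum_list t" by (simp add: heights_ok_def)
  moreover have "sum_list (take (whites t ! s - 1) (t @ [a])) = int s" if "s < length (whites t)" for s
    using h whites_nth_le[OF that] that by (auto simp: heights_ok_def)
  ultimately show ?case using a unfolding heights_ok_def
    by (auto simp: whites_snoc_aux[OF h] nth_append nth_butlast)
qed

lemma length_whites: "motzkin t \<Longrightarrow> int (length (whites t)) = sum_list t"
  using heights_ok[of t] by (simp add: heights_ok_def)

lemma whites_Nil [simp]: "whites [] = []"
  using length_whites[of "[]"] by simp

lemmas whites_snoc = whites_snoc_aux[OF heights_ok]

lemma paired_snoc:
  assumes "motzkin (t @ [a])"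
  shows "paired (t @ [a]) i j \<longleftrightarrow> paired t i j \<or> (a = -1 \<and> j = Suc (length t) \<and> i = last (whites t))"
proof -
  have "motzkin t" "a \<in> {-1,0,1}" "sum_list t + a \<ge> 0" using assms by (auto simp: motzkin_snoc)
  then show ?thesis using paired_snoc_aux[OF heights_ok, of t a i j] length_whites[of t] by auto
qed

section \<open>Blackening a white vertex and joining two neighbouring ones\<close>

lemma rem_append: "j < length a \<Longrightarrow> rem j (a @ b) = rem j a @ b"
  by (simp add: rem_def)

lemma rem_length [simp]: "rem (length a) (a @ x # b) = a @ b"
  by (simp add: rem_def)

lemma butlast_rem: "Suc j < length l \<Longrightarrow> butlast (rem j l) = rem j (butlast l)"
  by (auto simp: rem_def butlast_append take_butlast drop_butlast[symmetric])

lemma last_rem: "Suc j < length l \<Longrightarrow> last (rem j l) = last l"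
  by (simp add: rem_def)

text \<open>One entry is taken out of the stack of white vertices. No later down step ever pops it,
  as it is still white at the end, so all edges stay the same.\<close>

lemma kill_white:
  assumes "motzkin t" "j < length (whites t)"
  shows "motzkin (t[whites t ! j - 1 := 0]) \<and> whites (t[whites t ! j - 1 := 0]) = rem j (whites t)
     \<and> paired (t[whites t ! j - 1 := 0]) = paired t"
  using assms
proof (induction t arbitrary: j rule: rev_induct)
  case (snoc a t)
  then have m: "motzkin t" and a: "a \<in> {-1,0,1}" "sum_list t + a \<ge> 0" by (auto simp: motzkin_snoc)
  have l: "int (length (whites t)) = sum_list t" using length_whites[OF m] .
  show ?case
  proof (cases "j < length (whites (t @ [a])) \<and> j = length (whites t)")
    case True
    then have "a = 1" "j = length (whites t)" using a by (auto simp: whites_snoc[OF m])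
    moreover have "motzkin (t @ [0])" using m a l by (auto simp: motzkin_snoc)
    moreover have "paired (t @ [0]) = paired (t @ [1])"
      using calculation snoc.prems(1) by (intro ext) (auto simp: paired_snoc)
    ultimately show ?thesis by (simp add: whites_snoc[OF m] list_update_append)
  next
    case False
    have j: "j < length (whites t)" using False snoc.prems a by (auto simp: whites_snoc[OF m])
    have w: "whites (t @ [a]) ! j = whites t ! j"
      using j False snoc.prems a by (auto simp: whites_snoc[OF m] nth_append nth_butlast)
    define t' where t': "t' = t[whites t ! j - 1 := 0]"
    have e: "(t @ [a])[whites (t @ [a]) ! j - 1 := 0] = t' @ [a]"
      using whites_nth_le[OF j] w by (auto simp add: list_update_append t')
    from snoc.IH[OF m j] have IH: "motzkin t'" "whites t' = rem j (whites t)" "paired t' = paired t" unfolding t' by auto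
    have t'_len: "length t' = length t" by (simp add: t')
    have "a = -1 \<Longrightarrow> Suc j < length (whites t)" using snoc.prems by (auto simp: whites_snoc[OF m])
    moreover have "sum_list t' = int (length (whites t)) - 1"
      using length_whites[OF IH(1)] j by (simp add: IH(2) length_rem)
    ultimately have m': "motzkin (t' @ [a])" using a IH(1) j by (auto simp: motzkin_snoc)
    have "whites (t' @ [a]) = rem j (whites (t @ [a]))"
      using a j \<open>a = -1 \<Longrightarrow> Suc j < length (whites t)\<close>
      by (auto simp: whites_snoc[OF m] whites_snoc[OF IH(1)] IH(2) rem_append butlast_rem t'_len)
    moreover have "paired (t' @ [a]) = paired (t @ [a])"
      using \<open>a = -1 \<Longrightarrow> Suc j < length (whites t)\<close>
      by (intro ext) (auto simp: paired_snoc[OF m'] paired_snoc[OF snoc.prems(1)] IH(2,3) last_rem t'_len)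
    ultimately show ?thesis using m' unfolding e by simp
  qed
qed simp

text \<open>Between two consecutive white vertices every up step is already matched, so a down step
  in place of the second one pops exactly the first. Later letters then see a stack with these two
  entries missing.\<close>

lemma join_whites:
  assumes "motzkin t" "Suc j < length (whites t)"
  shows "motzkin (t[whites t ! Suc j - 1 := -1])
     \<and> whites (t[whites t ! Suc j - 1 := -1]) = rem j (rem j (whites t))
     \<and> paired (t[whites t ! Suc j - 1 := -1]) =
       (\<lambda>u v. paired t u v \<or> (u = whites t ! j \<and> v = whites t ! Suc j))"
  using assms
proof (induction t arbitrary: j rule: rev_induct)
  case (snoc a t)
  then have m: "motzkin t" and a: "a \<in> {-1,0,1}" "sum_list t + a \<ge> 0" by (auto simp: motzkin_snoc)
  have l: "int (length (whites t)) = sum_list t" using length_whites[OF m] .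
  show ?case
  proof (cases "Suc j = length (whites t)")
    case True
    then have a1: "a = 1" using snoc.prems a by (auto simp: whites_snoc[OF m])
    have m': "motzkin (t @ [-1])" using m l True by (auto simp: motzkin_snoc)
    have m1: "motzkin (t @ [1])" using snoc.prems a1 by simp
    have ne: "whites t \<noteq> []" using True by auto
    have "whites (t @ [-1]) = rem j (rem j (whites t @ [Suc (length t)]))"
    proof -
      have "whites t = butlast (whites t) @ [last (whites t)]" using ne by simp
      moreover have j: "j = length (butlast (whites t))" using True by simp
      ultimately show ?thesis unfolding whites_snoc[OF m] by (metis append_Nil2 append_assoc append_Cons append_Nil rem_length)
    qed
    moreover have "paired (t @ [-1]) = (\<lambda>u v. paired (t @ [a]) u v \<or> (u = whites t ! j \<and> v = Suc (length t)))"
      using ne True[symmetric] m1 unfolding a1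
      by (intro ext) (auto simp: paired_snoc[OF m'] paired_snoc[OF m1] last_conv_nth)
    ultimately show ?thesis using m' True a1
      by (auto simp: whites_snoc[OF m] list_update_append nth_append)
  next
    case False
    have j: "Suc j < length (whites t)" using False snoc.prems a by (auto simp: whites_snoc[OF m])
    have w: "whites (t @ [a]) ! Suc j = whites t ! Suc j" "whites (t @ [a]) ! j = whites t ! j"
      using j False snoc.prems a by (auto simp: whites_snoc[OF m] nth_append nth_butlast)
    define t' where t': "t' = t[whites t ! Suc j - 1 := -1]"
    have e: "(t @ [a])[whites (t @ [a]) ! Suc j - 1 := -1] = t' @ [a]"
      using whites_nth_le[OF j] w by (auto simp add: list_update_append t')
    from snoc.IH[OF m j] have IH: "motzkin t'" "whites t' = rem j (rem j (whites t))"
      "paired t' = (\<lambda>u v. paired t u v \<or> (u = whites t ! j \<and> v = whites t ! Suc j))" unfolding t' by auto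
    have t'_len: "length t' = length t" by (simp add: t')
    have am: "a = -1 \<Longrightarrow> Suc (Suc j) < length (whites t)" using snoc.prems by (auto simp: whites_snoc[OF m])
    moreover have "sum_list t' = int (length (whites t)) - 2"
      using length_whites[OF IH(1)] j by (simp add: IH(2) length_rem)
    ultimately have m': "motzkin (t' @ [a])" using a IH(1) j by (auto simp: motzkin_snoc)
    have "whites (t' @ [a]) = rem j (rem j (whites (t @ [a])))"
      using a j am
      by (auto simp: whites_snoc[OF m] whites_snoc[OF IH(1)] IH(2) rem_append butlast_rem t'_len length_rem)
    moreover have "paired (t' @ [a]) = (\<lambda>u v. paired (t @ [a]) u v \<or> (u = whites t ! j \<and> v = whites t ! Suc j))"
      using am
      by (intro ext) (auto simp: paired_snoc[OF m'] paired_snoc[OF snoc.prems(1)] IH(2,3) last_rem t'_len length_rem)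
    ultimately show ?thesis using m' unfolding e unfolding w by simp
  qed
qed simp

section \<open>Colour sums\<close>

text \<open>White vertices are unconstrained here: their colours are the slots of the tensors, read
  off by \<open>wcol\<close>.\<close>

definition compat :: "int list \<Rightarrow> nat list \<Rightarrow> bool" where
  "compat t c \<longleftrightarrow> (\<forall>i j. paired t i j \<longrightarrow> c ! (i - 1) = c ! (j - 1)) \<and>
     (\<forall>i<length t. t ! i = 0 \<longrightarrow> c ! i = 0)"

definition wcol :: "int list \<Rightarrow> nat list \<Rightarrow> nat list" where
  "wcol t c = map (\<lambda>i. c ! (i - 1)) (whites t)"

lemma length_wcol [simp]: "length (wcol t c) = length (whites t)"
  by (simp add: wcol_def)

lemma paired_bounds: "paired t i j \<Longrightarrow> 1 \<le> i \<and> i < j \<and> j \<le> length t"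
  by (simp add: paired_def)

lemma wcol_append: "length c = length t \<Longrightarrow> map (\<lambda>i. (c @ [x]) ! (i - 1)) (whites t) = wcol t c"
  unfolding wcol_def by (rule map_cong) (auto simp: nth_append white_def)

lemma compat_snoc_aux:
  assumes "length c = length t"
  shows "(\<forall>i j. paired t i j \<longrightarrow> (c @ [x]) ! (i - 1) = (c @ [x]) ! (j - 1)) \<longleftrightarrow>
         (\<forall>i j. paired t i j \<longrightarrow> c ! (i - 1) = c ! (j - 1))"
proof -
  have "(c @ [x]) ! (i - 1) = c ! (i - 1) \<and> (c @ [x]) ! (j - 1) = c ! (j - 1)" if "paired t i j" for i j
    using paired_bounds[OF that] assms by (auto simp: nth_append)
  then show ?thesis by auto
qed

lemma blacks_snoc: "length c = length t \<Longrightarrow> (\<forall>i<length (t @ [a]). (t @ [a]) ! i = (0::int) \<longrightarrow> (c @ [x]) ! i = (0::nat)) \<longleftrightarrow>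
   (\<forall>i<length t. t ! i = 0 \<longrightarrow> c ! i = 0) \<and> (a = 0 \<longrightarrow> x = 0)"
  by (auto simp: nth_append less_Suc_eq)

lemma snoc_up:
  assumes "motzkin t" "length c = length t"
  shows "compat (t @ [1]) (c @ [x]) \<longleftrightarrow> compat t c" "wcol (t @ [1]) (c @ [x]) = wcol t c @ [x]"
proof -
  have m: "motzkin (t @ [1])" using assms length_whites[of t] by (simp add: motzkin_snoc)
  show "compat (t @ [1]) (c @ [x]) \<longleftrightarrow> compat t c"
    unfolding compat_def blacks_snoc[OF assms(2)] using compat_snoc_aux[OF assms(2)]
    by (simp add: paired_snoc[OF m])
  show "wcol (t @ [1]) (c @ [x]) = wcol t c @ [x]"
    using wcol_append[OF assms(2)] assms(2) by (simp add: wcol_def whites_snoc[OF assms(1)] nth_append)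
qed

lemma snoc_flat:
  assumes "motzkin t" "length c = length t"
  shows "compat (t @ [0]) (c @ [x]) \<longleftrightarrow> compat t c \<and> x = 0" "wcol (t @ [0]) (c @ [x]) = wcol t c"
proof -
  have m: "motzkin (t @ [0])" using assms length_whites[of t] by (simp add: motzkin_snoc)
  show "compat (t @ [0]) (c @ [x]) \<longleftrightarrow> compat t c \<and> x = 0"
    unfolding compat_def blacks_snoc[OF assms(2)] using compat_snoc_aux[OF assms(2)]
    by (auto simp: paired_snoc[OF m])
  show "wcol (t @ [0]) (c @ [x]) = wcol t c"
    using wcol_append[OF assms(2)] by (simp add: wcol_def whites_snoc[OF assms(1)])
qed

lemma snoc_down:
  assumes "motzkin t" "length c = length t" "whites t \<noteq> []"
  shows "compat (t @ [-1]) (c @ [x]) \<longleftrightarrow> compat t c \<and> last (wcol t c) = x"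
    "wcol (t @ [-1]) (c @ [x]) = butlast (wcol t c)"
proof -
  have "length (whites t) > 0" using assms(3) by simp
  then have m: "motzkin (t @ [-1])" using assms length_whites[of t] by (simp add: motzkin_snoc del: length_greater_0_conv)
  have w: "last (whites t) - 1 < length t" "last (whites t) \<ge> 1"
    using whites_nth_le[of "length (whites t) - 1" t] assms(3) by (auto simp: last_conv_nth)
  have l: "last (wcol t c) = c ! (last (whites t) - 1)" using assms(3) by (simp add: wcol_def last_map)
  have "(\<forall>i j. paired (t @ [-1]) i j \<longrightarrow> (c @ [x]) ! (i - 1) = (c @ [x]) ! (j - 1)) \<longleftrightarrow>
     (\<forall>i j. paired t i j \<longrightarrow> (c @ [x]) ! (i - 1) = (c @ [x]) ! (j - 1)) \<and>
       (c @ [x]) ! (last (whites t) - 1) = (c @ [x]) ! (Suc (length t) - 1)"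
    unfolding paired_snoc[OF m] by blast
  also have "\<dots> \<longleftrightarrow> (\<forall>i j. paired t i j \<longrightarrow> c ! (i - 1) = c ! (j - 1)) \<and> last (wcol t c) = x"
    unfolding compat_snoc_aux[OF assms(2)] l using w assms(2) by (simp add: nth_append)
  finally show "compat (t @ [-1]) (c @ [x]) \<longleftrightarrow> compat t c \<and> last (wcol t c) = x"
    unfolding compat_def blacks_snoc[OF assms(2)] by auto
  have "wcol (t @ [-1]) (c @ [x]) = butlast (map (\<lambda>i. (c @ [x]) ! (i - 1)) (whites t))"
    by (simp add: wcol_def whites_snoc[OF assms(1)] map_butlast)
  then show "wcol (t @ [-1]) (c @ [x]) = butlast (wcol t c)"
    unfolding wcol_append[OF assms(2)] .
qed

lemma map_rem: "map f (rem j l) = rem j (map f l)"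
  by (simp add: rem_def take_map drop_map)

lemma kill_white_col:
  assumes "motzkin t" "j < length (whites t)"
  shows "compat (t[whites t ! j - 1 := 0]) c \<longleftrightarrow> compat t c \<and> wcol t c ! j = 0"
    "wcol (t[whites t ! j - 1 := 0]) c = rem j (wcol t c)"
proof -
  have l: "whites t ! j - 1 < length t" using whites_nth_le[OF assms(2)] by linarith
  have w: "t ! (whites t ! j - 1) \<noteq> 0"
    using nth_mem[OF assms(2)] by (auto simp: white_def)
  have "(\<forall>i<length t. t[whites t ! j - 1 := 0] ! i = 0 \<longrightarrow> c ! i = 0) \<longleftrightarrow>
    (\<forall>i<length t. t ! i = 0 \<longrightarrow> c ! i = 0) \<and> c ! (whites t ! j - 1) = 0"
    using l w by (auto simp: nth_list_update)
  then show "compat (t[whites t ! j - 1 := 0]) c \<longleftrightarrow> compat t c \<and> wcol t c ! j = 0"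
    using kill_white[OF assms] assms(2) by (auto simp: compat_def wcol_def)
  show "wcol (t[whites t ! j - 1 := 0]) c = rem j (wcol t c)"
    unfolding wcol_def map_rem[symmetric] using kill_white[OF assms] by presburger
qed

lemma join_whites_col:
  assumes "motzkin t" "Suc j < length (whites t)"
  shows "compat (t[whites t ! Suc j - 1 := -1]) c \<longleftrightarrow> compat t c \<and> wcol t c ! j = wcol t c ! Suc j"
    "wcol (t[whites t ! Suc j - 1 := -1]) c = rem j (rem j (wcol t c))"
proof -
  define t' where t': "t' = t[whites t ! Suc j - 1 := -1]"
  have l: "whites t ! Suc j - 1 < length t" using whites_nth_le[OF assms(2)] by linarith
  have w: "t ! (whites t ! Suc j - 1) \<noteq> 0"
    using nth_mem[OF assms(2)] by (auto simp: white_def)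
  have "(\<forall>i<length t'. t' ! i = 0 \<longrightarrow> c ! i = 0) \<longleftrightarrow> (\<forall>i<length t. t ! i = 0 \<longrightarrow> c ! i = 0)"
    using l w unfolding t' length_list_update by (metis nth_list_update zero_neq_neg_one)
  moreover have "paired t' = (\<lambda>u v. paired t u v \<or> (u = whites t ! j \<and> v = whites t ! Suc j))"
    using join_whites[OF assms] by (simp add: t')
  ultimately show "compat t' c \<longleftrightarrow> compat t c \<and> wcol t c ! j = wcol t c ! Suc j"
    using assms(2) by (auto simp: compat_def wcol_def)
  show "wcol t' c = rem j (rem j (wcol t c))"
    unfolding wcol_def map_rem[symmetric] t' using join_whites[OF assms] by presburger
qed

text \<open>An arbitrary tensor \<open>V\<close> stands in place of prescribed colours on the white
  vertices, so that a pair of prefixes, whose white vertices may still be matched later, already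
  defines a functional. This is what makes induction over the letters possible.\<close>

definition csum :: "nat \<Rightarrow> int list \<Rightarrow> int list \<Rightarrow> (nat list \<Rightarrow> nat list \<Rightarrow> rat) \<Rightarrow> rat" where
  "csum n t q V = (\<Sum>c\<in>words n (length t).
     if compat t c \<and> compat q c then V (wcol t c) (wcol q c) else 0)"

text \<open>The effect of appending a letter \<open>a\<close>, whose vertex has colour \<open>x\<close>, on a function of the colours of
  the white vertices.\<close>
definition act :: "int \<Rightarrow> nat \<Rightarrow> (nat list \<Rightarrow> rat) \<Rightarrow> nat list \<Rightarrow> rat" where
  "act a x \<phi> A = (if a = 1 then \<phi> (A @ [x]) else if a = 0 then (if x = 0 then \<phi> A else 0)
     else if last A = x then \<phi> (butlast A) else 0)"

lemma snoc_act:
  assumes "motzkin (t @ [a])" "length c = length t"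
  shows "(if compat (t @ [a]) (c @ [x]) then \<phi> (wcol (t @ [a]) (c @ [x])) else 0) =
     (if compat t c then act a x \<phi> (wcol t c) else 0)"
proof -
  have m: "motzkin t" and a: "a \<in> {-1,0,1}" "sum_list t + a \<ge> 0" using assms by (auto simp: motzkin_snoc)
  then have "a = -1 \<Longrightarrow> whites t \<noteq> []" using length_whites[OF m] by auto
  then show ?thesis using a m assms(2) by (auto simp: act_def snoc_up snoc_flat snoc_down)
qed

text \<open>The appended vertex is common to both paths, so one colour \<open>x\<close> enters the
  actions of both letters.\<close>

lemma csum_snoc:
  assumes "motzkin (t @ [a])" "motzkin (q @ [b])" "length q = length t"
  shows "csum n (t @ [a]) (q @ [b]) V =
    csum n t q (\<lambda>A B. \<Sum>x<n. act a x (\<lambda>A'. act b x (V A') B) A)"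
proof -
  have *: "(if compat (t @ [a]) (c @ [x]) \<and> compat (q @ [b]) (c @ [x])
          then V (wcol (t @ [a]) (c @ [x])) (wcol (q @ [b]) (c @ [x])) else 0)
      = (if compat t c \<and> compat q c then act a x (\<lambda>A'. act b x (V A') (wcol q c)) (wcol t c) else 0)"
    (is "?l = ?r") if "length c = length t" for c x
  proof -
    have "?l = (if compat (t @ [a]) (c @ [x]) then (\<lambda>A'. if compat (q @ [b]) (c @ [x])
          then V A' (wcol (q @ [b]) (c @ [x])) else 0) (wcol (t @ [a]) (c @ [x])) else 0)" by simp
    also have "\<dots> = (if compat t c then act a x (\<lambda>A'. if compat (q @ [b]) (c @ [x])
          then V A' (wcol (q @ [b]) (c @ [x])) else 0) (wcol t c) else 0)"
      by (rule snoc_act[OF assms(1) that])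
    also have "(\<lambda>A'. if compat (q @ [b]) (c @ [x]) then V A' (wcol (q @ [b]) (c @ [x])) else 0) =
       (\<lambda>A'. if compat q c then act b x (V A') (wcol q c) else 0)"
      by (rule ext, rule snoc_act[OF assms(2)]) (use that assms(3) in simp)
    also have "(if compat t c then act a x (\<lambda>A'. if compat q c then act b x (V A') (wcol q c) else 0) (wcol t c) else 0) = ?r"
      by (auto simp: act_def)
    finally show ?thesis .
  qed
  have "csum n (t @ [a]) (q @ [b]) V = (\<Sum>x<n. \<Sum>c\<in>words n (length t).
      if compat t c \<and> compat q c then act a x (\<lambda>A'. act b x (V A') (wcol q c)) (wcol t c) else 0)"
    unfolding csum_def by (simp add: sum_words_Suc) (intro sum.cong refl *, simp add: words_def)
  also have "\<dots> = (\<Sum>c\<in>words n (length t). \<Sum>x<n.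
      if compat t c \<and> compat q c then act a x (\<lambda>A'. act b x (V A') (wcol q c)) (wcol t c) else 0)"
    by (rule sum.swap)
  also have "\<dots> = csum n t q (\<lambda>A B. \<Sum>x<n. act a x (\<lambda>A'. act b x (V A') B) A)"
    unfolding csum_def by (intro sum.cong) auto
  finally show ?thesis .
qed

text \<open>The white colours of \<open>q\<close> are reversed, so that the two rightmost white vertices sit in adjacent
  slots and every further letter acts at the middle.\<close>
lemma csum_planar:
  assumes "n > 0" "motzkin t" "motzkin q" "length q = length t"
  shows "\<exists>L. planar n (length (whites t) + length (whites q)) L \<and>
    (\<forall>V. csum n t q V = L (\<lambda>l. V (take (length (whites t)) l) (rev (drop (length (whites t)) l))))"
  using assms(2-)
proof (induction t arbitrary: q rule: rev_induct)
  case Nil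
  have "csum n [] [] V = V [] []" for V
    by (simp add: csum_def compat_def wcol_def paired_def)
  then show ?case using Nil planar.base[of n 1] by (intro exI[of _ "\<lambda>W. 1 * W []"]) auto
next
  case (snoc a t q')
  from snoc.prems obtain q b where [simp]: "q' = q @ [b]"
    by (metis length_greater_0_conv length_append_singleton snoc_eq_iff_butlast zero_less_Suc)
  have m: "motzkin t" "motzkin q" and l: "length q = length t"
    and ab: "a \<in> {-1,0,1}" "sum_list t + a \<ge> 0" "b \<in> {-1,0,1}" "sum_list q + b \<ge> 0"
    using snoc.prems by (auto simp: motzkin_snoc)
  let ?i = "length (whites t)" and ?d = "length (whites q)"
  obtain L where L: "planar n (?i + ?d) L"
    "\<And>V. csum n t q V = L (\<lambda>l. V (take ?i l) (rev (drop ?i l)))"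
    using snoc.IH[OF m l] by blast
  have down: "a = -1 \<Longrightarrow> ?i > 0" "b = -1 \<Longrightarrow> ?d > 0"
    using ab length_whites[OF m(1)] length_whites[OF m(2)] by linarith+
  have S: "csum n (t @ [a]) (q @ [b]) V =
    L (\<lambda>l. \<Sum>x<n. act a x (\<lambda>A'. act b x (V A') (rev (drop ?i l))) (take ?i l))" for V
    using snoc.prems l by (simp add: csum_snoc L(2))
  have cong: "L W = L W'" if "\<And>l. length l = ?i + ?d \<Longrightarrow> set l \<subseteq> {..<n} \<Longrightarrow> W l = W' l" for W W'
    by (rule planar_cong[OF L(1) \<open>n > 0\<close>]) (use that in \<open>auto simp: words_def\<close>)
  \<comment> \<open>Two up steps create a pair of equal colours, a \<open>cap\<close>. An up and a
    flat step create a slot of colour 0, a \<open>dead\<close>. An up and a down step move a slot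
    across the middle and leave \<open>L\<close> unchanged, as do two flat steps. A flat and a down
    step give the adjoint of \<open>dead\<close>, two down steps the adjoint of
    \<open>cap\<close>.\<close>
  consider "a = 1" "b = 1" | "a = 1" "b = 0" | "a = 1" "b = -1" | "a = 0" "b = 1" | "a = 0" "b = 0"
    | "a = 0" "b = -1" | "a = -1" "b = 1" | "a = -1" "b = 0" | "a = -1" "b = -1" using ab by auto
  then have "\<exists>L'. planar n (length (whites (t @ [a])) + length (whites (q @ [b]))) L' \<and>
      (\<forall>V. L (\<lambda>l. \<Sum>x<n. act a x (\<lambda>A'. act b x (V A') (rev (drop ?i l))) (take ?i l)) =
        L' (\<lambda>l. V (take (length (whites (t @ [a]))) l) (rev (drop (length (whites (t @ [a]))) l))))"
  proof cases
    case 1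
    have "planar n (Suc (Suc (?i + ?d))) (\<lambda>W. L (\<lambda>l. \<Sum>v<n. W (ins ?i v (ins ?i v l))))"
      by (rule planar.cap[OF L(1)]) simp
    with 1 show ?thesis
      by (intro exI conjI, simp add: whites_snoc m)
        (auto simp: whites_snoc m act_def ins_def intro!: cong)
  next
    case 2
    have "planar n (Suc (?i + ?d)) (\<lambda>W. L (\<lambda>l. W (ins ?i 0 l)))"
      by (rule planar.dead[OF L(1)]) simp
    with 2 \<open>n > 0\<close> show ?thesis
      by (intro exI conjI, simp add: whites_snoc m)
        (auto simp: whites_snoc m act_def ins_def intro!: cong)
  next
    case 3
    obtain d where d: "?d = Suc d" using down 3 by (cases ?d) auto
    have E: "(\<Sum>x<n. act 1 x (\<lambda>A'. act (-1) x (V A') (rev (drop ?i l))) (take ?i l)) =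
        V (take (Suc ?i) l) (rev (drop (Suc ?i) l))" if "length l = ?i + ?d" "set l \<subseteq> {..<n}" for l V
    proof -
      have "?i < length l" using that d by simp
      then have "drop ?i l = l ! ?i # drop (Suc ?i) l" "take (Suc ?i) l = take ?i l @ [l ! ?i]" "l ! ?i < n"
        using that by (auto simp: Cons_nth_drop_Suc take_Suc_conv_app_nth subset_iff)
      then show ?thesis by (simp add: act_def)
    qed
    from 3 d L(1) show ?thesis
      by (intro exI[of _ L] conjI allI) (auto simp: whites_snoc m E intro!: cong)
  next
    case 4
    have "planar n (Suc (?i + ?d)) (\<lambda>W. L (\<lambda>l. W (ins ?i 0 l)))"
      by (rule planar.dead[OF L(1)]) simp
    with 4 \<open>n > 0\<close> show ?thesis
      by (intro exI conjI, simp add: whites_snoc m)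
        (auto simp: whites_snoc m act_def ins_def intro!: cong)
  next
    case 5
    with L(1) \<open>n > 0\<close> show ?thesis
      by (intro exI[of _ L] conjI allI) (auto simp: whites_snoc m act_def intro!: cong)
  next
    case 6
    obtain d where d: "?d = Suc d" using down 6 by (cases ?d) auto
    have P: "planar n (?i + d) (\<lambda>W. L (\<lambda>l. if l ! ?i = 0 then W (rem ?i l) else 0))"
      by (rule planar_dead_adjoint[OF L(1)]) (use d \<open>n > 0\<close> in auto)
    have E: "(\<Sum>x<n. act 0 x (\<lambda>A'. act (-1) x (V A') (rev (drop ?i l))) (take ?i l)) =
        (if l ! ?i = 0 then V (take ?i (rem ?i l)) (rev (drop ?i (rem ?i l))) else 0)"
      if "length l = ?i + ?d" for l V
    proof -
      have "?i < length l" using that d by simp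
      then have "drop ?i l = l ! ?i # drop (Suc ?i) l"
        using that by (auto simp: Cons_nth_drop_Suc)
      then show ?thesis using that d \<open>n > 0\<close> by (auto simp: rem_def act_def)
    qed
    from 6 d P \<open>n > 0\<close> show ?thesis
      by (intro exI[of _ "\<lambda>W. L (\<lambda>l. if l ! ?i = 0 then W (rem ?i l) else 0)"] conjI allI)
       (auto simp: whites_snoc m E intro!: cong)
  next
    case 7
    obtain i where i: "?i = Suc i" using down 7 by (cases ?i) auto
    have E: "(\<Sum>x<n. act (-1) x (\<lambda>A'. act 1 x (V A') (rev (drop ?i l))) (take ?i l)) =
        V (take i l) (rev (drop i l))" if "length l = ?i + ?d" "set l \<subseteq> {..<n}" for l V
    proof -
      have "i < length l" using that i by simp
      then have "drop i l = l ! i # drop (Suc i) l" "take (Suc i) l = take i l @ [l ! i]" "l ! i < n"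
        using that by (auto simp: Cons_nth_drop_Suc take_Suc_conv_app_nth subset_iff)
      then show ?thesis using i by (simp add: act_def)
    qed
    from 7 i L(1) show ?thesis
      by (intro exI[of _ L] conjI allI) (auto simp: whites_snoc m E[unfolded i] intro!: cong)
  next
    case 8
    obtain i where i: "?i = Suc i" using down 8 by (cases ?i) auto
    have P: "planar n (i + ?d) (\<lambda>W. L (\<lambda>l. if l ! i = 0 then W (rem i l) else 0))"
      by (rule planar_dead_adjoint[OF L(1)]) (use i \<open>n > 0\<close> in auto)
    have E: "(\<Sum>x<n. act (-1) x (\<lambda>A'. act 0 x (V A') (rev (drop ?i l))) (take ?i l)) =
        (if l ! i = 0 then V (take i (rem i l)) (rev (drop i (rem i l))) else 0)"
      if "length l = ?i + ?d" for l V
    proof -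
      have "i < length l" using that i by simp
      then have "take (Suc i) l = take i l @ [l ! i]" by (simp add: take_Suc_conv_app_nth)
      then show ?thesis using that i \<open>n > 0\<close> by (auto simp: rem_def act_def)
    qed
    from 8 i P \<open>n > 0\<close> show ?thesis
      by (intro exI[of _ "\<lambda>W. L (\<lambda>l. if l ! i = 0 then W (rem i l) else 0)"] conjI allI)
       (auto simp: whites_snoc m E[unfolded i] intro!: cong)
  next
    case 9
    obtain i where i: "?i = Suc i" using down 9 by (cases ?i) auto
    obtain d where d: "?d = Suc d" using down 9 by (cases ?d) auto
    have P: "planar n (i + d) (\<lambda>W. L (\<lambda>l. if l ! i = l ! Suc i then W (rem i (rem i l)) else 0))"
      by (rule planar_cap_adjoint[OF L(1)]) (use i d \<open>n > 0\<close> in auto)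
    have E: "(\<Sum>x<n. act (-1) x (\<lambda>A'. act (-1) x (V A') (rev (drop ?i l))) (take ?i l)) =
        (if l ! i = l ! Suc i then V (take i (rem i (rem i l))) (rev (drop i (rem i (rem i l)))) else 0)"
      if "length l = ?i + ?d" "set l \<subseteq> {..<n}" for l V
    proof -
      have "Suc i < length l" using that i d by simp
      then have "take (Suc i) l = take i l @ [l ! i]" "drop (Suc i) l = l ! Suc i # drop (Suc (Suc i)) l" "l ! i < n"
        using that by (auto simp: take_Suc_conv_app_nth Cons_nth_drop_Suc subset_iff)
      then show ?thesis using that i d by (auto simp: rem_def act_def)
    qed
    from 9 i d P show ?thesis
      by (intro exI[of _ "\<lambda>W. L (\<lambda>l. if l ! i = l ! Suc i then W (rem i (rem i l)) else 0)"] conjI allI)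
       (auto simp: whites_snoc m E[unfolded i] intro!: cong)
  qed
  then show ?case unfolding \<open>q' = q @ [b]\<close> S .
qed

section \<open>The harmonic tensor of the bracket\<close>

text \<open>The order of the quantifiers is the point: \<open>f\<close> does not depend on
  \<open>V\<close>, so its value, which is unknown here, can be found from any other harmonic
  tensor.\<close>

lemma csum_harmonic:
  assumes "n > 0" "motzkin t" "motzkin q" "length q = length t" "length (whites q) \<le> length (whites t)"
  shows "\<exists>f. \<forall>V. (\<forall>B. harmonic n (length (whites t)) (length (whites t)) (\<lambda>A. V A B)) \<longrightarrow>
    csum n t q V = (if length (whites q) = length (whites t)
       then f * (\<Sum>e\<in>words n (length (whites t)). V e e) else 0)"
proof -
  let ?i = "length (whites t)" and ?d = "length (whites q)"
  obtain L where L: "planar n (?i + ?d) L"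
    "\<And>V. csum n t q V = L (\<lambda>l. V (take ?i l) (rev (drop ?i l)))"
    using csum_planar[OF assms(1-4)] by blast
  obtain f where f: "\<And>i d W. ?i + ?d = i + d \<Longrightarrow> d \<le> i \<Longrightarrow> harmonic n (?i + ?d) i W \<Longrightarrow>
     L W = (if d = i then f * (\<Sum>e\<in>words n i. W (e @ rev e)) else 0)"
    using planar_harmonic[OF L(1) assms(1)] by blast
  show ?thesis
  proof (intro exI[of _ f] allI impI)
    fix V :: "nat list \<Rightarrow> nat list \<Rightarrow> rat"
    assume h: "\<forall>B. harmonic n ?i ?i (\<lambda>A. V A B)"
    have "harmonic n (?i + ?d) ?i (\<lambda>l. V (take ?i l) (rev (drop ?i l)))"
      unfolding harmonic_def
    proof (intro conjI allI impI)
      fix j and l :: "nat list" assume "j < ?i" "Suc (length l) = ?i + ?d"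
      then have "take ?i (ins j 0 l) = ins j 0 (take (?i - 1) l)"
        by (auto simp: ins_def take_Cons' drop_take min_def)
      moreover have "Suc (length (take (?i - 1) l)) = ?i"
        using \<open>j < ?i\<close> \<open>Suc (length l) = ?i + ?d\<close> by auto
      ultimately show "V (take ?i (ins j 0 l)) (rev (drop ?i (ins j 0 l))) = 0"
        using h \<open>j < ?i\<close> by (simp add: harmonic_def)
    next
      fix j and l :: "nat list" assume *: "Suc j < ?i" "Suc (Suc (length l)) = ?i + ?d"
      have "take ?i (ins j v (ins j v l)) = ins j v (ins j v (take (?i - 2) l))"
        "drop ?i (ins j v (ins j v l)) = drop (?i - 2) l" for v
        using * by (auto simp: ins_def take_Cons' drop_Cons' drop_take min_def numeral_2_eq_2)
      moreover have "Suc (Suc (length (take (?i - 2) l))) = ?i" using * by auto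
      ultimately show "(\<Sum>v<n. V (take ?i (ins j v (ins j v l))) (rev (drop ?i (ins j v (ins j v l))))) = 0"
        using h * by (simp add: harmonic_def)
    qed
    from f[OF refl assms(5) this] show "csum n t q V = (if ?d = ?i then f * (\<Sum>e\<in>words n ?i. V e e) else 0)"
      unfolding L(2) by (auto intro!: sum.cong arg_cong[where f = "(*) f"] dest!: wordsD(1))
  qed
qed

section \<open>Prescribed colours of the white vertices, and the resulting counts\<close>

definition tgt :: "nat \<Rightarrow> nat list" where "tgt r = [1..<Suc r]"

lemma length_tgt [simp]: "length (tgt r) = r" by (simp add: tgt_def)
lemma nth_tgt [simp]: "j < r \<Longrightarrow> tgt r ! j = Suc j" by (simp add: tgt_def del: upt_Suc)
lemma tgt_Suc: "tgt (Suc r) = tgt r @ [Suc r]" by (simp add: tgt_def)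
lemma set_tgt [simp]: "set (tgt r) = {1..r}" by (auto simp: tgt_def)

definition ind :: "nat \<Rightarrow> nat list \<Rightarrow> rat" where "ind r A = (if A = tgt r then 1 else 0)"

text \<open>The value of the form at \<open>x = n\<close>, as \<open>form_poly\<close> shows.
  Colours start from 1 in \<open>tgt\<close> because 0 marks black isolated vertices.\<close>

definition cnt :: "nat \<Rightarrow> nat \<Rightarrow> int list \<Rightarrow> int list \<Rightarrow> rat" where
  "cnt n r p q = csum n p q (\<lambda>A B. ind r A * ind r B)"

lemma act_mult: "act a x (\<lambda>A'. g A' * c) A = act a x g A * c"
  by (simp add: act_def)

lemma act_mult_left: "act a x (\<lambda>A'. c * g A') A = c * act a x g A"
  by (simp add: act_def)

lemma cnt_snoc:
  assumes "motzkin (t @ [a])" "motzkin (q @ [b])" "length q = length t"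
  shows "cnt n r (t @ [a]) (q @ [b]) = csum n t q (\<lambda>A B. \<Sum>x<n. act a x (ind r) A * act b x (ind r) B)"
  unfolding cnt_def csum_snoc[OF assms] by (simp add: act_mult act_mult_left)

text \<open>Editing the path is traded for editing the tensor, so that all terms of a bracket become
  values of the single functional \<open>csum n t q\<close>.\<close>

lemma csum_kill:
  assumes "motzkin t" "j < length (whites t)"
  shows "csum n (t[whites t ! j - 1 := 0]) q V = csum n t q (\<lambda>A B. if A ! j = 0 then V (rem j A) B else 0)"
  unfolding csum_def kill_white_col[OF assms] length_list_update by (intro sum.cong) auto

lemma csum_join:
  assumes "motzkin t" "Suc j < length (whites t)"
  shows "csum n (t[whites t ! Suc j - 1 := -1]) q V =
     csum n t q (\<lambda>A B. if A ! j = A ! Suc j then V (rem j (rem j A)) B else 0)"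
  unfolding csum_def join_whites_col[OF assms] length_list_update by (intro sum.cong) auto

lemma kill_two_whites:
  assumes "motzkin t" "Suc j < length (whites t)"
  defines "t' \<equiv> t[whites t ! j - 1 := 0, whites t ! Suc j - 1 := 0]"
  shows "motzkin t'" "whites t' = rem j (rem j (whites t))"
    "csum n t' q V = csum n t q (\<lambda>A B. if A ! j = 0 \<and> A ! Suc j = 0 then V (rem j (rem j A)) B else 0)"
proof -
  define s where s: "s = t[whites t ! j - 1 := 0]"
  have k: "motzkin s" "whites s = rem j (whites t)"
    using kill_white[OF assms(1), of j] assms(2) by (auto simp: s)
  have j: "j < length (whites s)" using assms(2) by (simp add: k length_rem)
  \<comment> \<open>After the first removal the vertex with index \<open>Suc j\<close> has index
    \<open>j\<close>.\<close>
  have t': "t' = s[whites s ! j - 1 := 0]"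
    using assms(2) unfolding k t'_def s[symmetric] by (simp add: nth_rem)
  show "motzkin t'" "whites t' = rem j (rem j (whites t))"
    using kill_white[OF k(1) j] unfolding t' k(2) by auto
  show "csum n t' q V = csum n t q (\<lambda>A B. if A ! j = 0 \<and> A ! Suc j = 0 then V (rem j (rem j A)) B else 0)"
    unfolding t' csum_kill[OF k(1) j] unfolding s csum_kill[OF assms(1) Suc_lessD[OF assms(2)]]
    unfolding csum_def
    using assms(2) by (intro sum.cong) (auto simp: nth_rem)
qed

section \<open>Chebyshev coefficients and harmonicity of the bracket tensor\<close>

abbreviation chb :: "nat \<Rightarrow> nat \<Rightarrow> rat" where "chb n m \<equiv> cheb_u m (of_nat n - 1)"

text \<open>\<open>u\<^sub>r\<close> times the coefficient tensor of the bracket of \<open>t @ [-1]\<close> in the colours of the white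
  vertices of \<open>t\<close>, when the last vertex has colour \<open>x\<close>.\<close>
definition jw :: "nat \<Rightarrow> nat \<Rightarrow> nat \<Rightarrow> nat list \<Rightarrow> rat" where
  "jw n r x A = chb n r * (if x \<noteq> 0 \<and> A = tgt r @ [x] then 1 else 0)
     - (\<Sum>m<r. (-1) ^ (r - 1 - m) * chb n m *
          (if x = r \<and> A ! m = A ! Suc m \<and> A ! m \<noteq> 0 \<and> rem m (rem m A) = tgt (r - 1) then 1 else 0))"

lemma set_rem_rem: "Suc m < length A \<Longrightarrow> A ! m = A ! Suc m \<Longrightarrow> set A \<subseteq> insert (A ! m) (set (rem m (rem m A)))"
  using set_ins[of m "A ! m" "rem m A"] set_ins[of m "A ! Suc m" "rem m (rem m A)"]
    ins_rem[of m A] ins_rem[of m "rem m A"]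
  by (auto simp: length_rem nth_rem)

text \<open>Subtracting the terms with deleted edge has left only nonzero colours on the joined
  pairs, and the remaining entries come from \<open>tgt\<close>.\<close>

lemma jw_zero:
  assumes "0 \<in> set A" "length A = Suc r"
  shows "jw n r x A = 0"
proof -
  let ?P = "\<lambda>m. x = r \<and> A ! m = A ! Suc m \<and> A ! m \<noteq> 0 \<and> rem m (rem m A) = tgt (r - 1)"
  have P: "\<not> ?P m" if "m < r" for m
  proof
    assume "x = r \<and> A ! m = A ! Suc m \<and> A ! m \<noteq> 0 \<and> rem m (rem m A) = tgt (r - 1)"
    then have "set A \<subseteq> insert (A ! m) {1..r - 1}" "A ! m \<noteq> 0"
      using set_rem_rem[of m A] assms that by auto
    then show False using assms(1) by fastforce
  qed
  have Q: "\<not> (x \<noteq> 0 \<and> A = tgt r @ [x])" using assms by auto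
  have S: "(\<Sum>m<r. (-1) ^ (r - 1 - m) * chb n m * (if ?P m then 1 else 0)) = 0"
  proof (rule sum.neutral, rule ballI)
    fix m assume "m \<in> {..<r}"
    then have "m < r" by simp
    show "(-1) ^ (r - 1 - m) * chb n m * (if ?P m then 1 else 0) = 0"
      unfolding if_not_P[OF P[OF \<open>m < r\<close>]] by simp
  qed
  show ?thesis unfolding jw_def S if_not_P[OF Q] by simp
qed

lemma tgt_no_repeat: "ins j v (ins j v l) \<noteq> tgt r" if "j \<le> length l"
proof
  assume e: "ins j v (ins j v l) = tgt r"
  then have "r = Suc (Suc (length l))" by (metis length_ins length_tgt)
  then have "tgt r ! j \<noteq> tgt r ! Suc j" using that by simp
  then show False unfolding e[symmetric] using that by (simp add: nth_ins)
qed

text \<open>These are the Temperley-Lieb relations. For \<open>m = j\<close> a loop closes; its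
  value is \<open>n - 1\<close>, as colour 0 is excluded. For neighbouring \<open>m\<close> and
  \<open>j\<close> the strand straightens. In the other cases two equal neighbours would survive in
  \<open>tgt (r - 1)\<close>, which has none.\<close>

lemma jw_cap_term:
  assumes "length l = r - 1" "j < r" "m < r" "r < n"
  shows "(\<Sum>v<n. if ins j v (ins j v l) ! m = ins j v (ins j v l) ! Suc m \<and> ins j v (ins j v l) ! m \<noteq> 0
        \<and> rem m (rem m (ins j v (ins j v l))) = tgt (r - 1) then 1 else 0 :: rat) =
    (if l = tgt (r - 1) then (if m = j then of_nat n - 1 else 0) + (if m = Suc j then 1 else 0) +
       (if Suc m = j then 1 else 0) else 0)"
    (is "(\<Sum>v<n. ?f v) = ?R")
proof -
  consider "m = j" | "m = Suc j" | "Suc m = j" | "Suc m < j" | "Suc j < m" by linarith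
  then show ?thesis
  proof cases
    case 1
    have "?f v = (if v \<in> {..<n} - {0} then if l = tgt (r - 1) then 1 else 0 else 0)" if "v < n" for v
      using assms 1 that by (auto simp: nth_ins rem_ins_same)
    then have "(\<Sum>v<n. ?f v) = (\<Sum>v<n. if v \<in> {..<n} - {0} then if l = tgt (r - 1) then 1 else 0 else 0)"
      by (intro sum.cong) auto
    also have "\<dots> = (\<Sum>v\<in>{..<n} - {0}. if l = tgt (r - 1) then 1 else 0)"
      by (intro sum.mono_neutral_cong_right) auto
    also have "\<dots> = ?R" using 1 assms by (simp add: of_nat_diff)
    finally show ?thesis .
  next
    case 2
    have jl: "j < length l" using 2 assms by simp
    have "?f v = (if v = l ! j then if l = tgt (r - 1) then 1 else 0 else 0)" for v
    proof (cases "v = l ! j")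
      case True
      have "rem m (rem m (ins j v (ins j v l))) = ins j v (rem j l)"
        using 2 jl by (simp add: rem_ins_less rem_ins_same length_rem)
      then have "rem m (rem m (ins j v (ins j v l))) = l" using True jl by (simp add: ins_rem)
      then show ?thesis using True 2 jl assms by (auto simp: nth_ins)
    next
      case False
      then show ?thesis using 2 jl by (auto simp: nth_ins)
    qed
    then have "(\<Sum>v<n. ?f v) = (if l ! j < n then if l = tgt (r - 1) then 1 else 0 else 0)" by simp
    also have "\<dots> = ?R" using 2 assms jl by auto
    finally show ?thesis .
  next
    case 3
    have jl: "m < length l" using 3 assms by simp
    have "?f v = (if v = l ! m then if l = tgt (r - 1) then 1 else 0 else 0)" for v
    proof (cases "v = l ! m")
      case True
      have "rem m (rem m (ins j v (ins j v l))) = ins m v (rem m l)"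
        using 3 jl by (auto simp add: rem_ins_less rem_ins_greater rem_ins_same length_rem)
      then have "rem m (rem m (ins j v (ins j v l))) = l" using True jl by (simp add: ins_rem)
      then show ?thesis using True 3 jl assms by (auto simp: nth_ins)
    next
      case False
      then show ?thesis using 3 jl by (auto simp: nth_ins)
    qed
    then have "(\<Sum>v<n. ?f v) = (if l ! m < n then if l = tgt (r - 1) then 1 else 0 else 0)" by simp
    also have "\<dots> = ?R" using 3 assms jl by auto
    finally show ?thesis .
  next
    case 4
    have "rem m (rem m (ins j v (ins j v l))) = ins (j - 2) v (ins (j - 2) v (rem m (rem m l)))" for v
      using 4 assms by (simp add: rem_ins_greater length_rem numeral_2_eq_2)
    moreover have "ins (j - 2) v (ins (j - 2) v (rem m (rem m l))) \<noteq> tgt (r - 1)" for v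
      using 4 assms by (intro tgt_no_repeat) (simp add: length_rem)
    ultimately show ?thesis using 4 by simp
  next
    case 5
    obtain m' where m': "m = Suc (Suc m')" using 5 that[of "m - 2"] by simp
    have "rem m (rem m (ins j v (ins j v l))) = ins j v (ins j v (rem m' (rem m' l)))" for v
      using 5 assms m' by (simp add: rem_ins_less length_rem)
    moreover have "ins j v (ins j v (rem m' (rem m' l))) \<noteq> tgt (r - 1)" for v
      using 5 assms m' by (intro tgt_no_repeat) (simp add: length_rem)
    ultimately show ?thesis using 5 by simp
  qed
qed

text \<open>The entries of \<open>tgt r\<close> are distinct, so two equal neighbours in
  \<open>tgt r @ [x]\<close> can only be the last two, and then \<open>x = r\<close>.\<close>

lemma jw_head_cap:
  assumes "length l = r - 1" "j < r" "r < n"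
  shows "(\<Sum>v<n. if x \<noteq> 0 \<and> ins j v (ins j v l) = tgt r @ [x] then 1 else 0 :: rat) =
    (if Suc j = r \<and> x = r \<and> l = tgt (r - 1) then 1 else 0)"
proof -
  have "ins j v (ins j v l) = tgt r @ [x] \<longleftrightarrow> v = r \<and> Suc j = r \<and> x = r \<and> l = tgt (r - 1)" for v
  proof
    assume e: "ins j v (ins j v l) = tgt r @ [x]"
    have "ins j v (ins j v l) ! j = v" "ins j v (ins j v l) ! Suc j = v" using assms by (simp_all add: nth_ins)
    then have v: "(tgt r @ [x]) ! j = v" "(tgt r @ [x]) ! Suc j = v" unfolding e by auto
    then have 1: "Suc j = r" "v = r" "x = r" using assms by (auto simp: nth_append split: if_splits)
    then have "l = rem j (rem j (tgt (r - 1) @ [r, x]))"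
      using e assms tgt_Suc[of j] by (metis append.assoc append_Cons append_Nil diff_Suc_1 le_refl length_ins order.trans le_SucI rem_ins_same)
    also have "\<dots> = tgt (r - 1)" using 1 rem_length[of "tgt j"] by auto
    finally show "v = r \<and> Suc j = r \<and> x = r \<and> l = tgt (r - 1)" using 1 by simp
  next
    assume "v = r \<and> Suc j = r \<and> x = r \<and> l = tgt (r - 1)"
    then show "ins j v (ins j v l) = tgt r @ [x]" using tgt_Suc[of j] by (auto simp: ins_def)
  qed
  then have "(\<Sum>v<n. if x \<noteq> 0 \<and> ins j v (ins j v l) = tgt r @ [x] then 1 else 0 :: rat) =
     (\<Sum>v<n. if v = r then if Suc j = r \<and> x = r \<and> l = tgt (r - 1) then 1 else 0 else 0)"
    by (intro sum.cong) auto
  then show ?thesis using assms by simp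
qed

text \<open>Each \<open>j\<close> collects \<open>(n - 1) u_j - u_(j+1) - u_(j-1)\<close>, which the
  recursion makes 0. For the last \<open>j\<close> the term \<open>u_(j+1) = u_r\<close> is missing
  from the sum and remains.\<close>

lemma chb_alternating:
  assumes "j < r"
  shows "(\<Sum>m<r. (-1) ^ (r - 1 - m) * chb n m * ((if m = j then of_nat n - 1 else 0) +
      (if m = Suc j then 1 else 0) + (if Suc m = j then 1 else 0))) = (if Suc j = r then chb n r else 0)"
proof -
  have "(\<Sum>m<r. (-1) ^ (r - 1 - m) * chb n m * (if Suc m = j then 1 else 0)) =
     (case j of 0 \<Rightarrow> 0 | Suc i \<Rightarrow> (-1) ^ (r - 1 - i) * chb n i)"
    using assms by (cases j) (auto simp: if_distrib cong: if_cong)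
  then have "(\<Sum>m<r. (-1) ^ (r - 1 - m) * chb n m * ((if m = j then of_nat n - 1 else 0) +
      (if m = Suc j then 1 else 0) + (if Suc m = j then 1 else 0)))
    = (-1) ^ (r - 1 - j) * chb n j * (of_nat n - 1)
      + (if Suc j < r then (-1) ^ (r - 1 - Suc j) * chb n (Suc j) else 0)
      + (case j of 0 \<Rightarrow> 0 | Suc i \<Rightarrow> (-1) ^ (r - 1 - i) * chb n i)"
    using assms by (simp add: distrib_left sum.distrib) (simp add: if_distrib cong: if_cong)
  also have "(case j of 0 \<Rightarrow> 0 | Suc i \<Rightarrow> (-1) ^ (r - 1 - i) * chb n i) =
      - ((-1) ^ (r - 1 - j)) * (case j of 0 \<Rightarrow> 0 | Suc i \<Rightarrow> chb n i)"
  proof (cases j)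
    case (Suc i)
    then have "r - 1 - i = Suc (r - 1 - j)" using assms by simp
    then show ?thesis using Suc by simp
  qed simp
  also have "(if Suc j < r then (-1) ^ (r - 1 - Suc j) * chb n (Suc j) else 0) =
      (if Suc j < r then - ((-1) ^ (r - 1 - j)) * chb n (Suc j) else 0)"
  proof (cases "Suc j < r")
    case True
    then have "r - 1 - j = Suc (r - 1 - Suc j)" by simp
    then show ?thesis by simp
  qed simp
  also have "(case j of 0 \<Rightarrow> 0 | Suc i \<Rightarrow> chb n i) = (of_nat n - 1) * chb n j - chb n (Suc j)"
    by (cases j) auto
  finally show ?thesis using assms by (auto simp: algebra_simps)
qed

text \<open>The boundary term left over by the alternating sum is the contraction of the head term,
  and the two cancel.\<close>

lemma jw_harmonic:
  assumes "r < n"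
  shows "harmonic n (Suc r) (Suc r) (jw n r x)"
  unfolding harmonic_def
proof (intro conjI allI impI)
  fix j and l :: "nat list" assume "j < Suc r" "Suc (length l) = Suc r"
  then show "jw n r x (ins j 0 l) = 0" by (intro jw_zero) (auto simp: set_ins)
next
  fix j and l :: "nat list" assume *: "Suc j < Suc r" "Suc (Suc (length l)) = Suc r"
  then have l: "length l = r - 1" "j < r" by auto
  let ?A = "\<lambda>v. ins j v (ins j v l)"
  let ?g = "\<lambda>m v. if ?A v ! m = ?A v ! Suc m \<and> ?A v ! m \<noteq> 0 \<and> rem m (rem m (?A v)) = tgt (r - 1) then 1 else 0 :: rat"
  have "(\<Sum>v<n. jw n r x (?A v)) = chb n r * (\<Sum>v<n. if x \<noteq> 0 \<and> ?A v = tgt r @ [x] then 1 else 0)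
     - (\<Sum>v<n. \<Sum>m<r. (-1) ^ (r - 1 - m) * chb n m * (if x = r then ?g m v else 0))"
    unfolding jw_def sum_subtractf sum_distrib_left
    by (intro arg_cong2[where f = "(-)"] sum.cong refl arg_cong2[where f = "(*)"]) auto
  also have "(\<Sum>v<n. \<Sum>m<r. (-1) ^ (r - 1 - m) * chb n m * (if x = r then ?g m v else 0)) =
     (\<Sum>m<r. (-1) ^ (r - 1 - m) * chb n m * (if x = r then \<Sum>v<n. ?g m v else 0))"
    by (subst sum.swap, cases "x = r") (simp_all add: sum_distrib_left)
  also have "\<dots> = (\<Sum>m<r. (-1) ^ (r - 1 - m) * chb n m * ((if m = j then of_nat n - 1 else 0) +
      (if m = Suc j then 1 else 0) + (if Suc m = j then 1 else 0))) * (if x = r \<and> l = tgt (r - 1) then 1 else 0)"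
    unfolding sum_distrib_right
  proof (intro sum.cong refl)
    fix m assume "m \<in> {..<r}"
    then have "m < r" by simp
    show "(-1) ^ (r - 1 - m) * chb n m * (if x = r then \<Sum>v<n. ?g m v else 0) =
      (-1) ^ (r - 1 - m) * chb n m * ((if m = j then of_nat n - 1 else 0) +
      (if m = Suc j then 1 else 0) + (if Suc m = j then 1 else 0)) * (if x = r \<and> l = tgt (r - 1) then 1 else 0)"
      unfolding jw_cap_term[OF l \<open>m < r\<close> assms] by auto
  qed
  also have "\<dots> = (if Suc j = r then chb n r else 0) * (if x = r \<and> l = tgt (r - 1) then 1 else 0)"
    unfolding chb_alternating[OF l(2)] by simp
  finally show "(\<Sum>v<n. jw n r x (?A v)) = 0"
    unfolding jw_head_cap[OF l assms] by auto
qed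


text \<open>The word \<open>tgt r\<close> contains no 0 and no repetition. This supplies the second
  harmonic tensor that determines the scalar in \<open>csum_jw\<close>.\<close>

lemma ind_harmonic: "harmonic n r r (\<lambda>A. ind r A * c)"
  unfolding harmonic_def
proof (intro conjI allI impI)
  fix j and l :: "nat list"
  have "ins j 0 l \<noteq> tgt r"
    using set_ins[of j 0 l] set_tgt[of r] by (metis atLeastAtMost_iff insertI1 not_one_le_zero)
  then show "ind r (ins j 0 l) * c = 0" by (simp add: ind_def)
next
  fix j and l :: "nat list" assume "Suc j < r" "Suc (Suc (length l)) = r"
  then show "(\<Sum>v<n. ind r (ins j v (ins j v l)) * c) = 0"
    using tgt_no_repeat[of j l _ r] by (simp add: ind_def)
qed

lemma harmonic_sum:
  assumes "\<And>x. x \<in> S \<Longrightarrow> harmonic n N i (W x)"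
  shows "harmonic n N i (\<lambda>A. \<Sum>x\<in>S. W x A * c x)"
  unfolding harmonic_def
proof (intro conjI allI impI)
  fix j and l :: "nat list" assume "j < i" "Suc (length l) = N"
  then show "(\<Sum>x\<in>S. W x (ins j 0 l) * c x) = 0"
    using assms by (intro sum.neutral) (simp add: harmonic_def)
next
  fix j and l :: "nat list" assume *: "Suc j < i" "Suc (Suc (length l)) = N"
  have "(\<Sum>v<n. \<Sum>x\<in>S. W x (ins j v (ins j v l)) * c x) = (\<Sum>x\<in>S. (\<Sum>v<n. W x (ins j v (ins j v l))) * c x)"
    by (subst sum.swap) (simp add: sum_distrib_right)
  also have "\<dots> = 0" using assms * by (intro sum.neutral) (simp add: harmonic_def)
  finally show "(\<Sum>v<n. \<Sum>x\<in>S. W x (ins j v (ins j v l)) * c x) = 0" .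
qed

lemma tgt_in_words: "r < n \<Longrightarrow> tgt r \<in> words n r"
  by (auto simp: words_def)

text \<open>The head contributes \<open>u_r\<close> for each of the \<open>n - 1\<close> nonzero
  colours, and of the joined terms only \<open>m = r - 1\<close> with \<open>x = r\<close> occurs,
  with coefficient \<open>u_(r-1)\<close>. The recursion makes the difference
  \<open>u_(r+1)\<close>.\<close>

lemma jw_diagonal:
  assumes "r < n"
  shows "(\<Sum>x<n. jw n r x (tgt r @ [x])) = chb n (Suc r)"
proof -
  let ?P = "\<lambda>x m. x = r \<and> (tgt r @ [x]) ! m = (tgt r @ [x]) ! Suc m \<and> (tgt r @ [x]) ! m \<noteq> 0 \<and>
     rem m (rem m (tgt r @ [x])) = tgt (r - 1)"
  have P: "?P x m \<longleftrightarrow> Suc m = r \<and> x = r" if "m < r" for m x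
  proof
    assume "?P x m" then show "Suc m = r \<and> x = r" using that by (auto simp: nth_append split: if_splits)
  next
    assume *: "Suc m = r \<and> x = r"
    then have "tgt r @ [x] = tgt m @ [r, r]" using tgt_Suc[of m] by simp
    then have "rem m (rem m (tgt r @ [x])) = tgt m" using rem_length[of "tgt m"] by simp
    then show "?P x m" using * by (auto simp: nth_append)
  qed
  have "jw n r x (tgt r @ [x]) = (if x \<noteq> 0 then chb n r else 0) -
      (if x = r then case r of 0 \<Rightarrow> 0 | Suc m \<Rightarrow> chb n m else 0)" for x
  proof -
    have "(\<Sum>m<r. (-1) ^ (r - 1 - m) * chb n m * (if ?P x m then 1 else 0)) =
        (\<Sum>m<r. if Suc m = r then if x = r then chb n m else 0 else 0)"
      by (intro sum.cong refl) (subst P, auto)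
    also have "\<dots> = (if x = r then case r of 0 \<Rightarrow> 0 | Suc m \<Rightarrow> chb n m else 0)"
      by (cases r) auto
    finally show ?thesis unfolding jw_def by simp
  qed
  then have "(\<Sum>x<n. jw n r x (tgt r @ [x])) = (\<Sum>x<n. if x \<noteq> 0 then chb n r else 0) -
      (case r of 0 \<Rightarrow> 0 | Suc m \<Rightarrow> chb n m)"
    using assms by (simp add: sum_subtractf)
  also have "(\<Sum>x<n. if x \<noteq> 0 then chb n r else 0) = (\<Sum>x\<in>{..<n} - {0}. chb n r)"
    by (intro sum.mono_neutral_cong_right) auto
  also have "\<dots> = (of_nat n - 1) * chb n r" using assms by (simp add: of_nat_diff)
  also have "(of_nat n - 1) * chb n r - (case r of 0 \<Rightarrow> 0 | Suc m \<Rightarrow> chb n m) = chb n (Suc r)"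
    by (cases r) auto
  finally show ?thesis .
qed

text \<open>If \<open>b\<close> is not -1, then \<open>q\<close> has at most \<open>r\<close> white
  vertices against \<open>r + 1\<close> harmonic slots, and the value is 0. If
  \<open>b = -1\<close>, both harmonic tensors are multiplied by the same scalar \<open>f\<close>;
  the indicator tensor has diagonal sum 1, which identifies \<open>f\<close> with
  \<open>cnt n (Suc r) t q\<close>.\<close>

lemma csum_jw:
  assumes "Suc r < n" "motzkin t" "motzkin (q @ [b])" "length q = length t"
    "length (whites t) = Suc r" "length (whites (q @ [b])) = r"
  shows "csum n t q (\<lambda>A B. \<Sum>x<n. jw n r x A * act b x (ind r) B) =
    (if b = -1 then chb n (Suc r) * cnt n (Suc r) t q else 0)"
proof -
  have m: "motzkin q" and b: "b \<in> {-1,0,1}" using assms(3) by (auto simp: motzkin_snoc)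
  have lb: "int (length (whites q)) + b = int r"
    using assms(6) length_whites[OF assms(3)] length_whites[OF m] by simp
  then have le: "length (whites q) \<le> length (whites t)" "length (whites q) = length (whites t) \<longleftrightarrow> b = -1"
    using b assms(5) by auto
  have "n > 0" using assms(1) by simp
  from csum_harmonic[OF this assms(2) m assms(4) le(1), unfolded le(2), unfolded assms(5)]
  obtain f where f: "\<And>V. (\<And>B. harmonic n (Suc r) (Suc r) (\<lambda>A. V A B)) \<Longrightarrow>
    csum n t q V = (if b = -1 then f * (\<Sum>e\<in>words n (Suc r). V e e) else 0)"
    by blast
  have 1: "csum n t q (\<lambda>A B. \<Sum>x<n. jw n r x A * act b x (ind r) B) =
      (if b = -1 then f * (\<Sum>e\<in>words n (Suc r). \<Sum>x<n. jw n r x e * act b x (ind r) e) else 0)"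
    by (rule f, rule harmonic_sum, rule jw_harmonic) (use assms(1) in simp)
  have 2: "cnt n (Suc r) t q = (if b = -1 then f * (\<Sum>e\<in>words n (Suc r). ind (Suc r) e * ind (Suc r) e) else 0)"
    unfolding cnt_def by (rule f, rule ind_harmonic)
  have 3: "(\<Sum>e\<in>words n (Suc r). ind (Suc r) e * ind (Suc r) e) = 1"
  proof -
    have "(\<Sum>e\<in>words n (Suc r). ind (Suc r) e * ind (Suc r) e) = (\<Sum>e\<in>words n (Suc r). if e = tgt (Suc r) then 1 else 0)"
      by (intro sum.cong) (auto simp: ind_def)
    then show ?thesis using tgt_in_words[OF assms(1)] by simp
  qed
  have 4: "(\<Sum>e\<in>words n (Suc r). \<Sum>x<n. jw n r x e * act (-1) x (ind r) e) = chb n (Suc r)"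
  proof -
    have "(\<Sum>e\<in>words n (Suc r). \<Sum>x<n. jw n r x e * act (-1) x (ind r) e) =
       (\<Sum>x<n. \<Sum>e\<in>words n (Suc r). if e = tgt r @ [x] then jw n r x (tgt r @ [x]) else 0)"
    proof (subst sum.swap, intro sum.cong refl)
      fix x e assume "e \<in> words n (Suc r)"
      then have "e \<noteq> []" by (auto simp: words_def)
      then have "last e = x \<and> butlast e = tgt r \<longleftrightarrow> e = tgt r @ [x]"
        by (metis append_butlast_last_id butlast_snoc last_snoc)
      then show "jw n r x e * act (-1) x (ind r) e = (if e = tgt r @ [x] then jw n r x (tgt r @ [x]) else 0)"
        by (auto simp: act_def ind_def)
    qed
    also have "\<dots> = (\<Sum>x<n. jw n r x (tgt r @ [x]))"
    proof (intro sum.cong refl)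
      fix x assume "x \<in> {..<n}"
      then have "tgt r @ [x] \<in> words n (Suc r)" using assms(1) by (auto simp: words_def)
      then show "(\<Sum>e\<in>words n (Suc r). if e = tgt r @ [x] then jw n r x (tgt r @ [x]) else 0) = jw n r x (tgt r @ [x])"
        by simp
    qed
    finally show ?thesis using jw_diagonal[of r n] assms(1) by simp
  qed
  show ?thesis
  proof (cases "b = -1")
    case True
    then show ?thesis unfolding 1 2 3 using 4 by simp
  qed (simp add: 1)
qed

section \<open>The bracket as a signed sum of counts\<close>

lemma csum_cong:
  assumes "\<And>A B. length A = length (whites t) \<Longrightarrow> length B = length (whites q) \<Longrightarrow> V A B = V' A B"
  shows "csum n t q V = csum n t q V'"
  unfolding csum_def by (intro sum.cong refl) (simp add: assms)

lemma csum_diff: "csum n t q (\<lambda>A B. V A B - V' A B) = csum n t q V - csum n t q V'"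
  unfolding csum_def sum_subtractf[symmetric] by (intro sum.cong) auto

lemma csum_scale: "csum n t q (\<lambda>A B. a * V A B) = a * csum n t q V"
  unfolding csum_def sum_distrib_left by (intro sum.cong) auto

lemma csum_sum: "csum n t q (\<lambda>A B. \<Sum>j\<in>S. V j A B) = (\<Sum>j\<in>S. csum n t q (V j))"
  unfolding csum_def by (subst sum.swap) (auto intro!: sum.cong)


text \<open>Equal colours minus both colours 0 means equal nonzero colours: each difference of an
  edge and its deletion is one indicator in \<open>jw\<close>. The letter 1 at the end forces
  \<open>x = r\<close>.\<close>

lemma jw_expand:
  assumes "length A = Suc r"
  shows "jw n r x A = chb n r * (act (-1) x (ind r) A - (if A ! r = 0 then act 0 x (ind r) (rem r A) else 0))
    - (\<Sum>j<r. (-1) ^ (r - 1 - j) * chb n j *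
       ((if A ! j = A ! Suc j then act 1 x (ind r) (rem j (rem j A)) else 0)
        - (if A ! j = 0 \<and> A ! Suc j = 0 then act 1 x (ind r) (rem j (rem j A)) else 0)))"
proof -
  have A: "A = butlast A @ [last A]" using assms by (cases A rule: rev_cases) auto
  then have last: "A ! r = last A" "rem r A = butlast A"
    using assms by (metis nth_append_length length_butlast diff_Suc_1,
      metis A append_Nil2 assms diff_Suc_1 length_butlast rem_length)
  have "last A = x \<and> butlast A = tgt r \<longleftrightarrow> A = tgt r @ [x]"
    using A by (metis butlast_snoc last_snoc)
  then have 1: "(if x \<noteq> 0 \<and> A = tgt r @ [x] then 1 else 0) =
     act (-1) x (ind r) A - (if A ! r = 0 then act 0 x (ind r) (rem r A) else 0)"
    unfolding last by (auto simp: act_def ind_def)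
  have "(if x = r \<and> A ! m = A ! Suc m \<and> A ! m \<noteq> 0 \<and> rem m (rem m A) = tgt (r - 1) then 1 else 0) =
      (if A ! m = A ! Suc m then act 1 x (ind r) (rem m (rem m A)) else 0)
        - (if A ! m = 0 \<and> A ! Suc m = 0 then act 1 x (ind r) (rem m (rem m A)) else 0)" if "m < r" for m
  proof -
    have "tgt r = tgt (r - 1) @ [r]" using that tgt_Suc[of "r - 1"] by simp
    then have "rem m (rem m A) @ [x] = tgt r \<longleftrightarrow> x = r \<and> rem m (rem m A) = tgt (r - 1)" by auto
    then show ?thesis by (auto simp: act_def ind_def)
  qed
  then show ?thesis unfolding jw_def 1 by (intro arg_cong2[where f = "(-)"] refl sum.cong) auto
qed

text \<open>The left side is \<open>u_r\<close> times the bracket of \<open>t @ [-1]\<close>,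
  unrolled as in \<open>bracket_eq\<close>, paired with \<open>q @ [b]\<close> at
  \<open>x = n\<close>.\<close>

lemma bracket_count:
  assumes "Suc r < n" "motzkin t" "motzkin (q @ [b])" "length q = length t"
    "length (whites t) = Suc r" "length (whites (q @ [b])) = r"
  shows "chb n r * (cnt n r (t @ [-1]) (q @ [b]) - cnt n r (t[whites t ! r - 1 := 0] @ [0]) (q @ [b]))
    - (\<Sum>j<r. (-1) ^ (r - 1 - j) * chb n j * (cnt n r (t[whites t ! Suc j - 1 := -1] @ [1]) (q @ [b])
       - cnt n r (t[whites t ! j - 1 := 0, whites t ! Suc j - 1 := 0] @ [1]) (q @ [b])))
    = (if b = -1 then chb n (Suc r) * cnt n (Suc r) t q else 0)"
proof -
  have up: "motzkin (s @ [1])" "motzkin (s @ [0])" if "motzkin s" for s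
    using that length_whites[OF that] by (auto simp: motzkin_snoc)
  have m1: "motzkin (t @ [-1])" using assms(2,5) length_whites[OF assms(2)] by (auto simp: motzkin_snoc)
  have k: "motzkin (t[whites t ! r - 1 := 0])" using kill_white[OF assms(2), of r] assms(5) by auto
  let ?\<beta> = "\<lambda>x. act b x (ind r)"
  have c1: "cnt n r (t @ [-1]) (q @ [b]) = csum n t q (\<lambda>A B. \<Sum>x<n. act (-1) x (ind r) A * ?\<beta> x B)"
    by (rule cnt_snoc[OF m1 assms(3,4)])
  have c2: "cnt n r (t[whites t ! r - 1 := 0] @ [0]) (q @ [b]) =
     csum n t q (\<lambda>A B. \<Sum>x<n. (if A ! r = 0 then act 0 x (ind r) (rem r A) else 0) * ?\<beta> x B)"
    by (subst cnt_snoc[OF up(2)[OF k] assms(3)]) 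
      (use assms(4,5) csum_kill[OF assms(2), of r] in \<open>auto intro!: csum_cong\<close>)
  have c3: "cnt n r (t[whites t ! Suc j - 1 := -1] @ [1]) (q @ [b]) =
     csum n t q (\<lambda>A B. \<Sum>x<n. (if A ! j = A ! Suc j then act 1 x (ind r) (rem j (rem j A)) else 0) * ?\<beta> x B)"
    if "j < r" for j
  proof -
    have j: "Suc j < length (whites t)" using that assms(5) by simp
    show ?thesis
      by (subst cnt_snoc[OF up(1)[OF conjunct1[OF join_whites[OF assms(2) j]]] assms(3)])
        (use assms(4,5) csum_join[OF assms(2) j] in \<open>auto intro!: csum_cong\<close>)
  qed
  have c4: "cnt n r (t[whites t ! j - 1 := 0, whites t ! Suc j - 1 := 0] @ [1]) (q @ [b]) =
     csum n t q (\<lambda>A B. \<Sum>x<n. (if A ! j = 0 \<and> A ! Suc j = 0 then act 1 x (ind r) (rem j (rem j A)) else 0) * ?\<beta> x B)"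
    if "j < r" for j
  proof -
    have j: "Suc j < length (whites t)" using that assms(5) by simp
    show ?thesis
      by (subst cnt_snoc[OF up(1)[OF kill_two_whites(1)[OF assms(2) j]] assms(3)])
        (use assms(4,5) kill_two_whites(3)[OF assms(2) j] in \<open>auto intro!: csum_cong\<close>)
  qed
  have "csum n t q (\<lambda>A B. \<Sum>x<n. jw n r x A * ?\<beta> x B) =
    csum n t q (\<lambda>A B. chb n r * ((\<Sum>x<n. act (-1) x (ind r) A * ?\<beta> x B) -
       (\<Sum>x<n. (if A ! r = 0 then act 0 x (ind r) (rem r A) else 0) * ?\<beta> x B))
     - (\<Sum>j<r. (-1) ^ (r - 1 - j) * chb n j *
        ((\<Sum>x<n. (if A ! j = A ! Suc j then act 1 x (ind r) (rem j (rem j A)) else 0) * ?\<beta> x B)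
        - (\<Sum>x<n. (if A ! j = 0 \<and> A ! Suc j = 0 then act 1 x (ind r) (rem j (rem j A)) else 0) * ?\<beta> x B))))"
  proof (rule csum_cong)
    fix A B :: "nat list" assume "length A = length (whites t)"
    then have "length A = Suc r" using assms(5) by simp
    let ?c = "\<lambda>j. (-1) ^ (r - 1 - j) * chb n j"
    let ?a = "\<lambda>x. act (-1) x (ind r) A" let ?b = "\<lambda>x. if A ! r = 0 then act 0 x (ind r) (rem r A) else 0"
    let ?d = "\<lambda>j x. if A ! j = A ! Suc j then act 1 x (ind r) (rem j (rem j A)) else 0"
    let ?e = "\<lambda>j x. if A ! j = 0 \<and> A ! Suc j = 0 then act 1 x (ind r) (rem j (rem j A)) else 0"
    have "(\<Sum>x<n. jw n r x A * ?\<beta> x B) = (\<Sum>x<n. (chb n r * (?a x - ?b x) - (\<Sum>j<r. ?c j * (?d j x - ?e j x))) * ?\<beta> x B)"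
      by (simp only: jw_expand[OF \<open>length A = Suc r\<close>])
    also have "\<dots> = chb n r * (\<Sum>x<n. (?a x - ?b x) * ?\<beta> x B) - (\<Sum>x<n. \<Sum>j<r. ?c j * ((?d j x - ?e j x) * ?\<beta> x B))"
      by (simp only: left_diff_distrib sum_subtractf sum_distrib_left sum_distrib_right mult.assoc right_diff_distrib)
    also have "(\<Sum>x<n. \<Sum>j<r. ?c j * ((?d j x - ?e j x) * ?\<beta> x B)) = (\<Sum>j<r. ?c j * (\<Sum>x<n. (?d j x - ?e j x) * ?\<beta> x B))"
      by (subst sum.swap) (simp only: sum_distrib_left)
    finally show "(\<Sum>x<n. jw n r x A * ?\<beta> x B) = chb n r * ((\<Sum>x<n. ?a x * ?\<beta> x B) - (\<Sum>x<n. ?b x * ?\<beta> x B))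
       - (\<Sum>j<r. ?c j * ((\<Sum>x<n. ?d j x * ?\<beta> x B) - (\<Sum>x<n. ?e j x * ?\<beta> x B)))"
      by (simp only: left_diff_distrib sum_subtractf)
  qed
  also have "\<dots> = chb n r * (cnt n r (t @ [-1]) (q @ [b]) - cnt n r (t[whites t ! r - 1 := 0] @ [0]) (q @ [b]))
    - (\<Sum>j<r. (-1) ^ (r - 1 - j) * chb n j * (cnt n r (t[whites t ! Suc j - 1 := -1] @ [1]) (q @ [b])
       - cnt n r (t[whites t ! j - 1 := 0, whites t ! Suc j - 1 := 0] @ [1]) (q @ [b])))"
    unfolding csum_diff csum_scale csum_sum c1 c2
    by (intro arg_cong2[where f = "(-)"] refl sum.cong) (simp only: c3 c4 lessThan_iff csum_sum)
  finally show ?thesis using csum_jw[OF assms] by simp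
qed

section \<open>Unions of two 1-factors\<close>

text \<open>The involutions send a vertex to its mate in one of two matchings, or to itself if it
  has none. So ends of paths are fixed points, and the component of \<open>w\<close> is its orbit
  under the dihedral group generated by \<open>\<sigma>\<close> and \<open>\<rho>\<close>.\<close>

locale two_involutions =
  fixes \<sigma> \<rho> :: "'a \<Rightarrow> 'a" and w :: 'a
  assumes inv: "\<sigma> (\<sigma> x) = x" "\<rho> (\<rho> x) = x" and fixed: "\<sigma> w = w"
    and finite_orbit: "finite {v. (\<lambda>x y. \<sigma> x = y \<or> \<rho> x = y)\<^sup>*\<^sup>* w v}"
begin

abbreviation orb :: "'a \<Rightarrow> bool" where "orb \<equiv> (\<lambda>x y. \<sigma> x = y \<or> \<rho> x = y)\<^sup>*\<^sup>* w"

definition \<tau> :: "'a \<Rightarrow> 'a" where "\<tau> x = \<sigma> (\<rho> x)"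

lemma inj_\<tau>: "inj (\<tau> ^^ m)"
proof (induction m)
  case (Suc m)
  have "inj \<tau>" by (rule inj_on_inverseI[of _ "\<lambda>x. \<rho> (\<sigma> x)"]) (simp add: \<tau>_def inv)
  from inj_compose[OF this Suc] show ?case by (simp only: funpow.simps)
qed simp

text \<open>This is the dihedral relation: conjugation by \<open>\<sigma>\<close> inverts
  \<open>\<tau>\<close>.\<close>

lemma \<tau>_reflect: "(\<tau> ^^ m) (\<sigma> ((\<tau> ^^ m) x)) = \<sigma> x"
proof (induction m arbitrary: x)
  case (Suc m)
  have "(\<tau> ^^ Suc m) (\<sigma> ((\<tau> ^^ Suc m) x)) = (\<tau> ^^ m) (\<tau> (\<sigma> (\<tau> ((\<tau> ^^ m) x))))"
    by (simp add: funpow_swap1)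
  also have "\<tau> (\<sigma> (\<tau> ((\<tau> ^^ m) x))) = \<sigma> ((\<tau> ^^ m) x)" by (simp add: \<tau>_def inv)
  finally show ?case using Suc by simp
qed simp

lemma rho_eq: "\<rho> ((\<tau> ^^ m) x) = \<sigma> ((\<tau> ^^ Suc m) x)"
  by (simp add: \<tau>_def inv)

lemma orb_\<tau>: "orb ((\<tau> ^^ m) w)"
proof (induction m)
  case (Suc m)
  then have "orb (\<rho> ((\<tau> ^^ m) w))" by (rule rtranclp.rtrancl_into_rtrancl) simp
  then have "orb (\<sigma> (\<rho> ((\<tau> ^^ m) w)))" by (rule rtranclp.rtrancl_into_rtrancl) simp
  then show ?case unfolding funpow.simps comp_apply by (subst \<tau>_def)
qed simp

lemma period: "\<exists>N>0. (\<tau> ^^ N) w = w"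
proof -
  have "finite (range (\<lambda>m. (\<tau> ^^ m) w))" by (rule finite_subset[OF _ finite_orbit]) (auto intro: orb_\<tau>)
  then have "\<not> inj (\<lambda>m. (\<tau> ^^ m) w)" using finite_imageD infinite_UNIV_nat by blast
  then obtain a b where "a < b" "(\<tau> ^^ a) w = (\<tau> ^^ b) w"
    unfolding inj_def by (metis linorder_neqE_nat)
  moreover have "(\<tau> ^^ b) w = (\<tau> ^^ a) ((\<tau> ^^ (b - a)) w)"
    using \<open>a < b\<close> funpow_add[of a "b - a" \<tau>] by simp
  ultimately have "w = (\<tau> ^^ (b - a)) w" using injD[OF inj_\<tau>[of a], of w "(\<tau> ^^ (b - a)) w"] by simp
  with \<open>a < b\<close> show ?thesis by (intro exI[of _ "b - a"]) simp
qed

lemma period_mult: "(\<tau> ^^ N) w = w \<Longrightarrow> (\<tau> ^^ (N * m)) w = w"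
  by (induction m) (simp_all add: funpow_add)

text \<open>As \<open>\<sigma>\<close> fixes \<open>w\<close>, reflecting \<open>\<tau>^m w\<close>
  gives \<open>\<tau>^(-m) w\<close>. For a period \<open>N\<close> this negative power equals the
  power \<open>(N - 1) * m\<close>.\<close>

lemma sigma_orbit: "\<exists>l. \<sigma> ((\<tau> ^^ m) w) = (\<tau> ^^ l) w"
proof -
  obtain N where N: "N > 0" "(\<tau> ^^ N) w = w" using period by blast
  have "(\<tau> ^^ m) (\<sigma> ((\<tau> ^^ m) w)) = (\<tau> ^^ (N * m)) w"
    using period_mult[OF N(2), of m] \<tau>_reflect[of m w] fixed by simp
  also have "N * m = m + (N - 1) * m" using N(1) by (cases N) auto
  finally have "(\<tau> ^^ m) (\<sigma> ((\<tau> ^^ m) w)) = (\<tau> ^^ m) ((\<tau> ^^ ((N - 1) * m)) w)" by (simp add: funpow_add)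
  then show ?thesis using injD[OF inj_\<tau>] by blast
qed

text \<open>Because \<open>w\<close> is fixed by one reflection, the powers of \<open>\<tau>\<close>
  alone already fill its dihedral orbit.\<close>

lemma orbD: "orb v \<Longrightarrow> \<exists>m. v = (\<tau> ^^ m) w"
proof (induction rule: rtranclp_induct)
  case base
  show ?case by (rule exI[of _ 0]) simp
next
  case (step y z)
  then obtain m where "y = (\<tau> ^^ m) w" by blast
  with step(2) show ?case using sigma_orbit[of m] sigma_orbit[of "Suc m"] rho_eq[of m w] by auto
qed

text \<open>A fixed point \<open>v = \<tau>\<^sup>m w\<close> of \<open>\<rho>\<close> gives \<open>w\<close> the odd period \<open>2m + 1\<close> under \<open>\<tau>\<close>, a fixed point
  \<open>u = \<tau>\<^sup>l w\<close> of \<open>\<sigma>\<close> the even period \<open>2l\<close>.\<close>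
lemma fixed_unique:
  assumes "orb v" "\<rho> v = v" "orb u" "\<sigma> u = u"
  shows "u = w"
proof -
  obtain m l where ml: "v = (\<tau> ^^ m) w" "u = (\<tau> ^^ l) w" using assms orbD by meson
  have "(\<tau> ^^ Suc m) v = w" using \<tau>_reflect[of "Suc m" w] rho_eq[of m w] assms ml fixed by simp
  then have "(\<tau> ^^ (Suc m + m)) w = w" unfolding funpow_add using ml by simp
  then have odd: "(\<tau> ^^ (2 * m + 1)) w = w" by (simp add: mult_2)
  have "(\<tau> ^^ l) u = w" using \<tau>_reflect[of l w] assms ml fixed by simp
  then have even: "(\<tau> ^^ (2 * l)) w = w" unfolding mult_2 funpow_add using ml by simp
  \<comment> \<open>Adding \<open>m\<close> copies of the even period \<open>2 * l\<close> to the
    exponent \<open>l\<close> gives a multiple of the odd period.\<close>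
  have "u = (\<tau> ^^ (l + 2 * l * m)) w" using period_mult[OF even, of m] ml by (simp add: funpow_add)
  also have "l + 2 * l * m = (2 * m + 1) * l" by (simp add: algebra_simps)
  also have "(\<tau> ^^ ((2 * m + 1) * l)) w = w" by (rule period_mult[OF odd])
  finally show ?thesis .
qed

text \<open>Halving the least period reaches the far end of the path. An even period
  \<open>2 * l\<close> gives the fixed point \<open>\<tau>^l w\<close> of \<open>\<sigma>\<close>,
  different from \<open>w\<close> by minimality; an odd period \<open>2 * m + 1\<close> gives the
  fixed point \<open>\<tau>^m w\<close> of \<open>\<rho>\<close>.\<close>

lemma other_end: "(\<exists>v. orb v \<and> \<rho> v = v) \<or> (\<exists>u. orb u \<and> \<sigma> u = u \<and> u \<noteq> w)"
proof -
  define N where "N = (LEAST N. N > 0 \<and> (\<tau> ^^ N) w = w)"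
  have N: "N > 0" "(\<tau> ^^ N) w = w" using LeastI_ex[OF period] unfolding N_def by auto
  have min: "\<not> (l > 0 \<and> (\<tau> ^^ l) w = w)" if "l < N" for l using not_less_Least[of l] that unfolding N_def by blast
  show ?thesis
  proof (cases "even N")
    case True
    then obtain l where "N = 2 * l" by (rule evenE)
    then have l: "N = l + l" by simp
    have "(\<tau> ^^ l) (\<sigma> ((\<tau> ^^ l) w)) = (\<tau> ^^ l) ((\<tau> ^^ l) w)"
      using \<tau>_reflect[of l w] N(2) fixed unfolding l by (simp add: funpow_add)
    then have "\<sigma> ((\<tau> ^^ l) w) = (\<tau> ^^ l) w" using injD[OF inj_\<tau>] by blast
    then show ?thesis using min[of l] l N(1) orb_\<tau>[of l] by auto
  next
    case False
    then obtain m where "N = 2 * m + 1" by (rule oddE)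
    then have m: "N = Suc m + m" by simp
    have "(\<tau> ^^ Suc m) (\<sigma> ((\<tau> ^^ Suc m) w)) = (\<tau> ^^ Suc m) ((\<tau> ^^ m) w)"
      using \<tau>_reflect[of "Suc m" w] N(2) fixed unfolding m funpow_add by simp
    then have "\<sigma> ((\<tau> ^^ Suc m) w) = (\<tau> ^^ m) w" using injD[OF inj_\<tau>] by blast
    then show ?thesis using rho_eq[of m w] orb_\<tau>[of m] by auto
  qed
qed

end

section \<open>Mates in a single path\<close>

definition partner :: "int list \<Rightarrow> nat \<Rightarrow> nat \<Rightarrow> bool" where
  "partner p i j \<longleftrightarrow> paired p i j \<or> paired p j i"

definition matched :: "int list \<Rightarrow> nat \<Rightarrow> bool" where
  "matched p i \<longleftrightarrow> (\<exists>j. partner p i j)"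

text \<open>Unmatched vertices are made fixed points, which turns a matching into an involution as
  \<open>two_involutions\<close> expects.\<close>

definition mate :: "int list \<Rightarrow> nat \<Rightarrow> nat" where
  "mate p i = (if matched p i then THE j. partner p i j else i)"

lemma paired_right:
  assumes "motzkin p" "paired p i j"
  shows "p ! (j - 1) = -1"
  using assms
proof (induction p rule: rev_induct)
  case (snoc a t)
  then have "motzkin t" by (simp add: motzkin_snoc)
  then show ?case using snoc paired_bounds[of t i j] by (auto simp: paired_snoc nth_append)
qed (simp add: paired_def)

lemma paired_inj:
  assumes "motzkin p" "paired p i j" "paired p i' j"
  shows "i = i'"
  using assms
proof (induction p rule: rev_induct)
  case (snoc a t)
  then have "motzkin t" by (simp add: motzkin_snoc)
  then show ?case using snoc paired_bounds[of t i j] paired_bounds[of t i' j] by (auto simp: paired_snoc)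
qed (simp add: paired_def)

lemma paired_fun: "paired p i j \<Longrightarrow> paired p i j' \<Longrightarrow> j = j'"
  by (rule linorder_cases[of j j']) (auto simp: paired_def)

lemma down_paired:
  assumes "motzkin p" "1 \<le> j" "j \<le> length p" "p ! (j - 1) = -1"
  shows "\<exists>i. paired p i j"
  using assms
proof (induction p rule: rev_induct)
  case (snoc a t)
  then have m: "motzkin t" by (simp add: motzkin_snoc)
  show ?case
  proof (cases "j = Suc (length t)")
    case True
    then show ?thesis using snoc.prems by (auto simp: paired_snoc)
  next
    case False
    then have "\<exists>i. paired t i j" using snoc m by (auto simp: nth_append split: if_splits)
    then show ?thesis using snoc.prems(1) by (auto simp: paired_snoc)
  qed
qed simp

lemma partner_sym: "partner p i j \<Longrightarrow> partner p j i" by (auto simp: partner_def)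

lemma partner_unique:
  assumes "motzkin p" "partner p i j" "partner p i j'" shows "j = j'"
proof -
  have "\<not> (paired p i a \<and> paired p b i)" for a b
    using paired_right[OF assms(1), of b i] by (auto simp: paired_def)
  then show ?thesis using assms paired_fun[of p i j j'] paired_inj[of p j i j'] unfolding partner_def by blast
qed

lemma partner_bounds: "partner p i j \<Longrightarrow> 1 \<le> i \<and> i \<le> length p \<and> 1 \<le> j \<and> j \<le> length p \<and> i \<noteq> j"
  by (auto simp: partner_def paired_def)

lemma unmatched_cases:
  assumes "motzkin p" "1 \<le> i" "i \<le> length p"
  shows "matched p i \<or> white p i \<or> p ! (i - 1) = 0"
proof -
  have "p ! (i - 1) \<in> set p" using assms by (intro nth_mem) simp
  then have "p ! (i - 1) \<in> {-1, 0, 1}" using assms(1) by (auto simp: motzkin_def)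
  then show ?thesis using down_paired[OF assms] assms by (auto simp: matched_def partner_def white_def)
qed

lemma white_unmatched: "motzkin p \<Longrightarrow> white p i \<Longrightarrow> \<not> matched p i"
proof -
  assume "motzkin p" "white p i"
  then have "p ! (i - 1) = 1" "\<not> paired p i j" for j by (auto simp: white_def)
  then show ?thesis using paired_right[OF \<open>motzkin p\<close>, of _ i] by (auto simp: matched_def partner_def)
qed

lemma black_unmatched: "motzkin p \<Longrightarrow> p ! (i - 1) = 0 \<Longrightarrow> \<not> matched p i"
proof -
  assume "motzkin p" "p ! (i - 1) = 0"
  then have "\<not> paired p i j" for j by (auto simp: paired_def)
  then show ?thesis using paired_right[OF \<open>motzkin p\<close>, of _ i] \<open>p ! (i - 1) = 0\<close>
    by (auto simp: matched_def partner_def)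
qed

lemma mate_eq: "motzkin p \<Longrightarrow> partner p i j \<Longrightarrow> mate p i = j"
  unfolding mate_def matched_def using partner_unique by (auto intro!: the_equality)

lemma mate_iff: "motzkin p \<Longrightarrow> mate p i = j \<longleftrightarrow> partner p i j \<or> (i = j \<and> \<not> matched p i)"
proof (cases "matched p i")
  case True
  assume m: "motzkin p"
  from True obtain l where "partner p i l" by (auto simp: matched_def)
  then show ?thesis using mate_eq[OF m] True by auto
qed (auto simp: mate_def matched_def)

lemma mate_mate: "motzkin p \<Longrightarrow> mate p (mate p i) = i"
proof (cases "matched p i")
  case True
  assume m: "motzkin p"
  from True obtain j where "partner p i j" by (auto simp: matched_def)
  then show ?thesis using mate_eq[OF m] partner_sym[of p i j] by simp
qed (simp add: mate_def)

lemma mate_fixed: "motzkin p \<Longrightarrow> mate p i = i \<longleftrightarrow> \<not> matched p i"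
proof (cases "matched p i")
  case True
  assume m: "motzkin p"
  from True obtain j where "partner p i j" by (auto simp: matched_def)
  then show ?thesis using mate_eq[OF m] partner_bounds[of p i j] True by auto
qed (simp add: mate_def)

section \<open>Components of the union of two paths\<close>

definition mrel :: "int list \<Rightarrow> int list \<Rightarrow> nat \<Rightarrow> nat \<Rightarrow> bool" where
  "mrel p q = (\<lambda>i j. partner p i j \<or> partner q i j)\<^sup>*\<^sup>*"

lemma mrel_refl [simp]: "mrel p q i i" by (simp add: mrel_def)

lemma mrel_sym: "mrel p q i j \<Longrightarrow> mrel p q j i"
  unfolding mrel_def by (rule sympD[OF sympI[THEN symp_rtranclp]]) (auto dest: partner_sym)

lemma mrel_trans: "mrel p q i j \<Longrightarrow> mrel p q j k \<Longrightarrow> mrel p q i k"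
  unfolding mrel_def by (rule rtranclp_trans)

lemma mrel_commute: "mrel p q = mrel q p"
  unfolding mrel_def by (intro arg_cong[where f = rtranclp]) auto

lemma mrel_mate:
  assumes "motzkin p" "motzkin q"
  shows "mrel p q = (\<lambda>x y. mate p x = y \<or> mate q x = y)\<^sup>*\<^sup>*"
proof -
  have "(\<lambda>i j. partner p i j \<or> partner q i j)\<^sup>*\<^sup>* = (\<lambda>i j. partner p i j \<or> partner q i j)\<^sup>=\<^sup>=\<^sup>*\<^sup>*" by simp
  also have "\<dots> = (\<lambda>x y. mate p x = y \<or> mate q x = y)\<^sup>=\<^sup>=\<^sup>*\<^sup>*"
    by (intro arg_cong[where f = rtranclp] ext) (auto simp: mate_iff assms)
  finally show ?thesis by (simp add: mrel_def)
qed

lemma mrel_bounds: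
  assumes "length p = k" "length q = k" "mrel p q i j" "1 \<le> i" "i \<le> k"
  shows "1 \<le> j \<and> j \<le> k"
  using assms(3,4,5) unfolding mrel_def
  by (induction rule: rtranclp_induct) (use assms(1,2) partner_bounds[of p] partner_bounds[of q] in auto)

lemma mrel_two_involutions:
  assumes "motzkin p" "motzkin q" "length p = length q" "\<not> matched p w" "1 \<le> w" "w \<le> length p"
  shows "two_involutions (mate p) (mate q) w"
proof
  show "finite {v. (\<lambda>x y. mate p x = y \<or> mate q x = y)\<^sup>*\<^sup>* w v}"
    unfolding mrel_mate[OF assms(1,2), symmetric]
  proof (rule finite_subset)
    show "{v. mrel p q w v} \<subseteq> {..length p}"
      using mrel_bounds[OF refl assms(3)[symmetric] _ assms(5,6)] by blast
  qed simp
qed (simp_all add: mate_mate mate_fixed assms(1,2,4))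

text \<open>A path component has two ends. If one is open in \<open>p\<close> and the other in
  \<open>q\<close>, there is none left for a further vertex open in \<open>p\<close>.\<close>

lemma mrel_end_unique:
  assumes "motzkin p" "motzkin q" "length p = length q" "\<not> matched p w" "1 \<le> w" "w \<le> length p"
    "mrel p q w v" "\<not> matched q v" "mrel p q w u" "\<not> matched p u"
  shows "u = w"
  using two_involutions.fixed_unique[OF mrel_two_involutions[OF assms(1-6)], of v u] assms
  by (simp add: mrel_mate mate_fixed)

lemma mrel_other_end:
  assumes "motzkin p" "motzkin q" "length p = length q" "\<not> matched p w" "1 \<le> w" "w \<le> length p"
  shows "(\<exists>v. mrel p q w v \<and> \<not> matched q v) \<or> (\<exists>u. mrel p q w u \<and> \<not> matched p u \<and> u \<noteq> w)"
  using two_involutions.other_end[OF mrel_two_involutions[OF assms]] assms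
  by (simp add: mrel_mate mate_fixed)

section \<open>Counting colourings\<close>

text \<open>These are the cycles of the union: the freely colourable components, and also the closed
  middle loops of the product.\<close>

definition closed_classes :: "int list \<Rightarrow> int list \<Rightarrow> nat set set" where
  "closed_classes p q = {{j. mrel p q i j} | i. \<forall>j. mrel p q i j \<longrightarrow> matched p j \<and> matched q j}"

text \<open>This condition ties the two sides together: it decides both whether colourings exist and
  whether the product diagram is \<open>diag q p\<close>.\<close>

definition linked :: "int list \<Rightarrow> int list \<Rightarrow> bool" where
  "linked p q \<longleftrightarrow> length (whites p) = length (whites q) \<and> (\<forall>s s'. s < length (whites p) \<longrightarrow> s' < length (whites p) \<longrightarrow>
     (mrel p q (whites p ! s) (whites q ! s') \<longleftrightarrow> s = s') \<and>
     (mrel p q (whites p ! s) (whites p ! s') \<longrightarrow> s = s') \<and>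
     (mrel p q (whites q ! s) (whites q ! s') \<longrightarrow> s = s'))"

definition colourings :: "nat \<Rightarrow> nat \<Rightarrow> int list \<Rightarrow> int list \<Rightarrow> nat list set" where
  "colourings n r p q = {c \<in> words n (length p). compat p c \<and> compat q c \<and> wcol p c = tgt r \<and> wcol q c = tgt r}"

lemma cnt_card: "cnt n r p q = of_nat (card (colourings n r p q))"
proof -
  have "cnt n r p q = (\<Sum>c\<in>words n (length p). if compat p c \<and> compat q c \<and> wcol p c = tgt r \<and> wcol q c = tgt r then 1 else 0)"
    unfolding cnt_def csum_def by (intro sum.cong) (auto simp: ind_def)
  also have "\<dots> = (\<Sum>c\<in>colourings n r p q. 1)"
    unfolding colourings_def by (rule sum.inter_filter[symmetric]) simp
  finally show ?thesis by simp
qed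

locale path_pair =
  fixes p q :: "int list" and k r :: nat
  assumes mp: "motzkin p" and mq: "motzkin q" and lp: "length p = k" and lq: "length q = k"
    and wp: "length (whites p) = r" and wq: "length (whites q) = r"
begin

lemma white_index: "white p i \<Longrightarrow> \<exists>s<r. i = whites p ! s" "white q i \<Longrightarrow> \<exists>s<r. i = whites q ! s"
  using set_whites[of p] set_whites[of q] wp wq by (metis in_set_conv_nth mem_Collect_eq)+

lemma white_nth: "s < r \<Longrightarrow> white p (whites p ! s)" "s < r \<Longrightarrow> white q (whites q ! s)"
  using set_whites[of p] set_whites[of q] wp wq by (metis nth_mem mem_Collect_eq)+

lemma white_range: "s < r \<Longrightarrow> 1 \<le> whites p ! s \<and> whites p ! s \<le> k"
  "s < r \<Longrightarrow> 1 \<le> whites q ! s \<and> whites q ! s \<le> k"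
  using whites_nth_le[of s p] whites_nth_le[of s q] wp wq lp lq by auto

lemma white_open: "s < r \<Longrightarrow> \<not> matched p (whites p ! s)" "s < r \<Longrightarrow> \<not> matched q (whites q ! s)"
  using white_nth white_unmatched mp mq by blast+

lemma colouring_mrel:
  assumes "c \<in> colourings n r p q" "mrel p q i j"
  shows "c ! (i - 1) = c ! (j - 1)"
  using assms(2) unfolding mrel_def
proof (induction rule: rtranclp_induct)
  case (step y z)
  have "c ! (y - 1) = c ! (z - 1)"
    using step(2) assms(1) by (auto simp: colourings_def compat_def partner_def)
  then show ?case using step by simp
qed simp

lemma colouring_white:
  assumes "c \<in> colourings n r p q" "s < r"
  shows "c ! (whites p ! s - 1) = Suc s" "c ! (whites q ! s - 1) = Suc s"
proof -
  have "wcol p c ! s = tgt r ! s" "wcol q c ! s = tgt r ! s" using assms by (auto simp: colourings_def)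
  then show "c ! (whites p ! s - 1) = Suc s" "c ! (whites q ! s - 1) = Suc s"
    using assms(2) wp wq by (auto simp: wcol_def)
qed

lemma colouring_open:
  assumes "c \<in> colourings n r p q" "1 \<le> i" "i \<le> k" "\<not> matched p i \<or> \<not> matched q i"
  shows "c ! (i - 1) = 0 \<or> (\<exists>s<r. c ! (i - 1) = Suc s \<and> (i = whites p ! s \<or> i = whites q ! s))"
proof -
  have "i - 1 < k" using assms by simp
  then have "p ! (i - 1) = 0 \<or> q ! (i - 1) = 0 \<Longrightarrow> ?thesis"
    using assms(1) lp lq by (auto simp: colourings_def compat_def)
  moreover have "white p i \<or> white q i \<Longrightarrow> ?thesis"
    using white_index[of i] colouring_white[OF assms(1)] by metis
  ultimately show ?thesis
    using unmatched_cases[OF mp, of i, unfolded lp] unmatched_cases[OF mq, of i, unfolded lq] assms(2-) by blast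
qed

text \<open>The nonzero colour \<open>Suc s\<close> spreads along the path that starts in the
  \<open>s\<close>-th white vertex of \<open>p\<close>. The other end is therefore not black, and as
  a white vertex it must have index \<open>s\<close>. Different colours keep the other white
  vertices apart.\<close>

lemma colouring_linked:
  assumes c: "c \<in> colourings n r p q"
  shows "linked p q"
proof -
  have "mrel p q (whites p ! s) (whites q ! s)" if s: "s < r" for s
  proof -
    note w = white_range(1)[OF s] white_open(1)[OF s]
    have "(\<exists>v. mrel p q (whites p ! s) v \<and> \<not> matched q v) \<or>
        (\<exists>u. mrel p q (whites p ! s) u \<and> \<not> matched p u \<and> u \<noteq> whites p ! s)"
      using mrel_other_end[OF mp mq _ w(2)] w(1) lp lq by simp
    \<comment> \<open>The last condition covers a one-vertex path, whose other end is the starting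
      vertex itself and is then open in \<open>q\<close>.\<close>
    then obtain v where v: "mrel p q (whites p ! s) v" "\<not> matched p v \<or> \<not> matched q v"
       "v \<noteq> whites p ! s \<or> \<not> matched q v" by blast
    have vb: "1 \<le> v \<and> v \<le> k" using mrel_bounds[OF lp lq v(1)] w(1) by blast
    have cv: "c ! (v - 1) = Suc s" using colouring_mrel[OF c v(1)] colouring_white[OF c s] by simp
    then have vw: "v = whites p ! s \<or> v = whites q ! s"
      using colouring_open[OF c _ _ v(2)] vb by auto
    show ?thesis
    proof (cases "v = whites q ! s")
      case False
      then have e: "v = whites p ! s" "\<not> matched q v" using vw v(3) by auto
      then have "white q v"
        using unmatched_cases[OF mq, of v] vb lq cv c by (auto simp: colourings_def compat_def)
      then obtain s' where "s' < r" "v = whites q ! s'" using white_index(2) by blast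
      then show ?thesis using cv colouring_white(2)[OF c, of s'] False by auto
    qed (use v in simp)
  qed
  then show ?thesis unfolding linked_def wp wq
    using colouring_mrel[OF c] colouring_white[OF c] by (metis nat.inject)
qed

lemma linked_open_p:
  assumes "linked p q" "s < r" "mrel p q (whites p ! s) i" "\<not> matched p i"
  shows "i = whites p ! s"
proof (rule mrel_end_unique[OF mp mq])
  show "mrel p q (whites p ! s) (whites q ! s)" using assms wp by (simp add: linked_def)
qed (use assms white_open white_range lp lq in auto)

lemma linked_open_q:
  assumes "linked p q" "s < r" "mrel p q (whites p ! s) i" "\<not> matched q i"
  shows "i = whites q ! s"
proof (rule mrel_end_unique[OF mq mp])
  have *: "mrel p q (whites p ! s) (whites q ! s)" using assms wp by (simp add: linked_def)
  then show "mrel q p (whites q ! s) (whites p ! s)" unfolding mrel_commute[of q p] by (rule mrel_sym)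
  show "mrel q p (whites q ! s) i" unfolding mrel_commute[of q p] using * assms(3) mrel_sym mrel_trans by blast
qed (use assms white_open white_range lp lq in auto)

lemma closed_class_iff:
  "{j. mrel p q i j} \<in> closed_classes p q \<longleftrightarrow> (\<forall>j. mrel p q i j \<longrightarrow> matched p j \<and> matched q j)"
  unfolding closed_classes_def by (auto dest: mrel_sym intro: mrel_trans)

lemma class_eq: "mrel p q i j \<Longrightarrow> {l. mrel p q i l} = {l. mrel p q j l}"
  using mrel_sym mrel_trans by blast

lemma closed_classes_sub: "C \<in> closed_classes p q \<Longrightarrow> C \<subseteq> {1..k} \<and> C \<noteq> {}"
proof -
  assume "C \<in> closed_classes p q"
  then obtain i where C: "C = {j. mrel p q i j}" "\<And>j. mrel p q i j \<Longrightarrow> matched p j"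
    unfolding closed_classes_def by blast
  have "j \<in> {1..k}" if "j \<in> C" for j
    using C that partner_bounds[of p j] lp by (auto simp: matched_def)
  moreover have "i \<in> C" using C by simp
  ultimately show ?thesis by blast
qed

lemma finite_closed_classes: "finite (closed_classes p q)"
  by (rule finite_subset[of _ "Pow {1..k}"]) (use closed_classes_sub in auto)

text \<open>The colouring forced by a choice \<phi> of colours on the cycles: paths through white
  vertices carry their index, all other paths carry 0.\<close>

definition fill :: "(nat set \<Rightarrow> nat) \<Rightarrow> nat \<Rightarrow> nat" where
  "fill \<phi> i = (let C = {j. mrel p q i j} in if C \<in> closed_classes p q then \<phi> C
     else if \<exists>s<r. mrel p q (whites p ! s) i then Suc (THE s. s < r \<and> mrel p q (whites p ! s) i) else 0)"

lemma fill_mrel: "mrel p q i j \<Longrightarrow> fill \<phi> i = fill \<phi> j"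
proof -
  assume *: "mrel p q i j"
  have e: "mrel p q x i = mrel p q x j" for x using * mrel_sym mrel_trans by blast
  show ?thesis unfolding fill_def class_eq[OF *] e ..
qed

lemma fill_white:
  assumes "linked p q" "s < r" "mrel p q (whites p ! s) i"
  shows "fill \<phi> i = Suc s"
proof -
  have "{j. mrel p q i j} \<notin> closed_classes p q"
    using white_open(1)[OF assms(2)] mrel_sym[OF assms(3)] unfolding closed_class_iff by blast
  moreover have "(THE s'. s' < r \<and> mrel p q (whites p ! s') i) = s"
  proof (rule the_equality)
    fix s' assume "s' < r \<and> mrel p q (whites p ! s') i"
    then have "mrel p q (whites p ! s') (whites p ! s)" "s' < r" using assms(3) mrel_sym mrel_trans by blast+
    then show "s' = s" using assms wp unfolding linked_def by blast
  qed (use assms in simp)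
  ultimately show ?thesis using assms unfolding fill_def Let_def by auto
qed

lemma fill_black:
  assumes "linked p q" "\<not> matched p i \<and> \<not> white p i \<or> \<not> matched q i \<and> \<not> white q i"
  shows "fill \<phi> i = 0"
proof -
  have "{j. mrel p q i j} \<notin> closed_classes p q"
    unfolding closed_class_iff using assms(2) mrel_refl[of p q i] by blast
  moreover have "\<not> mrel p q (whites p ! s) i" if "s < r" for s
    using linked_open_p[OF assms(1) that, of i] linked_open_q[OF assms(1) that, of i] assms(2) white_nth that by auto
  ultimately show ?thesis unfolding fill_def Let_def by auto
qed

text \<open>A colouring is determined by its colours on the cycles, read at chosen representatives,
  and these are arbitrary. The bound \<open>r < n\<close> makes all prescribed colours
  available.\<close>

lemma card_colourings:
  assumes "linked p q" "r < n"
  shows "card (colourings n r p q) = n ^ card (closed_classes p q)"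
proof -
  let ?F = "closed_classes p q \<rightarrow>\<^sub>E {..<n}"
  let ?restr = "\<lambda>c. restrict (\<lambda>C. c ! ((SOME i. i \<in> C) - 1)) (closed_classes p q)"
  define ext where "ext \<phi> = map (fill \<phi>) [1..<Suc k]" for \<phi>
  have length_ext: "length (ext \<phi>) = k" for \<phi> by (simp add: ext_def)
  have nth: "ext \<phi> ! (i - 1) = fill \<phi> i" if "1 \<le> i" "i \<le> k" for \<phi> i
    using that by (simp add: ext_def del: upt_Suc)
  have some: "mrel p q i (SOME j. j \<in> {j. mrel p q i j})" for i
    using someI[of "\<lambda>j. mrel p q i j" i] by simp
  have ext_col: "ext \<phi> \<in> colourings n r p q" if "\<phi> \<in> ?F" for \<phi>
  proof -
    have "fill \<phi> i < n" if "1 \<le> i" "i \<le> k" for i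
    proof (cases "\<exists>s<r. mrel p q (whites p ! s) i")
      case True
      then show ?thesis using fill_white[OF assms(1)] assms(2) by fastforce
    next
      case False
      then show ?thesis using \<open>\<phi> \<in> ?F\<close> assms(2) unfolding fill_def Let_def by (auto simp: PiE_iff)
    qed
    then have "ext \<phi> \<in> words n k" by (auto simp: words_def ext_def less_Suc_eq_le simp del: upt_Suc)
    moreover have "compat p (ext \<phi>)" unfolding compat_def
    proof (intro conjI allI impI)
      fix i j assume "paired p i j"
      moreover from this have "mrel p q i j" unfolding mrel_def by (auto simp: partner_def)
      ultimately show "ext \<phi> ! (i - 1) = ext \<phi> ! (j - 1)"
        using paired_bounds[of p i j] lp nth[of i \<phi>] nth[of j \<phi>] fill_mrel[of i j \<phi>] by simp
    next
      fix i assume i: "i < length p" "p ! i = 0"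
      then have "fill \<phi> (Suc i) = 0"
        using black_unmatched[OF mp, of "Suc i"] by (intro fill_black[OF assms(1)]) (auto simp: white_def)
      then show "ext \<phi> ! i = 0" using nth[of "Suc i" \<phi>] i lp by simp
    qed
    moreover have "compat q (ext \<phi>)" unfolding compat_def
    proof (intro conjI allI impI)
      fix i j assume "paired q i j"
      moreover from this have "mrel p q i j" unfolding mrel_def by (auto simp: partner_def)
      ultimately show "ext \<phi> ! (i - 1) = ext \<phi> ! (j - 1)"
        using paired_bounds[of q i j] lq nth[of i \<phi>] nth[of j \<phi>] fill_mrel[of i j \<phi>] by simp
    next
      fix i assume i: "i < length q" "q ! i = 0"
      then have "fill \<phi> (Suc i) = 0"
        using black_unmatched[OF mq, of "Suc i"] by (intro fill_black[OF assms(1)]) (auto simp: white_def)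
      then show "ext \<phi> ! i = 0" using nth[of "Suc i" \<phi>] i lq by simp
    qed
    moreover have "wcol p (ext \<phi>) = tgt r"
    proof (rule nth_equalityI)
      fix s assume "s < length (wcol p (ext \<phi>))"
      then have "s < r" using wp by simp
      then show "wcol p (ext \<phi>) ! s = tgt r ! s"
        using nth[of "whites p ! s" \<phi>] white_range(1) fill_white[OF assms(1), of s "whites p ! s"] wp
        by (simp add: wcol_def)
    qed (simp add: wp)
    moreover have "wcol q (ext \<phi>) = tgt r"
    proof (rule nth_equalityI)
      fix s assume "s < length (wcol q (ext \<phi>))"
      then have "s < r" using wq by simp
      moreover from this have "mrel p q (whites p ! s) (whites q ! s)" using assms(1) wp by (simp add: linked_def)
      ultimately show "wcol q (ext \<phi>) ! s = tgt r ! s"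
        using nth[of "whites q ! s" \<phi>] white_range(2) fill_white[OF assms(1), of s "whites q ! s"] wq
        by (simp add: wcol_def)
    qed (simp add: wq)
    ultimately show ?thesis using lp by (simp add: colourings_def)
  qed
  have "bij_betw ?restr (colourings n r p q) ?F"
  proof (rule bij_betw_byWitness[where f' = ext])
    show "\<forall>c\<in>colourings n r p q. ext (?restr c) = c"
    proof
      fix c assume c: "c \<in> colourings n r p q"
      show "ext (?restr c) = c"
      proof (rule nth_equalityI)
        show "length (ext (?restr c)) = length c" using c lp by (simp add: colourings_def words_def length_ext)
      next
        fix i0 assume "i0 < length (ext (?restr c))"
        then obtain i where i: "1 \<le> i" "i \<le> k" "i0 = i - 1"
          using that[of "Suc i0"] by (simp add: length_ext)
        have "fill (?restr c) i = c ! (i - 1)"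
        proof (cases "{j. mrel p q i j} \<in> closed_classes p q")
          case True
          then show ?thesis using colouring_mrel[OF c some[of i]] by (simp add: fill_def)
        next
          case False
          then obtain j where j: "mrel p q i j" "\<not> matched p j \<or> \<not> matched q j"
            unfolding closed_class_iff by blast
          have cj: "c ! (i - 1) = c ! (j - 1)" by (rule colouring_mrel[OF c j(1)])
          show ?thesis
          proof (cases "\<exists>s<r. mrel p q (whites p ! s) i")
            case True
            then obtain s where s: "s < r" "mrel p q (whites p ! s) i" by blast
            then show ?thesis
              using fill_white[OF assms(1) s] colouring_mrel[OF c s(2)] colouring_white(1)[OF c s(1)] by simp
          next
            \<comment> \<open>The component is a path without white ends, so its open vertex
              \<open>j\<close> is black and carries 0, which is the default of
              \<open>fill\<close>.\<close>
            case no: False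
            have jb: "1 \<le> j \<and> j \<le> k" using mrel_bounds[OF lp lq j(1)] i by blast
            have "\<not> (j = whites p ! s \<or> j = whites q ! s)" if "s < r" for s
            proof
              assume "j = whites p ! s \<or> j = whites q ! s"
              moreover have "mrel p q (whites p ! s) (whites q ! s)" using assms(1) that wp by (simp add: linked_def)
              ultimately have "mrel p q (whites p ! s) j" by auto
              then have "mrel p q (whites p ! s) i" using mrel_sym[OF j(1)] mrel_trans by blast
              then show False using no that by blast
            qed
            then have "c ! (j - 1) = 0" using colouring_open[OF c _ _ j(2)] jb by blast
            then show ?thesis using cj no False by (auto simp: fill_def)
          qed
        qed
        then show "ext (?restr c) ! i0 = c ! i0" using nth[OF i(1,2)] i(3) by simp
      qed
    qed
    show "\<forall>\<phi>\<in>?F. ?restr (ext \<phi>) = \<phi>"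
    proof
      fix \<phi> assume F: "\<phi> \<in> ?F"
      show "?restr (ext \<phi>) = \<phi>"
      proof
        fix C
        show "?restr (ext \<phi>) C = \<phi> C"
        proof (cases "C \<in> closed_classes p q")
          case True
          then obtain i where i: "C = {j. mrel p q i j}" by (auto simp: closed_classes_def)
          let ?j = "SOME j. j \<in> C"
          have j: "mrel p q i ?j" using some[of i] i by simp
          then have "?j \<in> C" using i by simp
          then have "1 \<le> ?j" "?j \<le> k" using closed_classes_sub[OF True] by auto
          then have "ext \<phi> ! (?j - 1) = fill \<phi> ?j" by (rule nth)
          also have "\<dots> = fill \<phi> i" using fill_mrel[OF j] by simp
          also have "\<dots> = \<phi> C" using True i by (simp add: fill_def)
          finally show ?thesis using True by simp
        next
          case False
          then show ?thesis using F by (auto simp: PiE_iff extensional_def)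
        qed
      qed
    qed
    show "?restr ` colourings n r p q \<subseteq> ?F"
    proof
      fix f assume "f \<in> ?restr ` colourings n r p q"
      then obtain c where c: "c \<in> colourings n r p q" "f = ?restr c" by blast
      have "c ! ((SOME i. i \<in> C) - 1) < n" if C: "C \<in> closed_classes p q" for C
      proof -
        have "(SOME i. i \<in> C) \<in> C" using closed_classes_sub[OF C] by (simp add: some_in_eq)
        then have "1 \<le> (SOME i. i \<in> C)" "(SOME i. i \<in> C) \<le> k" using closed_classes_sub[OF C] by auto
        then have "(SOME i. i \<in> C) - 1 < k" by simp
        then show ?thesis using c(1) wordsD(2)[of c n k] lp by (simp add: colourings_def)
      qed
      then show "f \<in> ?F" using c(2) by auto
    qed
    show "ext ` ?F \<subseteq> colourings n r p q" using ext_col by blast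
  qed
  then have "card (colourings n r p q) = card ?F" by (rule bij_betw_same_card)
  also have "\<dots> = n ^ card (closed_classes p q)"
    using finite_closed_classes by (simp add: card_funcsetE)
  finally show ?thesis .
qed

lemma cnt_eq: "r < n \<Longrightarrow> cnt n r p q = (if linked p q then of_nat n ^ card (closed_classes p q) else 0)"
proof (cases "linked p q")
  case True
  then show "r < n \<Longrightarrow> ?thesis" using card_colourings[OF True] by (simp add: cnt_card)
next
  case False
  then have "colourings n r p q = {}" using colouring_linked by blast
  then show ?thesis using False by (simp add: cnt_card)
qed

end

section \<open>Composition of diagrams\<close>

lemma image_set2: "f ` {g i j | i j. P i j} = {f (g i j) | i j. P i j}" by blast

lemma image_set1: "f ` {g i | i. P i} = {f (g i) | i. P i}" by blast


context path_pair
begin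

abbreviation "pp \<equiv> diag p p"
abbreviation "qq \<equiv> diag q q"

lemma up_edges: "(\<lambda>e. up1 ` e) ` pp = {{(1, i), (1, j)} | i j. paired p i j} \<union> {{(0, i), (0, j)} | i j. paired p i j}
   \<union> {{(0, i), (1, i)} | i. white p i}" (is "?L = ?R")
proof -
  have "?L = {{(1, i), (1, j)} | i j. paired p i j} \<union> {{(0, i), (0, j)} | i j. paired p i j}
    \<union> {{(0, whites p ! s), (1, whites p ! s)} | s. s < r}"
    unfolding diag_def wp image_Un image_set2 image_set1 by (simp add: up1_def)
  also have "{{(0::nat, whites p ! s), (1, whites p ! s)} | s. s < r} = {{(0, i), (1, i)} | i. white p i}"
    using white_index(1) white_nth(1) by blast
  finally show ?thesis .
qed

lemma dn_edges: "(\<lambda>e. dn2 ` e) ` qq = {{(2, i), (2, j)} | i j. paired q i j} \<union> {{(1, i), (1, j)} | i j. paired q i j}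
   \<union> {{(1, i), (2, i)} | i. white q i}" (is "?L = ?R")
proof -
  have "?L = {{(2, i), (2, j)} | i j. paired q i j} \<union> {{(1, i), (1, j)} | i j. paired q i j}
    \<union> {{(1, whites q ! s), (2, whites q ! s)} | s. s < r}"
    unfolding diag_def wq image_Un image_set2 image_set1 by (simp add: dn2_def)
  also have "{{(1::nat, whites q ! s), (2, whites q ! s)} | s. s < r} = {{(1, i), (2, i)} | i. white q i}"
    using white_index(2) white_nth(2) by blast
  finally show ?thesis .
qed

lemma cadj_iff: "cadj pp qq u v \<longleftrightarrow>
   (\<exists>i j. partner p i j \<and> (u = (1, i) \<and> v = (1, j) \<or> u = (0, i) \<and> v = (0, j))) \<or>
   (\<exists>i j. partner q i j \<and> (u = (1, i) \<and> v = (1, j) \<or> u = (2, i) \<and> v = (2, j))) \<or>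
   (\<exists>i. white p i \<and> (u = (0, i) \<and> v = (1, i) \<or> u = (1, i) \<and> v = (0, i))) \<or>
   (\<exists>i. white q i \<and> (u = (1, i) \<and> v = (2, i) \<or> u = (2, i) \<and> v = (1, i)))"
proof -
  have "paired p i j \<Longrightarrow> i \<noteq> j" "paired q i j \<Longrightarrow> i \<noteq> j" for i j by (auto simp: paired_def)
  note irrefl = this
  have d: "{u, v} \<in> {{(c, i), (c', j)} | i j. P i j} \<longleftrightarrow>
      (\<exists>i j. P i j \<and> (u = (c, i) \<and> v = (c', j) \<or> u = (c', j) \<and> v = (c, i)))" for c c' P
    by (auto simp: doubleton_eq_iff)
  have d1: "{u, v} \<in> {{(c, i), (c', i)} | i. P i} \<longleftrightarrow>
      (\<exists>i. P i \<and> (u = (c, i) \<and> v = (c', i) \<or> u = (c', i) \<and> v = (c, i)))" for c c' P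
    by (auto simp: doubleton_eq_iff)
  show ?thesis (is "_ \<longleftrightarrow> ?R")
  proof
    assume "cadj pp qq u v"
    then show ?R unfolding cadj_def up_edges dn_edges Un_iff d d1 partner_def
      by (elim conjE disjE exE) auto
  next
    assume ?R
    then show "cadj pp qq u v" unfolding cadj_def up_edges dn_edges Un_iff d d1 partner_def
      by (elim conjE disjE exE) (auto dest: irrefl)
  qed
qed

lemma cconn_sym: "cconn pp qq u v \<Longrightarrow> cconn pp qq v u"
  unfolding cconn_def
  by (rule sympD[OF sympI[THEN symp_rtranclp]]) (auto simp: cadj_def insert_commute)

lemma cconn_trans: "cconn pp qq u v \<Longrightarrow> cconn pp qq v w \<Longrightarrow> cconn pp qq u w"
  unfolding cconn_def by (rule rtranclp_trans)

lemma cadj_cconn: "cadj pp qq u v \<Longrightarrow> cconn pp qq u v"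
  unfolding cconn_def by blast

lemma mrel_cconn: "mrel p q i j \<Longrightarrow> cconn pp qq (1, i) (1, j)"
  unfolding mrel_def
proof (induction rule: rtranclp_induct)
  case (step y z)
  then have "cadj pp qq (1, y) (1, z)" by (auto simp: cadj_iff)
  then show ?case using step cadj_cconn cconn_trans by blast
qed (simp add: cconn_def)

lemma white_cconn: "white p i \<Longrightarrow> cconn pp qq (1, i) (0, i)" "white q i \<Longrightarrow> cconn pp qq (1, i) (2, i)"
  by (rule cadj_cconn, simp add: cadj_iff)+

lemma white_no_partner: "white p i \<Longrightarrow> \<not> partner p i j" "white q i \<Longrightarrow> \<not> partner q i j"
  using white_unmatched[OF mp] white_unmatched[OF mq] unfolding matched_def by blast+

lemma mrel_step: "mrel p q i y \<Longrightarrow> partner p y z \<or> partner q y z \<Longrightarrow> mrel p q i z"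
  unfolding mrel_def by (rule rtranclp.rtrancl_into_rtrancl)

text \<open>Since \<open>diag p p\<close> joins each white vertex straight to its copy, and white
  vertices have no other edge in the outer rows, the stacked graph around the middle row is the
  union of \<open>p\<close> and \<open>q\<close> with pendant vertices attached at the white
  ones.\<close>

lemma cconn_mid:
  assumes "cconn pp qq (1, i) v"
  shows "\<exists>j. mrel p q i j \<and> (v = (1, j) \<or> v = (0, j) \<and> white p j \<or> v = (2, j) \<and> white q j)"
  using assms unfolding cconn_def
proof (induction rule: rtranclp_induct)
  case base
  show ?case by (rule exI[of _ i]) simp
next
  case (step y z)
  then obtain j where j: "mrel p q i j" "y = (1, j) \<or> y = (0, j) \<and> white p j \<or> y = (2, j) \<and> white q j" by blast
  then show ?case using step(2) white_no_partner[of j] mrel_step[OF j(1)] unfolding cadj_iff by auto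
qed

lemma cconn_top:
  assumes "cconn pp qq (0, i) v" "\<not> white p i"
  shows "v = (0, i) \<or> (\<exists>j. v = (0, j) \<and> partner p i j)"
  using assms(1) unfolding cconn_def
proof (induction rule: rtranclp_induct)
  case (step y z)
  from step(3) obtain j where j: "y = (0, j)" "j = i \<or> partner p i j" by blast
  then have "\<not> white p j" using assms(2) white_no_partner(1)[of j i] partner_sym[of p i j] by blast
  then obtain l where l: "z = (0, l)" "partner p j l" using step(2) j(1) unfolding cadj_iff by auto
  from j(2) show ?case
  proof
    assume "partner p i j"
    then have "l = i" using partner_unique[OF mp l(2)] partner_sym by blast
    then show ?thesis using l by simp
  qed (use l in blast)
qed simp

lemma cconn_bot:
  assumes "cconn pp qq (2, i) v" "\<not> white q i"
  shows "v = (2, i) \<or> (\<exists>j. v = (2, j) \<and> partner q i j)"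
  using assms(1) unfolding cconn_def
proof (induction rule: rtranclp_induct)
  case (step y z)
  from step(3) obtain j where j: "y = (2, j)" "j = i \<or> partner q i j" by blast
  then have "\<not> white q j" using assms(2) white_no_partner(2)[of j i] partner_sym[of q i j] by blast
  then obtain l where l: "z = (2, l)" "partner q j l" using step(2) j(1) unfolding cadj_iff by auto
  from j(2) show ?case
  proof
    assume "partner q i j"
    then have "l = i" using partner_unique[OF mq l(2)] partner_sym by blast
    then show ?thesis using l by simp
  qed (use l in blast)
qed simp

text \<open>In \<open>compose\<close> the outer vertices range over all levels other than 1. Levels
  above 2 are isolated and so contribute no edge.\<close>

lemma cconn_far: "cconn pp qq (l, i) v \<Longrightarrow> l > 2 \<Longrightarrow> v = (l, i)"
  unfolding cconn_def by (induction rule: rtranclp_induct) (auto simp: cadj_iff)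

text \<open>Edges of the outer rows stay as they are; all other edges connect white vertices through
  a component of the middle row.\<close>

lemma compose_eq: "Defs.compose pp qq =
   {{Top i, Top j} | i j. paired p i j \<or> i \<noteq> j \<and> white p i \<and> white p j \<and> mrel p q i j} \<union>
   {{Bot i, Bot j} | i j. paired q i j \<or> i \<noteq> j \<and> white q i \<and> white q j \<and> mrel p q i j} \<union>
   {{Top i, Bot j} | i j. white p i \<and> white q j \<and> mrel p q i j}" (is "_ = ?T \<union> ?B \<union> ?V")
proof (intro equalityI subsetI)
  have T: "{Top i, Top j} \<in> ?T" if "partner p i j" for i j
    using that unfolding partner_def by (auto simp: doubleton_eq_iff)
  have B: "{Bot i, Bot j} \<in> ?B" if "partner q i j" for i j
    using that unfolding partner_def by (auto simp: doubleton_eq_iff)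
  have V: "{Bot j, Top i} \<in> ?V" if "white p i" "white q j" "mrel p q i j" for i j
    using that by (auto simp: doubleton_eq_iff)
  fix e assume "e \<in> Defs.compose pp qq"
  then obtain lu iu lv iv where e: "e = {outv (lu, iu), outv (lv, iv)}" "lu \<noteq> 1" "lv \<noteq> 1" "(lu, iu) \<noteq> (lv, iv)"
    "cconn pp qq (lu, iu) (lv, iv)" unfolding Defs.compose_def by auto
  consider "lu = 0" "white p iu" | "lu = 0" "\<not> white p iu" | "lu = 2" "white q iu" | "lu = 2" "\<not> white q iu" | "lu > 2"
    using e(2) by linarith
  then show "e \<in> ?T \<union> ?B \<union> ?V"
  proof cases
    case 1
    then have "cconn pp qq (1, iu) (lv, iv)" using white_cconn(1) e(5) cconn_trans by blast
    from cconn_mid[OF this] show ?thesis using e(1-4) 1 by (auto simp: outv_def)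
  next
    case 2
    then have "lv = 0" "partner p iu iv" using cconn_top[of iu "(lv, iv)"] e(4,5) by auto
    then show ?thesis using T[of iu iv] 2 e(1) by (simp add: outv_def)
  next
    case 3
    then have "cconn pp qq (1, iu) (lv, iv)" using white_cconn(2) e(5) cconn_trans by blast
    from cconn_mid[OF this] show ?thesis using e(1-4) 3 V[of iv iu] mrel_sym[of p q iu iv] by (auto simp: outv_def)
  next
    case 4
    then have "lv = 2" "partner q iu iv" using cconn_bot[of iu "(lv, iv)"] e(4,5) by auto
    then show ?thesis using B[of iu iv] 4 e(1) by (simp add: outv_def)
  next
    case 5
    then show ?thesis using cconn_far e(4,5) by blast
  qed
next
  fix e assume "e \<in> ?T \<union> ?B \<union> ?V"
  moreover have "{outv u, outv v} \<in> Defs.compose pp qq" if "fst u \<noteq> 1" "fst v \<noteq> 1" "u \<noteq> v" "cconn pp qq u v" for u v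
    using that unfolding Defs.compose_def by blast
  from this[of "(0, i)" "(0, j)" for i j] this[of "(2, i)" "(2, j)" for i j] this[of "(0, i)" "(2, j)" for i j]
  have C: "i \<noteq> j \<Longrightarrow> cconn pp qq (0, i) (0, j) \<Longrightarrow> {Top i, Top j} \<in> Defs.compose pp qq"
    "i \<noteq> j \<Longrightarrow> cconn pp qq (2, i) (2, j) \<Longrightarrow> {Bot i, Bot j} \<in> Defs.compose pp qq"
    "cconn pp qq (0, i) (2, j) \<Longrightarrow> {Top i, Bot j} \<in> Defs.compose pp qq" for i j
    by (auto simp: outv_def)
  have "paired p i j \<Longrightarrow> i \<noteq> j \<and> cconn pp qq (0, i) (0, j)" for i j
    using cadj_cconn[of "(0, i)" "(0, j)"] by (auto simp: cadj_iff partner_def paired_def)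
  moreover have "paired q i j \<Longrightarrow> i \<noteq> j \<and> cconn pp qq (2, i) (2, j)" for i j
    using cadj_cconn[of "(2, i)" "(2, j)"] by (auto simp: cadj_iff partner_def paired_def)
  moreover have "white p i \<Longrightarrow> white p j \<Longrightarrow> mrel p q i j \<Longrightarrow> cconn pp qq (0, i) (0, j)"
    "white q i \<Longrightarrow> white q j \<Longrightarrow> mrel p q i j \<Longrightarrow> cconn pp qq (2, i) (2, j)"
    "white p i \<Longrightarrow> white q j \<Longrightarrow> mrel p q i j \<Longrightarrow> cconn pp qq (0, i) (2, j)" for i j
    using mrel_cconn[of i j] white_cconn[of i] white_cconn[of j] cconn_sym cconn_trans by blast+
  ultimately show "e \<in> Defs.compose pp qq" using C by blast
qed

lemma whites_inj: "s < r \<Longrightarrow> s' < r \<Longrightarrow> whites p ! s = whites p ! s' \<longleftrightarrow> s = s'"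
  "s < r \<Longrightarrow> s' < r \<Longrightarrow> whites q ! s = whites q ! s' \<longleftrightarrow> s = s'"
  using wp wq by (auto simp: nth_eq_iff_index_eq)

lemma diag_qp: "diag q p = {{Bot i, Bot j} | i j. paired q i j} \<union> {{Top i, Top j} | i j. paired p i j}
     \<union> {{Top (whites p ! s), Bot (whites q ! s)} | s. s < r}"
  unfolding diag_def wp by simp

text \<open>White vertices have no mates, so an extra horizontal edge between them or a wrongly
  matched vertical edge is visible in the product.\<close>

lemma compose_diag: "Defs.compose pp qq = diag q p \<longleftrightarrow> linked p q"
proof
  assume eq: "Defs.compose pp qq = diag q p"
  show "linked p q" unfolding linked_def wp wq
  proof (intro conjI allI impI refl)
    fix s s' assume s: "s < r" "s' < r"
    have "mrel p q (whites p ! s) (whites q ! s') \<longleftrightarrow> {Top (whites p ! s), Bot (whites q ! s')} \<in> Defs.compose pp qq"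
      unfolding compose_eq using white_nth s by (auto simp: doubleton_eq_iff)
    also have "\<dots> \<longleftrightarrow> s = s'" unfolding eq diag_qp using s whites_inj
      by (auto simp: doubleton_eq_iff)
    finally show "mrel p q (whites p ! s) (whites q ! s') \<longleftrightarrow> s = s'" .
    show "s = s'" if m: "mrel p q (whites p ! s) (whites p ! s')"
    proof (rule ccontr)
      assume "s \<noteq> s'"
      then have "{Top (whites p ! s), Top (whites p ! s')} \<in> Defs.compose pp qq"
        unfolding compose_eq using white_nth s m whites_inj(1)[OF s] by blast
      then have "partner p (whites p ! s) (whites p ! s')" unfolding eq diag_qp partner_def by (auto simp: doubleton_eq_iff)
      then show False using white_no_partner white_nth s by blast
    qed
    show "s = s'" if m: "mrel p q (whites q ! s) (whites q ! s')"
    proof (rule ccontr)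
      assume "s \<noteq> s'"
      then have "{Bot (whites q ! s), Bot (whites q ! s')} \<in> Defs.compose pp qq"
        unfolding compose_eq using white_nth s m whites_inj(2)[OF s] by blast
      then have "partner q (whites q ! s) (whites q ! s')" unfolding eq diag_qp partner_def by (auto simp: doubleton_eq_iff)
      then show False using white_no_partner white_nth s by blast
    qed
  qed
next
  assume l: "linked p q"
  have "\<not> (i \<noteq> j \<and> white p i \<and> white p j \<and> mrel p q i j)" "\<not> (i \<noteq> j \<and> white q i \<and> white q j \<and> mrel p q i j)" for i j
    using l white_index wp unfolding linked_def by blast+
  then have e: "(paired p i j \<or> i \<noteq> j \<and> white p i \<and> white p j \<and> mrel p q i j) = paired p i j"
    "(paired q i j \<or> i \<noteq> j \<and> white q i \<and> white q j \<and> mrel p q i j) = paired q i j" for i j by blast+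
  have V: "{{Top i, Bot j} | i j. white p i \<and> white q j \<and> mrel p q i j} =
      {{Top (whites p ! s), Bot (whites q ! s)} | s. s < r}"
    using l white_index white_nth wp unfolding linked_def by blast
  show "Defs.compose pp qq = diag q p" unfolding compose_eq diag_qp e V by blast
qed

lemma drank_qp: "drank (diag q p) = r"
proof -
  have "{e \<in> diag q p. \<exists>i j. e = {Top i, Bot j}} = (\<lambda>s. {Top (whites p ! s), Bot (whites q ! s)}) ` {..<r}"
    unfolding diag_qp by (auto simp: doubleton_eq_iff)
  moreover have "inj_on (\<lambda>s. {Top (whites p ! s), Bot (whites q ! s)}) {..<r}"
    by (rule inj_onI) (use whites_inj in \<open>auto simp: doubleton_eq_iff\<close>)
  ultimately show ?thesis unfolding drank_def by (simp add: card_image)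
qed

lemma edge_at: "(\<exists>e\<in>pp. Bot i \<in> e) \<longleftrightarrow> matched p i \<or> white p i" "(\<exists>e\<in>qq. Top i \<in> e) \<longleftrightarrow> matched q i \<or> white q i"
proof -
  have w: "(\<exists>s<r. i = whites p ! s) \<longleftrightarrow> white p i" "(\<exists>s<r. i = whites q ! s) \<longleftrightarrow> white q i"
    using white_index[of i] white_nth by blast+
  have b: "(\<exists>e\<in>{g i j | i j. P i j}. Q e) \<longleftrightarrow> (\<exists>i j. P i j \<and> Q (g i j))"
    for g :: "nat \<Rightarrow> nat \<Rightarrow> vtx set" and P Q by blast
  have b1: "(\<exists>e\<in>{g i | i. P i}. Q e) \<longleftrightarrow> (\<exists>i. P i \<and> Q (g i))"
    for g :: "nat \<Rightarrow> vtx set" and P Q by blast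
  show "(\<exists>e\<in>pp. Bot i \<in> e) \<longleftrightarrow> matched p i \<or> white p i" "(\<exists>e\<in>qq. Top i \<in> e) \<longleftrightarrow> matched q i \<or> white q i"
    unfolding diag_def matched_def partner_def wp wq bex_Un b b1 w[symmetric] by auto
qed

text \<open>A white vertex lets its component escape to an outer row, and a black isolated vertex
  lacks an edge on one side. What stays in the middle with edges on both sides at every vertex is a
  cycle.\<close>

lemma loops_eq: "loops pp qq = card (closed_classes p q)"
proof -
  let ?P = "\<lambda>v. \<forall>w. cconn pp qq v w \<longrightarrow> fst w = 1 \<and> (\<exists>e\<in>pp. Bot (snd w) \<in> e) \<and> (\<exists>e\<in>qq. Top (snd w) \<in> e)"
  have P: "?P (1, i) \<longleftrightarrow> (\<forall>j. mrel p q i j \<longrightarrow> matched p j \<and> matched q j)" for i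
  proof
    assume *: "?P (1, i)"
    show "\<forall>j. mrel p q i j \<longrightarrow> matched p j \<and> matched q j"
    proof (intro allI impI)
      fix j assume j: "mrel p q i j"
      have "\<not> white p j" "\<not> white q j"
        using * mrel_cconn[OF j] white_cconn[of j] cconn_trans by (metis fst_conv zero_neq_one, metis fst_conv numeral_eq_one_iff semiring_norm(85))
      then show "matched p j \<and> matched q j" using * mrel_cconn[OF j] unfolding edge_at by fastforce
    qed
  next
    assume *: "\<forall>j. mrel p q i j \<longrightarrow> matched p j \<and> matched q j"
    show "?P (1, i)" unfolding edge_at
    proof (intro allI impI)
      fix w assume "cconn pp qq (1, i) w"
      from cconn_mid[OF this] obtain j where j: "mrel p q i j" "w = (1, j) \<or> w = (0, j) \<and> white p j \<or> w = (2, j) \<and> white q j"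
        by blast
      then show "fst w = 1 \<and> (matched p (snd w) \<or> white p (snd w)) \<and> (matched q (snd w) \<or> white q (snd w))"
        using * white_unmatched[OF mp, of j] white_unmatched[OF mq, of j] by auto
    qed
  qed
  have C: "{w. cconn pp qq (1, i) w} = Pair 1 ` {j. mrel p q i j}"
    if "\<forall>j. mrel p q i j \<longrightarrow> matched p j \<and> matched q j" for i
    using that cconn_mid[of i] mrel_cconn[of i] white_unmatched[OF mp] white_unmatched[OF mq] by blast
  have gen: "{G v | v. fst v = 1 \<and> Q v} = {G (1, i) | i. Q (1, i)}"
    for G :: "nat \<times> nat \<Rightarrow> (nat \<times> nat) set" and Q
    by (auto simp: split_paired_Ex)
  have "{{w. cconn pp qq v w} | v. fst v = 1 \<and> ?P v} = {{w. cconn pp qq (1, i) w} | i. ?P (1, i)}"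
    by (rule gen)
  also have "\<dots> = {{w. cconn pp qq (1, i) w} | i. \<forall>j. mrel p q i j \<longrightarrow> matched p j \<and> matched q j}"
    unfolding P ..
  also have "\<dots> = (`) (Pair 1) ` closed_classes p q"
    unfolding closed_classes_def using C by blast
  finally have "loops pp qq = card ((`) (Pair (1::nat)) ` closed_classes p q)" unfolding loops_def by simp
  also have "\<dots> = card (closed_classes p q)"
    by (intro card_image inj_onI) (simp add: inj_image_eq_iff inj_def)
  finally show ?thesis .
qed

text \<open>A product equal to \<open>diag q p\<close> has rank exactly \<open>r\<close>; for any
  other product both branches of \<open>form\<close> give 0.\<close>

lemma form_eq: "form (int r) p q = (if linked p q then X ^ card (closed_classes p q) else 0)"
  unfolding form_def Let_def compose_diag loops_eq using drank_qp compose_diag by auto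

end

text \<open>The bridge between diagrams and colourings: form and count are the same monomial in the
  number of cycles, or both are 0.\<close>

lemma form_poly:
  assumes "motzkin p" "motzkin q" "length p = length q" "length (whites p) = r" "length (whites q) = r"
  shows "\<exists>g. form (int r) p q = Fract g 1 \<and> (\<forall>n>r. cnt n r p q = poly g (of_nat n))"
proof -
  interpret path_pair p q "length p" r by standard (use assms in auto)
  let ?m = "card (closed_classes p q)"
  have "X ^ m = Fract ([:0, 1:] ^ m) 1" for m
    by (induction m) (simp_all add: X_def One_fract_def)
  then show ?thesis
    by (intro exI[of _ "if linked p q then [:0, 1:] ^ ?m else 0"]) (simp add: form_eq cnt_eq Zero_fract_def)
qed

section \<open>From large integers to the indeterminate\<close>

abbreviation emb :: "rat poly \<Rightarrow> K" where "emb g \<equiv> Fract g 1"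

lemma emb_simps: "emb a + emb b = emb (a + b)" "emb a - emb b = emb (a - b)" "emb a * emb b = emb (a * b)"
  "0 = emb 0" "1 = emb 1" "- emb a = emb (- a)"
  by (simp_all add: Zero_fract_def One_fract_def)

lemma emb_sum: "(\<Sum>i\<in>S. emb (g i)) = emb (\<Sum>i\<in>S. g i)"
  by (induction S rule: infinite_finite_induct) (simp_all add: emb_simps)

lemma emb_power: "emb a ^ m = emb (a ^ m)"
  by (induction m) (simp_all add: One_fract_def)

lemma emb_inj: "emb a = emb b \<longleftrightarrow> a = b"
  by (simp add: eq_fract)

abbreviation chp :: "nat \<Rightarrow> rat poly" where "chp m \<equiv> cheb_u m [:-1, 1:]"

lemma cheb_emb: "cheb_u m (X - 1) = emb (chp m)"
proof (induction m "X - 1" rule: cheb_u.induct)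
  case (2)
  show ?case by (simp add: X_def One_fract_def one_pCons)
next
  case (3 m)
  then show ?case by (simp add: X_def One_fract_def one_pCons)
qed (simp add: One_fract_def)

lemma poly_chp: "poly (chp m) (of_nat n) = chb n m"
  by (induction m "[:-1, 1 :: rat:]" rule: cheb_u.induct) (simp_all add: algebra_simps)

text \<open>At \<open>y = 2\<close>, that is \<open>x = 3\<close>, the recursion is that of an
  arithmetic progression. The positive values show that no denominator vanishes.\<close>

lemma cheb_u_2: "cheb_u m (2 :: rat) = of_nat m + 1"
  by (induction m "2 :: rat" rule: cheb_u.induct) (simp_all add: algebra_simps)

lemma chp_nz: "chp m \<noteq> 0"
proof
  assume "chp m = 0"
  then have "chb 3 m = 0" using poly_chp[of m 3] by simp
  then show False using cheb_u_2[of m] by simp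
qed

lemma cheb_nz: "cheb_u m (X - 1) \<noteq> 0"
  unfolding cheb_emb using chp_nz[of m] emb_inj[of "chp m" 0] by (simp add: Zero_fract_def)

lemma poly_eqI_large_nat:
  fixes g h :: "rat poly"
  assumes "\<And>n. n > R \<Longrightarrow> poly g (of_nat n) = poly h (of_nat n)"
  shows "g = h"
proof (rule ccontr)
  assume "g \<noteq> h"
  then have "finite {x. poly (g - h) x = 0}" by (intro poly_roots_finite) simp
  moreover have "of_nat ` {R<..} \<subseteq> {x. poly (g - h) x = 0}" using assms by auto
  ultimately have "finite ((of_nat :: nat \<Rightarrow> rat) ` {R<..})" by (rule finite_subset[rotated])
  then have "finite {R<..}" by (rule finite_imageD) (simp add: inj_on_def)
  then show False by (simp add: infinite_Ioi)
qed

lemma pathsD: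
  assumes "p \<in> paths k (int r)"
  shows "motzkin p" "length p = k" "length (whites p) = r"
  using assms length_whites[of p] by (auto simp: paths_def)

lemma pathsI: "motzkin p \<Longrightarrow> length p = k \<Longrightarrow> length (whites p) = r \<Longrightarrow> p \<in> paths k (int r)"
  using length_whites[of p] by (auto simp: paths_def)

text \<open>A chosen polynomial for each pair of paths lets linear combinations of form values be
  tested as one polynomial at large integers.\<close>

definition fpoly :: "nat \<Rightarrow> int list \<Rightarrow> int list \<Rightarrow> rat poly" where
  "fpoly r p q = (SOME g. form (int r) p q = emb g \<and> (\<forall>n>r. cnt n r p q = poly g (of_nat n)))"

lemma fpoly:
  assumes "p \<in> paths k (int r)" "q \<in> paths k (int r)"
  shows "form (int r) p q = emb (fpoly r p q)" "n > r \<Longrightarrow> cnt n r p q = poly (fpoly r p q) (of_nat n)"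
proof -
  have "form (int r) p q = emb (fpoly r p q) \<and> (\<forall>n>r. cnt n r p q = poly (fpoly r p q) (of_nat n))"
    unfolding fpoly_def by (rule someI_ex, rule form_poly) (use pathsD[OF assms(1)] pathsD[OF assms(2)] in auto)
  then show "form (int r) p q = emb (fpoly r p q)" "n > r \<Longrightarrow> cnt n r p q = poly (fpoly r p q) (of_nat n)" by auto
qed

lemma form_eqI:
  assumes "p \<in> paths k (int r)" "q \<in> paths k (int r)" "p' \<in> paths k' (int r')" "q' \<in> paths k' (int r')"
    "\<And>n. n > r \<Longrightarrow> n > r' \<Longrightarrow> cnt n r p q = cnt n r' p' q'"
  shows "form (int r) p q = form (int r') p' q'"
  unfolding fpoly(1)[OF assms(1,2)] fpoly(1)[OF assms(3,4)] emb_inj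
  by (rule poly_eqI_large_nat[of "max r r'"])
    (use fpoly(2)[OF assms(1,2)] fpoly(2)[OF assms(3,4)] assms(5) in auto)

text \<open>The symmetry is immediate for the counts.\<close>

lemma form_sym:
  assumes "p \<in> paths k (int r)" "q \<in> paths k (int r)"
  shows "form (int r) p q = form (int r) q p"
proof (rule form_eqI[OF assms assms(2,1)])
  show "cnt n r p q = cnt n r q p" for n
    unfolding cnt_def csum_def using pathsD(2)[OF assms(1)] pathsD(2)[OF assms(2)]
    by (intro sum.cong) (auto simp: mult.commute)
qed

section \<open>Pairings of paths that end in 1 or 0\<close>

lemma snoc_paths:
  "t @ [a] \<in> paths (Suc k) r \<longleftrightarrow> t \<in> paths k (r - a) \<and> a \<in> {-1,0,1} \<and> r \<ge> 0"
  by (auto simp: paths_def motzkin_snoc)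

text \<open>The common last vertex is the last white vertex of both paths, so its colour must be
  \<open>r\<close> and one term of the sum over colours survives.\<close>

lemma form_up:
  assumes "t @ [1] \<in> paths (Suc k) (int r)" "s @ [1] \<in> paths (Suc k) (int r)"
  shows "form (int r) (t @ [1]) (s @ [1]) = form (int r - 1) t s"
proof -
  have ts: "t \<in> paths k (int r - 1)" "s \<in> paths k (int r - 1)" using assms by (auto simp: snoc_paths)
  then have "int r - 1 \<ge> 0" by (force simp: paths_def motzkin_def)
  then obtain r' where r: "r = Suc r'" by (cases r) auto
  have ts': "t \<in> paths k (int r')" "s \<in> paths k (int r')" using ts r by auto
  have "form (int r) (t @ [1]) (s @ [1]) = form (int r') t s"
  proof (rule form_eqI[OF assms ts'])
    fix n assume n: "n > r"
    have "act 1 x (ind r) A = (if x = r then ind r' A else 0)" for x A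
      by (auto simp: act_def ind_def r tgt_Suc)
    then have "(\<Sum>x<n. act 1 x (ind r) A * act 1 x (ind r) B) = (\<Sum>x<n. if x = r then ind r' A * ind r' B else 0)" for A B
      by (intro sum.cong) auto
    then show "cnt n r (t @ [1]) (s @ [1]) = cnt n r' t s"
      using cnt_snoc[OF pathsD(1)[OF assms(1)] pathsD(1)[OF assms(2)], of n r] pathsD(2)[OF ts'(1)] pathsD(2)[OF ts'(2)] n
      by (simp add: cnt_def)
  qed
  then show ?thesis using r by simp
qed

text \<open>The common last vertex is black and isolated in both paths, so only colour 0
  contributes.\<close>

lemma form_flat:
  assumes "t @ [0] \<in> paths (Suc k) (int r)" "s @ [0] \<in> paths (Suc k) (int r)"
  shows "form (int r) (t @ [0]) (s @ [0]) = form (int r) t s"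
proof -
  have ts: "t \<in> paths k (int r)" "s \<in> paths k (int r)" using assms by (auto simp: snoc_paths)
  show ?thesis
  proof (rule form_eqI[OF assms ts])
    fix n assume n: "n > r"
    have "(\<Sum>x<n. act 0 x (ind r) A * act 0 x (ind r) B) = (\<Sum>x<n. if x = 0 then ind r A * ind r B else 0)" for A B
      by (intro sum.cong) (auto simp: act_def)
    then show "cnt n r (t @ [0]) (s @ [0]) = cnt n r t s"
      using cnt_snoc[OF pathsD(1)[OF assms(1)] pathsD(1)[OF assms(2)], of n r] pathsD(2)[OF ts(1)] pathsD(2)[OF ts(2)] n
      by (simp add: cnt_def)
  qed
qed

text \<open>The last vertex would need a positive colour as a white vertex of one path and colour 0
  as a black vertex of the other.\<close>

lemma form_up_flat:
  assumes "t @ [1] \<in> paths (Suc k) (int r)" "s @ [0] \<in> paths (Suc k) (int r)"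
  shows "form (int r) (t @ [1]) (s @ [0]) = 0"
proof -
  have l: "length s = length t" using pathsD(2)[OF assms(1)] pathsD(2)[OF assms(2)] by simp
  have "A @ [0] \<noteq> tgt r" for A
    using set_tgt[of r] by (metis atLeastAtMost_iff in_set_conv_decomp not_one_le_zero)
  then have z: "act 1 x (ind r) A * act 0 x (ind r) B = 0" for x A B
    by (auto simp: act_def ind_def)
  then have "cnt n r (t @ [1]) (s @ [0]) = 0" for n
    unfolding cnt_snoc[OF pathsD(1)[OF assms(1)] pathsD(1)[OF assms(2)] l] z by (simp add: csum_def)
  then have "fpoly r (t @ [1]) (s @ [0]) = 0"
    by (intro poly_eqI_large_nat[of r]) (use fpoly(2)[OF assms] in simp)
  then show ?thesis using fpoly(1)[OF assms] by (simp add: Zero_fract_def)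
qed

section \<open>Unrolling the recursion of the bracket\<close>

text \<open>For \<open>p = t @ [-1]\<close>, the path \<open>p^(1)\<close> is
  \<open>joined t (r - 1)\<close>, and each further shift lowers the index by one. Deleting the
  pivot of \<open>joined t j\<close> gives \<open>cleared t j\<close>; deleting the pivot of
  \<open>p\<close> itself gives \<open>lowered t r\<close>.\<close>

definition joined :: "int list \<Rightarrow> nat \<Rightarrow> int list" where
  "joined t j = t[whites t ! Suc j - 1 := -1] @ [1]"

definition cleared :: "int list \<Rightarrow> nat \<Rightarrow> int list" where
  "cleared t j = t[whites t ! j - 1 := 0, whites t ! Suc j - 1 := 0] @ [1]"

definition lowered :: "int list \<Rightarrow> nat \<Rightarrow> int list" where
  "lowered t r = t[whites t ! r - 1 := 0] @ [0]"

context
  fixes t :: "int list" and k r :: nat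
  assumes t: "t \<in> paths k (int (Suc r))"
begin

lemma t_facts: "motzkin t" "length t = k" "length (whites t) = Suc r"
  using pathsD[OF t] by auto

lemma down_mem: "t @ [-1] \<in> paths (Suc k) (int r)"
  using t by (simp add: snoc_paths add.commute)

lemma lowered_mem: "lowered t r \<in> paths (Suc k) (int r)"
proof -
  have "motzkin (t[whites t ! r - 1 := 0])" "whites (t[whites t ! r - 1 := 0]) = rem r (whites t)"
    using kill_white[OF t_facts(1), of r] t_facts(3) by auto
  then have "t[whites t ! r - 1 := 0] \<in> paths k (int r)"
    by (intro pathsI) (use t_facts in \<open>auto simp: length_rem\<close>)
  then show ?thesis unfolding lowered_def by (simp add: snoc_paths)
qed

lemma joined_mem: assumes "j < r" shows "joined t j \<in> paths (Suc k) (int r)"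
proof -
  have "motzkin (t[whites t ! Suc j - 1 := -1])" "whites (t[whites t ! Suc j - 1 := -1]) = rem j (rem j (whites t))"
    using join_whites[OF t_facts(1), of j] t_facts(3) assms by auto
  then have "t[whites t ! Suc j - 1 := -1] \<in> paths k (int (r - 1))"
    by (intro pathsI) (use t_facts assms in \<open>auto simp: length_rem\<close>)
  then show ?thesis unfolding joined_def using assms by (simp add: snoc_paths of_nat_diff)
qed

lemma cleared_mem: assumes "j < r" shows "cleared t j \<in> paths (Suc k) (int r)"
proof -
  have "Suc j < length (whites t)" using assms t_facts by simp
  note * = kill_two_whites(1,2)[OF t_facts(1) this]
  then have "t[whites t ! j - 1 := 0, whites t ! Suc j - 1 := 0] \<in> paths k (int (r - 1))"
    by (intro pathsI) (use t_facts assms in \<open>auto simp: length_rem\<close>)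
  then show ?thesis unfolding cleared_def using assms by (simp add: snoc_paths of_nat_diff)
qed

lemma w_less: "i < j \<Longrightarrow> j \<le> r \<Longrightarrow> whites t ! i < whites t ! j"
  using sorted_wrt_nth_less[of "(<)" "whites t" i j] strict_sorted_iff[of "whites t"] t_facts(3) by simp

lemma w_range: "j \<le> r \<Longrightarrow> 1 \<le> whites t ! j \<and> whites t ! j \<le> k"
  using whites_nth_le[of j t] t_facts by simp

lemma w_letter: "j \<le> r \<Longrightarrow> t ! (whites t ! j - 1) = 1"
  using nth_mem[of j "whites t"] t_facts(3) by (simp add: white_def)

lemma w_restore: "j \<le> r \<Longrightarrow> t[whites t ! j - 1 := 1] = t"
  using w_letter[of j] by (metis list_update_id)

lemma filter_whites:
  assumes "j \<le> r"
  shows "filter (\<lambda>w. w < whites t ! j) (take j (whites t) @ xs) = take j (whites t) @ filter (\<lambda>w. w < whites t ! j) xs"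
    "filter (\<lambda>w. w < whites t ! j) (drop j (whites t)) = []"
proof -
  have "w < whites t ! j" if "w \<in> set (take j (whites t))" for w
    using that w_less[of _ j] assms t_facts(3) by (auto simp: in_set_conv_nth)
  then show "filter (\<lambda>w. w < whites t ! j) (take j (whites t) @ xs) = take j (whites t) @ filter (\<lambda>w. w < whites t ! j) xs"
    by simp
  have "\<not> w < whites t ! j" if "w \<in> set (drop j (whites t))" for w
  proof -
    from that obtain i where "i < length (whites t) - j" "w = whites t ! (j + i)"
      by (auto simp: in_set_conv_nth)
    moreover from this have "j + i \<le> r" using t_facts(3) by linarith
    ultimately show ?thesis using w_less[of j "j + i"] by (cases "i = 0") auto
  qed
  then show "filter (\<lambda>w. w < whites t ! j) (drop j (whites t)) = []" by (simp add: filter_empty_conv)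
qed

text \<open>Joining two consecutive white vertices leaves those further left untouched, so the next
  shift reaches the preceding white vertex of \<open>t\<close>.\<close>

lemma whites_left_joined:
  assumes "Suc j < r"
  shows "last (whites_left (joined t (Suc j)) (whites t ! Suc j)) = whites t ! j"
proof -
  have j: "Suc (Suc j) < length (whites t)" using assms t_facts by simp
  let ?s = "t[whites t ! Suc (Suc j) - 1 := -1]"
  have s: "motzkin ?s" "whites ?s = rem (Suc j) (rem (Suc j) (whites t))"
    using join_whites[OF t_facts(1) j] by auto
  have "rem (Suc j) (rem (Suc j) (whites t)) = take (Suc j) (whites t) @ drop (Suc (Suc (Suc j))) (whites t)"
    using j by (simp add: rem_def)
  then have "whites (joined t (Suc j)) = take (Suc j) (whites t) @ drop (Suc (Suc (Suc j))) (whites t) @ [Suc k]"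
    unfolding joined_def using whites_snoc(1)[OF s(1)] s(2) t_facts(2) by simp
  moreover have "filter (\<lambda>w. w < whites t ! Suc j) (drop (Suc (Suc (Suc j))) (whites t)) = []"
    using filter_whites(2)[of "Suc j"] assms set_drop_subset_set_drop[of "Suc j" "Suc (Suc (Suc j))" "whites t"]
    by (auto simp: filter_empty_conv)
  ultimately have "whites_left (joined t (Suc j)) (whites t ! Suc j) = take (Suc j) (whites t)"
    unfolding whites_left_def using filter_whites(1)[of "Suc j"] w_range[of "Suc j"] assms by simp
  then show ?thesis using j by (simp add: take_Suc_conv_app_nth)
qed

text \<open>Left of the pivot of \<open>joined t j\<close> there are \<open>j\<close> white
  vertices, so the recursion multiplies the ratios \<open>u_i / u_(i+1)\<close>, which telescope to
  \<open>u_i / u_j\<close>; each shift contributes one sign.\<close>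

lemma brk_joined:
  assumes "j < r"
  shows "brk j (joined t j) (whites t ! j) (whites t ! Suc j) q =
    (\<Sum>i\<le>j. (-1) ^ (j - i) * (cheb_u i (X - 1) / cheb_u j (X - 1)) * (delta (joined t i) q - delta (cleared t i) q))"
  using assms
proof (induction j)
  case 0
  have r: "1 \<le> r" using 0 by simp
  have "pbullet (joined t 0) (whites t ! 0) (whites t ! Suc 0) = cleared t 0"
    using w_range[of 0] w_range[of 1] w_less[of 0 1] r t_facts(2)
    by (auto simp: pbullet_def joined_def cleared_def list_update_append list_update_swap)
  then show ?case by simp
next
  case (Suc j)
  let ?w = "\<lambda>i. whites t ! i"
  have ord: "?w (Suc j) < ?w (Suc (Suc j))" "1 \<le> ?w (Suc j)" "?w (Suc (Suc j)) \<le> k"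
    using w_range[of "Suc j"] w_range[of "Suc (Suc j)"] w_less[of "Suc j" "Suc (Suc j)"] Suc.prems by auto
  have b: "pbullet (joined t (Suc j)) (?w (Suc j)) (?w (Suc (Suc j))) = cleared t (Suc j)"
    using ord t_facts(2)
    by (auto simp: pbullet_def joined_def cleared_def list_update_append list_update_swap)
  have o: "pone (joined t (Suc j)) (?w (Suc j)) (?w (Suc (Suc j))) = joined t j"
  proof -
    \<comment> \<open>Colouring the right end of the old pivot white restores the letter 1 that
      \<open>t\<close> has there.\<close>
    have "t[?w (Suc (Suc j)) - 1 := -1, ?w (Suc j) - 1 := -1, ?w (Suc (Suc j)) - 1 := 1] = t[?w (Suc j) - 1 := -1]"
      using ord w_restore[of "Suc (Suc j)"] Suc.prems by (subst list_update_swap) (auto simp: list_update_swap)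
    then show ?thesis using ord t_facts(2) by (auto simp: pone_def joined_def list_update_append)
  qed
  define d where "d i = delta (joined t i) q - delta (cleared t i) q" for i
  define u where "u i = cheb_u i (X - 1)" for i
  have u: "u i \<noteq> 0" for i unfolding u_def by (rule cheb_nz)
  have "brk (Suc j) (joined t (Suc j)) (?w (Suc j)) (?w (Suc (Suc j))) q =
      d (Suc j) - (u j / u (Suc j)) * brk j (joined t j) (?w j) (?w (Suc j)) q"
    using whites_left_joined[of j] Suc.prems by (simp only: brk.simps b o u_def d_def)
  also have "brk j (joined t j) (?w j) (?w (Suc j)) q = (\<Sum>i\<le>j. (-1) ^ (j - i) * (u i / u j) * d i)"
    using Suc unfolding u_def d_def by simp
  also have "(u j / u (Suc j)) * \<dots> = (\<Sum>i\<le>j. (-1) ^ (j - i) * (u i / u (Suc j)) * d i)"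
    unfolding sum_distrib_left using u by (intro sum.cong) auto
  also have "d (Suc j) - (\<Sum>i\<le>j. (-1) ^ (j - i) * (u i / u (Suc j)) * d i) =
      (\<Sum>i\<le>Suc j. (-1) ^ (Suc j - i) * (u i / u (Suc j)) * d i)"
    using u by (simp add: Suc_diff_le sum_negf)
  finally show ?case unfolding u_def d_def .
qed

lemma pivot: "pivot_left (t @ [-1]) = whites t ! r"
proof -
  have m: "motzkin (t @ [-1])" using pathsD[OF down_mem] by simp
  have "whites t \<noteq> []" using t_facts(3) by auto
  then have l: "last (whites t) = whites t ! r" using t_facts(3) by (simp add: last_conv_nth)
  have "paired (t @ [-1]) i (length (t @ [-1])) \<longleftrightarrow> i = whites t ! r" for i
    using paired_bounds[of t i "Suc (length t)"] by (auto simp: paired_snoc[OF m] l)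
  then show ?thesis unfolding pivot_left_def by simp
qed

text \<open>The left end of the pivot already carries the letter 1, so making both ends white
  changes only the last letter.\<close>

lemma butlast_plus_end: "butlast (plus_end (t @ [-1])) = t"
  unfolding plus_end_def pplus_def pivot
  using w_range[of r] w_restore[of r] t_facts(2) by (auto simp: list_update_append)

text \<open>The first step of the recursion stands apart because its pivot ends at the last vertex;
  from the second step on \<open>brk_joined\<close> applies, and the ratio
  \<open>u_(r-1) / u_r\<close> of the first step completes the telescoping.\<close>

lemma bracket_eq: "bracket (t @ [-1]) q = delta (t @ [-1]) q - delta (lowered t r) q -
   (\<Sum>j<r. (-1) ^ (r - 1 - j) * (cheb_u j (X - 1) / cheb_u r (X - 1)) * (delta (joined t j) q - delta (cleared t j) q))"
proof -
  let ?w = "whites t ! r"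
  have "whites (t @ [-1]) = butlast (whites t)" by (rule whites_snoc(3)[OF t_facts(1)])
  also have "\<dots> = take r (whites t)" using t_facts(3) by (simp add: butlast_conv_take)
  finally have wl: "whites_left (t @ [-1]) ?w = take r (whites t)"
    unfolding whites_left_def using filter_whites(1)[of r "[]"] by simp
  have b: "pbullet (t @ [-1]) ?w (length (t @ [-1])) = lowered t r"
    using w_range[of r] t_facts(2) by (auto simp: pbullet_def lowered_def list_update_append)
  have e: "bracket (t @ [-1]) = brk r (t @ [-1]) ?w (length (t @ [-1]))"
    unfolding bracket_def pivot wl using t_facts(3) by simp
  show ?thesis
  proof (cases r)
    case 0
    then show ?thesis unfolding e using b by simp
  next
    case (Suc j)
    have o: "pone (t @ [-1]) ?w (length (t @ [-1])) = joined t j"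
      using w_range[of r] t_facts(2) Suc by (auto simp: pone_def joined_def list_update_append)
    have l: "last (whites_left (t @ [-1]) ?w) = whites t ! j"
      unfolding wl using Suc t_facts(3) by (simp add: take_Suc_conv_app_nth)
    have "bracket (t @ [-1]) q = delta (t @ [-1]) q - delta (lowered t r) q -
       (cheb_u j (X - 1) / cheb_u (Suc j) (X - 1)) * brk j (joined t j) (whites t ! j) (whites t ! Suc j) q"
      unfolding e using b o l unfolding Suc by (simp only: brk.simps)
    also have "(cheb_u j (X - 1) / cheb_u (Suc j) (X - 1)) * brk j (joined t j) (whites t ! j) (whites t ! Suc j) q =
      (\<Sum>i\<le>j. (-1) ^ (j - i) * (cheb_u i (X - 1) / cheb_u (Suc j) (X - 1)) * (delta (joined t i) q - delta (cleared t i) q))"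
      using cheb_nz[of j] unfolding brk_joined[of j q, unfolded Suc, OF lessI] sum_distrib_left
      by (intro sum.cong) auto
    finally show ?thesis unfolding Suc by (simp add: lessThan_Suc_atMost)
  qed
qed

end

section \<open>The Gram matrix\<close>

lemma finite_paths: "finite (paths k r)"
proof (rule finite_subset)
  show "paths k r \<subseteq> {xs. set xs \<subseteq> {-1,0,1} \<and> length xs = k}" by (auto simp: paths_def motzkin_def)
qed (simp add: finite_lists_length_eq)

lemma sum_delta_paths: "a \<in> paths k r \<Longrightarrow> (\<Sum>p\<in>paths k r. delta a p * F p) = F a"
  using finite_paths[of k r] by (simp add: delta_def if_distrib[of "\<lambda>x. x * _"] cong: if_cong)

lemma formv_right: "formv k r v w = (\<Sum>q\<in>paths k r. w q * (\<Sum>p\<in>paths k r. v p * form r p q))"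
  unfolding formv_def by (subst sum.swap) (simp add: sum_distrib_left mult_ac)

lemma formv_delta_right: "q \<in> paths k r \<Longrightarrow> formv k r v (delta q) = (\<Sum>p\<in>paths k r. v p * form r p q)"
  unfolding formv_right by (rule sum_delta_paths)

lemma formv_expand: "formv k r v w = (\<Sum>q\<in>paths k r. w q * formv k r v (delta q))"
  unfolding formv_right[of k r v w] by (intro sum.cong refl) (simp add: formv_delta_right)

lemma formv_delta: "p \<in> paths k r \<Longrightarrow> q \<in> paths k r \<Longrightarrow> formv k r (delta p) (delta q) = form r p q"
  by (simp add: formv_delta_right sum_delta_paths)

lemma formv_sym: "formv k (int r) v w = formv k (int r) w v"
  unfolding formv_def by (subst sum.swap) (auto intro!: sum.cong simp: form_sym mult_ac)

text \<open>Multiplication by \<open>u_r\<close> clears all denominators and leaves an identity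
  between polynomials in \<open>x\<close>; \<open>bracket_count\<close> confirms it at every integer
  \<open>n > r + 1\<close>.\<close>

lemma formv_bracket_delta:
  assumes t: "t \<in> paths k (int (Suc r))" and q: "q @ [b] \<in> paths (Suc k) (int r)"
  shows "formv (Suc k) (int r) (bracket (t @ [-1])) (delta (q @ [b])) =
    (if b = -1 then cheb_u (Suc r) (X - 1) / cheb_u r (X - 1) * form (int (Suc r)) t q else 0)"
proof -
  let ?P = "paths (Suc k) (int r)" and ?F = "\<lambda>p. form (int r) p (q @ [b])" and ?f = "\<lambda>p. fpoly r p (q @ [b])"
  let ?u = "\<lambda>j. cheb_u j (X - 1) :: K"
  have m: "t @ [-1] \<in> ?P" "lowered t r \<in> ?P" by (rule down_mem[OF t], rule lowered_mem[OF t])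
  have mj: "joined t j \<in> ?P" "cleared t j \<in> ?P" if "j < r" for j
    using joined_mem[OF t that] cleared_mem[OF t that] by auto
  \<comment> \<open>\<open>G\<close> represents \<open>u_r\<close> times the pairing, and
    \<open>H\<close> its claimed value.\<close>
  define G where "G = chp r * (?f (t @ [-1]) - ?f (lowered t r)) -
     (\<Sum>j<r. (-1) ^ (r - 1 - j) * chp j * (?f (joined t j) - ?f (cleared t j)))"
  define H where "H = (if b = -1 then chp (Suc r) * fpoly (Suc r) t q else 0)"
  have q': "b = -1 \<Longrightarrow> q \<in> paths k (int (Suc r))" using q by (auto simp: snoc_paths add.commute)
  have GH: "G = H"
  proof (rule poly_eqI_large_nat[of "Suc r"])
    fix n assume n: "n > Suc r"
    have "poly G (of_nat n) = chb n r * (cnt n r (t @ [-1]) (q @ [b]) - cnt n r (lowered t r) (q @ [b])) -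
      (\<Sum>j<r. (-1) ^ (r - 1 - j) * chb n j * (cnt n r (joined t j) (q @ [b]) - cnt n r (cleared t j) (q @ [b])))"
      unfolding G_def using n
      by (simp add: poly_sum poly_chp fpoly(2)[OF m(1) q] fpoly(2)[OF m(2) q] fpoly(2)[OF mj(1) q] fpoly(2)[OF mj(2) q])
    also have "\<dots> = (if b = -1 then chb n (Suc r) * cnt n (Suc r) t q else 0)"
      unfolding lowered_def joined_def cleared_def
      by (rule bracket_count) (use n pathsD[OF t] pathsD[OF q] in auto)
    also have "\<dots> = poly H (of_nat n)"
      unfolding H_def using n fpoly(2)[OF t q', of n] poly_chp[of "Suc r" n] by (simp del: cheb_u.simps)
    finally show "poly G (of_nat n) = poly H (of_nat n)" .
  qed
  have "formv (Suc k) (int r) (bracket (t @ [-1])) (delta (q @ [b])) = (\<Sum>p\<in>?P. bracket (t @ [-1]) p * ?F p)"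
    by (rule formv_delta_right[OF q])
  also have "\<dots> = (\<Sum>p\<in>?P. delta (t @ [-1]) p * ?F p) - (\<Sum>p\<in>?P. delta (lowered t r) p * ?F p) -
      (\<Sum>p\<in>?P. \<Sum>j<r. (-1) ^ (r - 1 - j) * (?u j / ?u r) * (delta (joined t j) p * ?F p - delta (cleared t j) p * ?F p))"
    unfolding bracket_eq[OF t] sum_subtractf[symmetric]
    by (intro sum.cong refl) (simp add: left_diff_distrib sum_distrib_right mult.assoc)
  also have "(\<Sum>p\<in>?P. \<Sum>j<r. (-1) ^ (r - 1 - j) * (?u j / ?u r) * (delta (joined t j) p * ?F p - delta (cleared t j) p * ?F p))
     = (\<Sum>j<r. (-1) ^ (r - 1 - j) * (?u j / ?u r) *
         ((\<Sum>p\<in>?P. delta (joined t j) p * ?F p) - (\<Sum>p\<in>?P. delta (cleared t j) p * ?F p)))"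
    by (subst sum.swap) (simp only: sum_distrib_left sum_subtractf[symmetric])
  also have "\<dots> = (\<Sum>j<r. (-1) ^ (r - 1 - j) * (?u j / ?u r) * (?F (joined t j) - ?F (cleared t j)))"
    by (intro sum.cong refl) (simp add: sum_delta_paths mj)
  finally have E: "formv (Suc k) (int r) (bracket (t @ [-1])) (delta (q @ [b])) = ?F (t @ [-1]) - ?F (lowered t r) -
      (\<Sum>j<r. (-1) ^ (r - 1 - j) * (?u j / ?u r) * (?F (joined t j) - ?F (cleared t j)))"
    by (simp add: sum_delta_paths m)
  have neg: "(-1 :: K) ^ m = emb ((-1) ^ m)" for m by (simp add: emb_simps(5,6) emb_power)
  have u: "?u r \<noteq> 0" by (rule cheb_nz)
  have "?u r * formv (Suc k) (int r) (bracket (t @ [-1])) (delta (q @ [b])) =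
     ?u r * (?F (t @ [-1]) - ?F (lowered t r)) -
       (\<Sum>j<r. (-1) ^ (r - 1 - j) * ?u j * (?F (joined t j) - ?F (cleared t j)))"
    unfolding E right_diff_distrib[of "?u r" _ "sum _ _"] sum_distrib_left using u
    by (intro arg_cong2[where f = "(-)"] refl sum.cong) simp_all
  also have "(\<Sum>j<r. (-1) ^ (r - 1 - j) * ?u j * (?F (joined t j) - ?F (cleared t j))) =
      (\<Sum>j<r. emb ((-1) ^ (r - 1 - j) * chp j * (?f (joined t j) - ?f (cleared t j))))"
    by (intro sum.cong refl)
      (simp only: fpoly(1)[OF mj(1) q] fpoly(1)[OF mj(2) q] cheb_emb emb_simps(2,3) neg lessThan_iff)
  also have "?u r * (?F (t @ [-1]) - ?F (lowered t r)) - \<dots> = emb G"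
    unfolding G_def fpoly(1)[OF m(1) q] fpoly(1)[OF m(2) q] cheb_emb emb_sum emb_simps(2,3) ..
  also have "\<dots> = (if b = -1 then ?u (Suc r) * form (int (Suc r)) t q else 0)"
    unfolding GH H_def using fpoly(1)[OF t q'] by (auto simp: cheb_emb emb_simps(3) Zero_fract_def simp del: cheb_u.simps of_nat_Suc)
  finally show ?thesis using u by (auto simp: field_simps)
qed

section \<open>The bracketed family as a basis\<close>

lemma bracket_outside:
  assumes t: "t \<in> paths k (int (Suc r))" and "q \<notin> paths (Suc k) (int r)"
  shows "bracket (t @ [-1]) q = 0"
proof -
  have "delta a q = 0" if "a \<in> paths (Suc k) (int r)" for a
    using that assms(2) by (auto simp: delta_def)
  then show ?thesis unfolding bracket_eq[OF t]
    using down_mem[OF t] lowered_mem[OF t] joined_mem[OF t] cleared_mem[OF t] by simp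
qed

text \<open>All terms of the bracket except the leading one end in 0 or 1. This gives both the
  triangular change of basis and the reduction of the pairing of two brackets.\<close>

lemma bracket_last:
  assumes t: "t \<in> paths k (int (Suc r))" and "last q = -1"
  shows "bracket (t @ [-1]) q = delta (t @ [-1]) q"
proof -
  have "delta (lowered t r) q = 0" "delta (joined t j) q = 0" "delta (cleared t j) q = 0" for j
    using assms(2) by (auto simp: delta_def lowered_def joined_def cleared_def)
  then show ?thesis unfolding bracket_eq[OF t] by simp
qed

lemma paths_end_cases:
  assumes "p \<in> paths_end (Suc k) r l"
  obtains t where "p = t @ [l]" "t \<in> paths k (r - l)"
proof -
  have "p \<noteq> []" "last p = l" "p \<in> paths (Suc k) r" using assms by (auto simp: paths_end_def paths_def)
  then have e: "p = butlast p @ [l]" by (metis append_butlast_last_id)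
  moreover have "butlast p \<in> paths k (r - l)" using \<open>p \<in> paths (Suc k) r\<close> by (subst (asm) e) (simp add: snoc_paths)
  ultimately show thesis using that by blast
qed

lemma bij_butlast:
  assumes "l \<in> {-1,0,1}" "r \<ge> 0"
  shows "bij_betw butlast (paths_end (Suc k) r l) (paths k (r - l))"
proof (rule bij_betw_byWitness[where f' = "\<lambda>t. t @ [l]"])
  show "\<forall>p\<in>paths_end (Suc k) r l. butlast p @ [l] = p" by (auto elim!: paths_end_cases)
  show "butlast ` paths_end (Suc k) r l \<subseteq> paths k (r - l)" by (auto elim!: paths_end_cases)
  show "(\<lambda>t. t @ [l]) ` paths k (r - l) \<subseteq> paths_end (Suc k) r l" using assms by (auto simp: paths_end_def snoc_paths)
qed simp

lemma tbasis_outside: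
  assumes "p \<in> paths (Suc k) (int r)" "q \<notin> paths (Suc k) (int r)"
  shows "tbasis p q = 0"
proof (cases "last p = -1")
  case True
  then have "p \<in> paths_end (Suc k) (int r) (-1)" using assms by (simp add: paths_end_def)
  then obtain t where t: "p = t @ [-1]" "t \<in> paths k (int r - -1)" by (rule paths_end_cases)
  then have "t \<in> paths k (int (Suc r))" by (simp add: add.commute)
  then show ?thesis using bracket_outside[OF _ assms(2)] t(1) by (simp add: tbasis_def)
next
  case False
  then show ?thesis using assms by (auto simp: tbasis_def delta_def)
qed

lemma tbasis_last:
  assumes "p \<in> paths (Suc k) (int r)" "last q = -1"
  shows "tbasis p q = delta p q"
proof (cases "last p = -1")
  case True
  then have "p \<in> paths_end (Suc k) (int r) (-1)" using assms by (simp add: paths_end_def)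
  then obtain t where t: "p = t @ [-1]" "t \<in> paths k (int r - -1)" by (rule paths_end_cases)
  then have "t \<in> paths k (int (Suc r))" by (simp add: add.commute)
  then show ?thesis using bracket_last[OF _ assms(2)] t(1) by (simp add: tbasis_def)
qed (simp add: tbasis_def)

lemma tbasis_coeff:
  assumes q: "q \<in> paths (Suc k) (int r)"
  shows "(\<Sum>p\<in>paths (Suc k) (int r). c p * tbasis p q) =
    (if last q = -1 then c q else c q + (\<Sum>p\<in>paths_end (Suc k) (int r) (-1). c p * bracket p q))"
proof -
  let ?P = "paths (Suc k) (int r)"
  have D: "(\<Sum>p\<in>?P. c p * delta p q) = c q"
    using finite_paths q by (simp add: delta_def if_distrib cong: if_cong)
  show ?thesis
  proof (cases "last q = -1")
    case True
    have "(\<Sum>p\<in>?P. c p * tbasis p q) = (\<Sum>p\<in>?P. c p * delta p q)"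
      by (intro sum.cong refl) (simp add: tbasis_last True)
    then show ?thesis using D True by simp
  next
    case False
    have "c p * tbasis p q = c p * delta p q + (if p \<in> {p. last p = -1} then c p * bracket p q else 0)" for p
      using False by (auto simp: tbasis_def delta_def)
    then have "(\<Sum>p\<in>?P. c p * tbasis p q) = c q + (\<Sum>p\<in>?P. if p \<in> {p. last p = -1} then c p * bracket p q else 0)"
      by (simp only: sum.distrib D)
    also have "(\<Sum>p\<in>?P. if p \<in> {p. last p = -1} then c p * bracket p q else 0) = (\<Sum>p\<in>paths_end (Suc k) (int r) (-1). c p * bracket p q)"
      unfolding sum.inter_restrict[OF finite_paths, symmetric] by (rule sum.cong) (auto simp: paths_end_def)
    finally show ?thesis using False by simp
  qed
qed

text \<open>The transition from the standard basis is unitriangular: a bracket adds to its leading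
  path only paths that do not end in -1.\<close>

lemma tbasis_basis:
  fixes v :: vec
  assumes v: "\<forall>q. q \<notin> paths (Suc k) (int r) \<longrightarrow> v q = 0"
  shows "\<exists>!c::int list \<Rightarrow> K. (\<forall>p. p \<notin> paths (Suc k) (int r) \<longrightarrow> c p = 0) \<and>
     v = (\<lambda>q. \<Sum>p\<in>paths (Suc k) (int r). c p * tbasis p q)"
proof -
  let ?P = "paths (Suc k) (int r)" and ?E = "paths_end (Suc k) (int r) (-1)"
  have lastE: "p \<in> ?E \<Longrightarrow> last p = -1 \<and> p \<in> ?P" for p by (simp add: paths_end_def)
  have iff: "v = (\<lambda>q. \<Sum>p\<in>?P. c p * tbasis p q) \<longleftrightarrow>
     (\<forall>q\<in>?P. v q = (if last q = -1 then c q else c q + (\<Sum>p\<in>?E. c p * bracket p q)))" for c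
  proof -
    have "(\<Sum>p\<in>?P. c p * tbasis p q) = 0" if "q \<notin> ?P" for q
      using tbasis_outside[OF _ that] by simp
    then have "v = (\<lambda>q. \<Sum>p\<in>?P. c p * tbasis p q) \<longleftrightarrow> (\<forall>q\<in>?P. v q = (\<Sum>p\<in>?P. c p * tbasis p q))"
      using v by (metis (mono_tags, lifting) ext)
    then show ?thesis using tbasis_coeff by (metis (no_types, lifting))
  qed
  \<comment> \<open>Coefficients at paths ending in -1 are read off from \<open>v\<close>, and they
    fix the corrections at all other paths.\<close>
  define c0 where "c0 q = (if q \<notin> ?P then 0 else if last q = -1 then v q else v q - (\<Sum>p\<in>?E. v p * bracket p q))" for q
  show ?thesis unfolding iff
  proof (rule ex1I[of _ c0])
    have "(\<Sum>p\<in>?E. c0 p * bracket p q) = (\<Sum>p\<in>?E. v p * bracket p q)" for q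
      by (intro sum.cong refl) (use lastE in \<open>simp add: c0_def\<close>)
    then show "(\<forall>p. p \<notin> ?P \<longrightarrow> c0 p = 0) \<and>
      (\<forall>q\<in>?P. v q = (if last q = -1 then c0 q else c0 q + (\<Sum>p\<in>?E. c0 p * bracket p q)))"
      by (simp add: c0_def)
  next
    fix c assume c: "(\<forall>p. p \<notin> ?P \<longrightarrow> c p = 0) \<and>
      (\<forall>q\<in>?P. v q = (if last q = -1 then c q else c q + (\<Sum>p\<in>?E. c p * bracket p q)))"
    have "c p = v p" if "p \<in> ?E" for p using c lastE[OF that] by auto
    then have "(\<Sum>p\<in>?E. c p * bracket p q) = (\<Sum>p\<in>?E. v p * bracket p q)" for q by simp
    with c show "c = c0" unfolding c0_def by (intro ext) (auto simp: algebra_simps)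
  qed
qed

theorem mainTheorem15:
  fixes k r :: nat
  assumes "k \<ge> 2" and "r \<le> k"
  shows "(\<forall>v::vec. (\<forall>q. q \<notin> paths k (int r) \<longrightarrow> v q = 0) \<longrightarrow>
            (\<exists>!c::int list \<Rightarrow> K. (\<forall>p. p \<notin> paths k (int r) \<longrightarrow> c p = 0) \<and>
               v = (\<lambda>q. \<Sum>p\<in>paths k (int r). c p * tbasis p q)))
    \<and> bij_betw butlast (paths_end k (int r) 1) (paths (k - 1) (int r - 1))
    \<and> bij_betw butlast (paths_end k (int r) 0) (paths (k - 1) (int r))
    \<and> bij_betw (\<lambda>p. butlast (plus_end p)) (paths_end k (int r) (-1)) (paths (k - 1) (int r + 1))
    \<and> (\<forall>p\<in>paths_end k (int r) 1. \<forall>q\<in>paths_end k (int r) 1.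
         form (int r) p q = form (int r - 1) (butlast p) (butlast q))
    \<and> (\<forall>p\<in>paths_end k (int r) 0. \<forall>q\<in>paths_end k (int r) 0.
         form (int r) p q = form (int r) (butlast p) (butlast q))
    \<and> (\<forall>p\<in>paths_end k (int r) (-1). \<forall>q\<in>paths_end k (int r) (-1).
         formv k (int r) (bracket p) (bracket q) =
           cheb_u (r + 1) (X - 1) / cheb_u r (X - 1) *
             form (int r + 1) (butlast (plus_end p)) (butlast (plus_end q)))
    \<and> (\<forall>p\<in>paths k (int r). \<forall>q\<in>paths k (int r). last p \<noteq> last q \<longrightarrow>
         formv k (int r) (tbasis p) (tbasis q) = 0)"
proof -
  obtain k' where k: "k = Suc k'" using assms(1) by (cases k) auto
  have mem: "p \<in> paths k (int r)" if "p \<in> paths_end k (int r) l" for p l using that by (simp add: paths_end_def)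
  have down: "\<exists>t. p = t @ [-1] \<and> t \<in> paths k' (int (Suc r))" if "p \<in> paths_end k (int r) (-1)" for p
    using that unfolding k by (rule paths_end_cases) (simp add: add.commute)
  have plus: "butlast (plus_end p) = butlast p" if "p \<in> paths_end k (int r) (-1)" for p
    using down[OF that] butlast_plus_end by fastforce
  have bd: "formv k (int r) (bracket p) (delta q) = (if last q = -1 then
      cheb_u (Suc r) (X - 1) / cheb_u r (X - 1) * form (int (Suc r)) (butlast p) (butlast q) else 0)"
    if p: "p \<in> paths_end k (int r) (-1)" and q: "q \<in> paths k (int r)" for p q
  proof -
    obtain t where t: "p = t @ [-1]" "t \<in> paths k' (int (Suc r))" using down[OF p] by blast
    have "q \<in> paths_end k (int r) (last q)" using q by (simp add: paths_end_def)
    then obtain s where s: "q = s @ [last q]" unfolding k by (rule paths_end_cases)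
    then show ?thesis using formv_bracket_delta[OF t(2), of s "last q"] q t(1) unfolding k by (metis butlast_snoc)
  qed
  have bb: "formv k (int r) (bracket p) (bracket q) = cheb_u (Suc r) (X - 1) / cheb_u r (X - 1) * form (int (Suc r)) (butlast p) (butlast q)"
    if p: "p \<in> paths_end k (int r) (-1)" and q: "q \<in> paths_end k (int r) (-1)" for p q
  proof -
    obtain s where s: "q = s @ [-1]" "s \<in> paths k' (int (Suc r))" using down[OF q] by blast
    have "formv k (int r) (bracket p) (bracket q) = (\<Sum>q'\<in>paths k (int r). bracket q q' * formv k (int r) (bracket p) (delta q'))"
      by (rule formv_expand)
    \<comment> \<open>\<open>bracket p\<close> is orthogonal to every path not ending in -1, and on
      the remaining paths \<open>bracket q\<close> agrees with \<open>delta q\<close>. Hence pairing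
      with \<open>bracket q\<close> is pairing with \<open>q\<close>.\<close>
    also have "\<dots> = (\<Sum>q'\<in>paths k (int r). delta q q' * formv k (int r) (bracket p) (delta q'))"
    proof (intro sum.cong refl)
      fix q' assume q': "q' \<in> paths k (int r)"
      show "bracket q q' * formv k (int r) (bracket p) (delta q') = delta q q' * formv k (int r) (bracket p) (delta q')"
      proof (cases "last q' = -1")
        case True
        then show ?thesis using bracket_last[OF s(2)] s(1) by simp
      next
        case False
        then show ?thesis using bd[OF p q'] by simp
      qed
    qed
    also have "\<dots> = formv k (int r) (bracket p) (delta q)" by (rule sum_delta_paths[OF mem[OF q]])
    finally show ?thesis using bd[OF p mem[OF q]] s(1) by simp
  qed
  have last_cases: "last p \<in> {-1,0,1}" if "p \<in> paths k (int r)" for p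
  proof -
    have "p \<noteq> []" "motzkin p" using that k by (auto simp: paths_def)
    then show ?thesis unfolding motzkin_def using last_in_set by blast
  qed
  have off: "formv k (int r) (tbasis p) (tbasis q) = 0"
    if p: "p \<in> paths k (int r)" and q: "q \<in> paths k (int r)" and ne: "last p \<noteq> last q" for p q
  proof -
    have 1: "formv k (int r) (tbasis p') (tbasis q') = 0"
      if "p' \<in> paths k (int r)" "q' \<in> paths k (int r)" "last p' = -1" "last q' \<noteq> -1" for p' q'
      using bd[of p' q'] that by (simp add: tbasis_def paths_end_def)
    have 2: "formv k (int r) (tbasis p') (tbasis q') = 0"
      if a: "p' \<in> paths k (int r)" "q' \<in> paths k (int r)" "last p' = 1" "last q' = 0" for p' q'
    proof -
      have "p' \<in> paths_end k (int r) 1" "q' \<in> paths_end k (int r) 0" using a by (simp_all add: paths_end_def)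
      then obtain t s where "p' = t @ [1]" "q' = s @ [0]" unfolding k by (metis paths_end_cases)
      then show ?thesis using a form_up_flat[of t k' r s] formv_delta[OF a(1,2)] by (simp add: tbasis_def k)
    qed
    \<comment> \<open>By symmetry of the form two situations remain: a bracket against an
      unbracketed path, and a path ending in 1 against one ending in 0.\<close>
    consider "last p = -1" "last q \<noteq> -1" | "last q = -1" "last p \<noteq> -1" | "last p = 1" "last q = 0" | "last p = 0" "last q = 1"
      using last_cases[OF p] last_cases[OF q] ne by auto
    then show ?thesis
      by cases (use 1[OF p q] 1[OF q p] 2[OF p q] 2[OF q p] formv_sym[of k r "tbasis p" "tbasis q"] in simp_all)
  qed
  show ?thesis
  proof (intro conjI)
    show "\<forall>v::vec. (\<forall>q. q \<notin> paths k (int r) \<longrightarrow> v q = 0) \<longrightarrow>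
            (\<exists>!c::int list \<Rightarrow> K. (\<forall>p. p \<notin> paths k (int r) \<longrightarrow> c p = 0) \<and>
               v = (\<lambda>q. \<Sum>p\<in>paths k (int r). c p * tbasis p q))"
      unfolding k by (intro allI impI, rule tbasis_basis)
    show "bij_betw butlast (paths_end k (int r) 1) (paths (k - 1) (int r - 1))"
      "bij_betw butlast (paths_end k (int r) 0) (paths (k - 1) (int r))"
      using bij_butlast[of 1 "int r" k'] bij_butlast[of 0 "int r" k'] by (simp_all add: k)
    have "bij_betw butlast (paths_end k (int r) (-1)) (paths (k - 1) (int r + 1))"
      using bij_butlast[of "-1" "int r" k'] by (simp add: k)
    then show "bij_betw (\<lambda>p. butlast (plus_end p)) (paths_end k (int r) (-1)) (paths (k - 1) (int r + 1))"
      using bij_betw_cong[of "paths_end k (int r) (-1)" "\<lambda>p. butlast (plus_end p)" butlast] plus by blast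
    show "\<forall>p\<in>paths_end k (int r) 1. \<forall>q\<in>paths_end k (int r) 1.
         form (int r) p q = form (int r - 1) (butlast p) (butlast q)"
    proof (intro ballI)
      fix p q assume a: "p \<in> paths_end k (int r) 1" "q \<in> paths_end k (int r) 1"
      then obtain t s where "p = t @ [1]" "q = s @ [1]" unfolding k by (metis paths_end_cases)
      then show "form (int r) p q = form (int r - 1) (butlast p) (butlast q)"
        using form_up[of t k' r s] mem a k by auto
    qed
    show "\<forall>p\<in>paths_end k (int r) 0. \<forall>q\<in>paths_end k (int r) 0.
         form (int r) p q = form (int r) (butlast p) (butlast q)"
    proof (intro ballI)
      fix p q assume a: "p \<in> paths_end k (int r) 0" "q \<in> paths_end k (int r) 0"
      then obtain t s where "p = t @ [0]" "q = s @ [0]" unfolding k by (metis paths_end_cases)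
      then show "form (int r) p q = form (int r) (butlast p) (butlast q)"
        using form_flat[of t k' r s] mem a k by auto
    qed
    show "\<forall>p\<in>paths_end k (int r) (-1). \<forall>q\<in>paths_end k (int r) (-1).
         formv k (int r) (bracket p) (bracket q) =
           cheb_u (r + 1) (X - 1) / cheb_u r (X - 1) *
             form (int r + 1) (butlast (plus_end p)) (butlast (plus_end q))"
      using bb plus by (simp add: add.commute)
    show "\<forall>p\<in>paths k (int r). \<forall>q\<in>paths k (int r). last p \<noteq> last q \<longrightarrow>
         formv k (int r) (tbasis p) (tbasis q) = 0"
      using off by blast
  qed
qed

end
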